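(* Let $\lambda\in P^+$ be a dominant coweight and let $\mu\in P$. Then $\mathcal{P}(\vec\lambda)_\mu\neq\emptyset$ if and only if $\mu\in\Pi_\lambda$.
   Context: Root system. $R$ is a reduced irreducible root system in an $n$-dimensional real inner product space $\mathfrak{h}_{\mathbb R}$ with inner product $\langle\cdot,\cdot\rangle$; $\alpha^\vee=2\alpha/\langle\alpha,\alpha\rangle$; $\alpha_1,\dots,\alpha_n$ are simple roots, $R^+$ the corresponding positive roots, $\theta$ the highest root. $Q=\sum_i\mathbb Z\alpha_i^\vee$ is the coroot lattice and $Q^+=\sum_i\mathbb Z_{\ge0}\alpha_i^\vee$. $\omega_1,\dots,\omega_n$ is the basis with $\langle\omega_i,\alpha_j\rangle=\delta_{ij}$; $P=\sum_i\mathbb Z\omega_i$ (coweight lattice) and $P^+=\sum_i\mathbb Z_{\ge0}\omega_i$ (dominant coweights). $W_0$ is the finite Weyl group generated by the reflections $s_\alpha$ in $H_\alpha=\{x:\langle x,\alpha\rangle=0\}$, with $s_i=s_{\alpha_i}$, $1\le i\le n$. For $\lambda\in P^+$, $\Pi_\lambda=\bigcap_{w\in W_0}w(\lambda-Q^+)$ is the saturated set with highest coweight $\lambda$. Affine Weyl groups. For $\alpha\in R$, $k\in\mathbb Z$ let $H_{\alpha+k\delta}=\{x\in\mathfrak h_{\mathbb R}:\langle x,\alpha\rangle=-k\}$, with reflection $s_{\alpha+k\delta}(x)=x-(\langle x,\alpha\rangle+k)\alpha^\vee$. The affine Weyl group $W=Q\rtimes W_0$ is generated by all these reflections; it is a Coxeter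 group with generators $s_0,\dots,s_n$, where $s_0=s_{-\theta+\delta}$. Alcoves are the open connected components of the complement of all $H_{\alpha+k\delta}$; the fundamental alcove is $c_0=\{x:\langle x,\alpha_i\rangle>0\ (1\le i\le n),\ \langle x,\theta\rangle<1\}$. $W$ is identified with the set of alcoves via $w\leftrightarrow wc_0$. $t_\mu$ is translation by $\mu$, and $\tilde W=P\rtimes W_0$ is the extended affine Weyl group, with length $\ell(w)$ equal to the number of hyperplanes $H_{\alpha+k\delta}$ separating $c_0$ from $wc_0$. With $\Omega=\{w\in\tilde W:\ell(w)=0\}$ we have $\tilde W=W\rtimes\Omega$. A reduced expression $\vec w=s_{i_1}\cdots s_{i_\ell}\gamma$ of $w\in\tilde W$ has $\ell=\ell(w)$, $\gamma\in\Omega$; it is also called a minimal length walk to $w$. Alcove walks. For $\alpha\in R^+$, the positive side of $H_{\alpha+k\delta}$ is $\{x:\langle x,\alpha\rangle\ge-k\}$ and the negative side is $\{x:\langle x,\alpha\rangle\le-k\}$. A positively folded alcove walk of type $\vec w=s_{i_1}\cdots s_{i_\ell}\gamma$ is a sequence of alcoves $x_0=1,x_1,\dots,x_\ell\in W$ where, writing $x=x_{k-1}$, $s=s_{i_k}$, and $H$ for the hyperplane separating the adjacent alcoves $x$ and $xs$, the $k$th step is one of: a positive crossing ($x$ is on the negative and $xs$ on the positive side of $H$, and $x_k=xs$); a negative crossing ($x$ is on the positive and $xs$ on the negative side of $H$, and $x_k=xs$); or a positive fold ($x$ is on the positive and $xs$ on the negative side of $H$, and $x_k=x$). The walk ends by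 multiplying by $\gamma$: its end alcove is $\mathrm{end}(p)=x_\ell\gamma\in\tilde W$. The set of paths. For $\lambda\in P^+$ let $W_{0\lambda}=\{w\in W_0:w\lambda=\lambda\}$, let $W_0^\lambda$ be the set of minimal length representatives of the cosets in $W_0/W_{0\lambda}$, and let $m_\lambda$ be the minimal length element of $W_0t_\lambda W_0$. Fix a minimal length walk $\vec m_\lambda$ to $m_\lambda$ and a minimal length walk $\vec u$ to each $u\in W_0^\lambda$; $\vec u\cdot\vec m_\lambda$ denotes concatenation. Then $\mathcal P(\vec\lambda)_\mu$ is the set of all positively folded alcove walks $p$ of type $\vec u\cdot\vec m_\lambda$, for some $u\in W_0^\lambda$, with $\mathrm{end}(p)\in t_\mu W_0$. *)

theory Defs
  imports "HOL-Analysis.Analysis"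
begin

text \<open>
  The ambient space is a type \<open>'a\<close> of class \<^class>\<open>euclidean_space\<close>, of dimension
  \<open>n = DIM('a)\<close>. Families of \<open>n\<close> vectors such as the simple roots are functions
  \<open>nat \<Rightarrow> 'a\<close> of which only the values on \<open>{1..n}\<close> are used.
\<close>

subsection \<open>Root systems\<close>

definition coroot :: "'a::euclidean_space \<Rightarrow> 'a" where
  "coroot a = (2 / (a \<bullet> a)) *\<^sub>R a"

definition hyperplane :: "'a::euclidean_space \<Rightarrow> int \<Rightarrow> 'a set" where
  "hyperplane a k = {x. x \<bullet> a = - of_int k}"

definition reflection :: "'a::euclidean_space \<Rightarrow> int \<Rightarrow> 'a \<Rightarrow> 'a" where
  "reflection a k x = x - (x \<bullet> a + of_int k) *\<^sub>R coroot a"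

definition root_system :: "'a::euclidean_space set \<Rightarrow> bool" where
  "root_system R \<longleftrightarrow>
     finite R \<and> 0 \<notin> R \<and> span R = UNIV \<and>
     (\<forall>a\<in>R. reflection a 0 ` R = R) \<and>
     (\<forall>a\<in>R. \<forall>b\<in>R. b \<bullet> coroot a \<in> \<int>)"

definition reduced_root_system :: "'a::euclidean_space set \<Rightarrow> bool" where
  "reduced_root_system R \<longleftrightarrow> root_system R \<and> (\<forall>a\<in>R. R \<inter> range (\<lambda>c. c *\<^sub>R a) = {a, - a})"

definition irreducible_root_system :: "'a::euclidean_space set \<Rightarrow> bool" where
  "irreducible_root_system R \<longleftrightarrow> root_system R \<and> R \<noteq> {} \<and>
     \<not> (\<exists>A B. A \<noteq> {} \<and> B \<noteq> {} \<and> A \<inter> B = {} \<and> A \<union> B = R \<and> (\<forall>a\<in>A. \<forall>b\<in>B. a \<bullet> b = 0))"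

definition nat_combinations :: "(nat \<Rightarrow> 'a::euclidean_space) \<Rightarrow> 'a set" where
  "nat_combinations v = {\<Sum>i=1..DIM('a). real (c i) *\<^sub>R v i | c :: nat \<Rightarrow> nat. True}"

definition int_combinations :: "(nat \<Rightarrow> 'a::euclidean_space) \<Rightarrow> 'a set" where
  "int_combinations v = {\<Sum>i=1..DIM('a). real_of_int (c i) *\<^sub>R v i | c :: nat \<Rightarrow> int. True}"

definition simple_roots :: "'a::euclidean_space set \<Rightarrow> (nat \<Rightarrow> 'a) \<Rightarrow> bool" where
  "simple_roots R \<alpha> \<longleftrightarrow>
     \<alpha> ` {1..DIM('a)} \<subseteq> R \<and> inj_on \<alpha> {1..DIM('a)} \<and> independent (\<alpha> ` {1..DIM('a)}) \<and>
     (\<forall>b\<in>R. b \<in> nat_combinations \<alpha> \<or> - b \<in> nat_combinations \<alpha>)"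

definition positive_roots :: "'a::euclidean_space set \<Rightarrow> (nat \<Rightarrow> 'a) \<Rightarrow> 'a set" where
  "positive_roots R \<alpha> = R \<inter> nat_combinations \<alpha>"

definition highest_root :: "'a::euclidean_space set \<Rightarrow> (nat \<Rightarrow> 'a) \<Rightarrow> 'a \<Rightarrow> bool" where
  "highest_root R \<alpha> \<theta> \<longleftrightarrow> \<theta> \<in> R \<and> (\<forall>b\<in>R. \<theta> - b \<in> nat_combinations \<alpha>)"

definition fundamental_coweights :: "(nat \<Rightarrow> 'a::euclidean_space) \<Rightarrow> (nat \<Rightarrow> 'a) \<Rightarrow> bool" where
  "fundamental_coweights \<alpha> \<omega> \<longleftrightarrow>
     (\<forall>i\<in>{1..DIM('a)}. \<forall>j\<in>{1..DIM('a)}. \<omega> i \<bullet> \<alpha> j = (if i = j then 1 else 0))"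


subsection \<open>Lattices and saturated sets\<close>

definition pos_coroot_cone :: "(nat \<Rightarrow> 'a::euclidean_space) \<Rightarrow> 'a set" where
  "pos_coroot_cone \<alpha> = nat_combinations (\<lambda>i. coroot (\<alpha> i))"

definition coweights :: "(nat \<Rightarrow> 'a::euclidean_space) \<Rightarrow> 'a set" where
  "coweights \<omega> = int_combinations \<omega>"

definition dominant_coweights :: "(nat \<Rightarrow> 'a::euclidean_space) \<Rightarrow> 'a set" where
  "dominant_coweights \<omega> = nat_combinations \<omega>"

text \<open>Closing under products suffices below, because all generators are involutions.\<close>

inductive_set generated_by_reflections :: "('a \<Rightarrow> 'a) set \<Rightarrow> ('a \<Rightarrow> 'a) set"
  for S :: "('a \<Rightarrow> 'a) set" where
  id: "id \<in> generated_by_reflections S"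
| comp: "s \<in> S \<Longrightarrow> w \<in> generated_by_reflections S \<Longrightarrow> s \<circ> w \<in> generated_by_reflections S"

definition finite_weyl :: "'a::euclidean_space set \<Rightarrow> ('a \<Rightarrow> 'a) set" where
  "finite_weyl R = generated_by_reflections {reflection a 0 | a. a \<in> R}"

definition saturated_set ::
  "'a::euclidean_space set \<Rightarrow> (nat \<Rightarrow> 'a) \<Rightarrow> 'a \<Rightarrow> 'a set" where
  "saturated_set R \<alpha> l = (\<Inter>w\<in>finite_weyl R. w ` {l - q | q. q \<in> pos_coroot_cone \<alpha>})"


subsection \<open>Affine Weyl groups\<close>

text \<open>
  Elements of the (extended) affine Weyl group are affine maps of the ambient space, and
  \<open>w\<close> stands for the alcove \<open>w ` fund_alcove \<alpha> \<theta>\<close>. Translation by \<open>m\<close> is \<open>(+) m\<close>.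
\<close>

definition affine_weyl :: "'a::euclidean_space set \<Rightarrow> ('a \<Rightarrow> 'a) set" where
  "affine_weyl R = generated_by_reflections {reflection a k | a k. a \<in> R}"

definition ext_affine_weyl ::
  "'a::euclidean_space set \<Rightarrow> (nat \<Rightarrow> 'a) \<Rightarrow> ('a \<Rightarrow> 'a) set" where
  "ext_affine_weyl R \<omega> = {(+) m \<circ> w | m w. m \<in> coweights \<omega> \<and> w \<in> finite_weyl R}"

definition simple_reflection ::
  "(nat \<Rightarrow> 'a::euclidean_space) \<Rightarrow> 'a \<Rightarrow> nat \<Rightarrow> 'a \<Rightarrow> 'a" where
  "simple_reflection \<alpha> \<theta> i = (if i = 0 then reflection (- \<theta>) 1 else reflection (\<alpha> i) 0)"

definition fund_alcove :: "(nat \<Rightarrow> 'a::euclidean_space) \<Rightarrow> 'a \<Rightarrow> 'a set" where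
  "fund_alcove \<alpha> \<theta> = {x. (\<forall>i\<in>{1..DIM('a)}. x \<bullet> \<alpha> i > 0) \<and> x \<bullet> \<theta> < 1}"

definition pos_side :: "'a::euclidean_space \<Rightarrow> int \<Rightarrow> 'a set" where
  "pos_side a k = {x. x \<bullet> a \<ge> - of_int k}"

definition neg_side :: "'a::euclidean_space \<Rightarrow> int \<Rightarrow> 'a set" where
  "neg_side a k = {x. x \<bullet> a \<le> - of_int k}"

text \<open>
  Hyperplanes are counted as sets, since \<open>hyperplane a k = hyperplane (- a) (- k)\<close>.
  Letting \<open>a\<close> run over all of \<open>R\<close> covers both ways round of being on opposite sides;
  the closed half-spaces do no harm, as alcoves are open and nonempty.
\<close>

definition separating_hyperplanes ::
  "'a::euclidean_space set \<Rightarrow> 'a set \<Rightarrow> 'a set \<Rightarrow> 'a set set" where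
  "separating_hyperplanes R A B =
     {hyperplane a k | a k. a \<in> R \<and> A \<subseteq> pos_side a k \<and> B \<subseteq> neg_side a k}"

definition weyl_length ::
  "'a::euclidean_space set \<Rightarrow> (nat \<Rightarrow> 'a) \<Rightarrow> 'a \<Rightarrow> ('a \<Rightarrow> 'a) \<Rightarrow> nat" where
  "weyl_length R \<alpha> \<theta> w =
     card (separating_hyperplanes R (fund_alcove \<alpha> \<theta>) (w ` fund_alcove \<alpha> \<theta>))"

definition length_zero_elements ::
  "'a::euclidean_space set \<Rightarrow> (nat \<Rightarrow> 'a) \<Rightarrow> 'a \<Rightarrow> (nat \<Rightarrow> 'a) \<Rightarrow> ('a \<Rightarrow> 'a) set" where
  "length_zero_elements R \<alpha> \<theta> \<omega> = {w \<in> ext_affine_weyl R \<omega>. weyl_length R \<alpha> \<theta> w = 0}"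

text \<open>\<open>is\<close> lists the indices \<open>i\<^sub>1, \<dots>, i\<^sub>l\<close> of the expression \<open>s\<^bsub>i\<^sub>1\<^esub> \<cdots> s\<^bsub>i\<^sub>l\<^esub> \<gamma>\<close>.\<close>

definition reduced_expression ::
  "'a::euclidean_space set \<Rightarrow> (nat \<Rightarrow> 'a) \<Rightarrow> 'a \<Rightarrow> (nat \<Rightarrow> 'a) \<Rightarrow>
   nat list \<Rightarrow> ('a \<Rightarrow> 'a) \<Rightarrow> ('a \<Rightarrow> 'a) \<Rightarrow> bool" where
  "reduced_expression R \<alpha> \<theta> \<omega> is \<gamma> w \<longleftrightarrow>
     set is \<subseteq> {0..DIM('a)} \<and> \<gamma> \<in> length_zero_elements R \<alpha> \<theta> \<omega> \<and>
     w = foldr (\<lambda>i v. simple_reflection \<alpha> \<theta> i \<circ> v) is \<gamma> \<and>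
     length is = weyl_length R \<alpha> \<theta> w"


subsection \<open>Positively folded alcove walks\<close>

text \<open>
  The hyperplane \<open>H\<close> separating the adjacent alcoves \<open>x\<close> and \<open>x \<circ> s\<close> is unique, so saying
  that these lie on given sides of \<open>H\<close> amounts to the existence of a hyperplane with
  them on those sides. Sides are named with respect to positive roots.
\<close>

definition negative_to_positive ::
  "'a::euclidean_space set \<Rightarrow> (nat \<Rightarrow> 'a) \<Rightarrow> 'a \<Rightarrow> ('a \<Rightarrow> 'a) \<Rightarrow> ('a \<Rightarrow> 'a) \<Rightarrow> bool" where
  "negative_to_positive R \<alpha> \<theta> x y \<longleftrightarrow>
     (\<exists>a\<in>positive_roots R \<alpha>. \<exists>k. x ` fund_alcove \<alpha> \<theta> \<subseteq> neg_side a k \<and>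
                                  y ` fund_alcove \<alpha> \<theta> \<subseteq> pos_side a k)"

definition folded_step ::
  "'a::euclidean_space set \<Rightarrow> (nat \<Rightarrow> 'a) \<Rightarrow> 'a \<Rightarrow> nat \<Rightarrow> ('a \<Rightarrow> 'a) \<Rightarrow> ('a \<Rightarrow> 'a) \<Rightarrow> bool" where
  "folded_step R \<alpha> \<theta> i x x' \<longleftrightarrow>
     (let xs = x \<circ> simple_reflection \<alpha> \<theta> i in
        negative_to_positive R \<alpha> \<theta> x xs \<and> x' = xs       \<comment> \<open>positive crossing\<close>
      \<or> negative_to_positive R \<alpha> \<theta> xs x \<and> x' = xs       \<comment> \<open>negative crossing\<close>
      \<or> negative_to_positive R \<alpha> \<theta> xs x \<and> x' = x)       \<comment> \<open>positive fold\<close>"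

text \<open>The closing factor \<open>\<gamma>\<close> of the type only affects the end of the walk.\<close>

definition folded_walk ::
  "'a::euclidean_space set \<Rightarrow> (nat \<Rightarrow> 'a) \<Rightarrow> 'a \<Rightarrow> nat list \<Rightarrow> ('a \<Rightarrow> 'a) list \<Rightarrow> bool" where
  "folded_walk R \<alpha> \<theta> is p \<longleftrightarrow>
     length p = Suc (length is) \<and> set p \<subseteq> affine_weyl R \<and> p ! 0 = id \<and>
     (\<forall>k<length is. folded_step R \<alpha> \<theta> (is ! k) (p ! k) (p ! Suc k))"

definition walk_end :: "('a \<Rightarrow> 'a) list \<Rightarrow> ('a \<Rightarrow> 'a) \<Rightarrow> 'a \<Rightarrow> 'a" where
  "walk_end p \<gamma> = last p \<circ> \<gamma>"


subsection \<open>The set of paths\<close>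

definition weyl_stabilizer :: "'a::euclidean_space set \<Rightarrow> 'a \<Rightarrow> ('a \<Rightarrow> 'a) set" where
  "weyl_stabilizer R l = {w \<in> finite_weyl R. w l = l}"

definition min_coset_reps ::
  "'a::euclidean_space set \<Rightarrow> (nat \<Rightarrow> 'a) \<Rightarrow> 'a \<Rightarrow> 'a \<Rightarrow> ('a \<Rightarrow> 'a) set" where
  "min_coset_reps R \<alpha> \<theta> l =
     {u \<in> finite_weyl R. \<forall>v\<in>weyl_stabilizer R l. weyl_length R \<alpha> \<theta> u \<le> weyl_length R \<alpha> \<theta> (u \<circ> v)}"

definition weyl_double_coset :: "'a::euclidean_space set \<Rightarrow> 'a \<Rightarrow> ('a \<Rightarrow> 'a) set" where
  "weyl_double_coset R l = {v \<circ> (+) l \<circ> w | v w. v \<in> finite_weyl R \<and> w \<in> finite_weyl R}"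

definition min_double_coset_rep ::
  "'a::euclidean_space set \<Rightarrow> (nat \<Rightarrow> 'a) \<Rightarrow> 'a \<Rightarrow> 'a \<Rightarrow> ('a \<Rightarrow> 'a) \<Rightarrow> bool" where
  "min_double_coset_rep R \<alpha> \<theta> l m \<longleftrightarrow>
     is_arg_min (weyl_length R \<alpha> \<theta>) (\<lambda>w. w \<in> weyl_double_coset R l) m"

text \<open>
  \<open>U u\<close> is the chosen word for the coset representative \<open>u\<close>; the chosen expression for
  the minimal element of the double coset consists of the word \<open>M\<close> and the factor \<open>\<gamma>\<close>.
\<close>

definition folded_paths ::
  "'a::euclidean_space set \<Rightarrow> (nat \<Rightarrow> 'a) \<Rightarrow> 'a \<Rightarrow> (('a \<Rightarrow> 'a) \<Rightarrow> nat list) \<Rightarrow>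
   nat list \<Rightarrow> ('a \<Rightarrow> 'a) \<Rightarrow> 'a \<Rightarrow> 'a \<Rightarrow> ('a \<Rightarrow> 'a) list set" where
  "folded_paths R \<alpha> \<theta> U M \<gamma> l \<mu> =
     {p. (\<exists>u\<in>min_coset_reps R \<alpha> \<theta> l. folded_walk R \<alpha> \<theta> (U u @ M) p) \<and>
         walk_end p \<gamma> \<in> {(+) \<mu> \<circ> w | w. w \<in> finite_weyl R}}"

end

theory Submission
  imports Defs
begin

text \<open>
  Alcoves are located by the values of affine roots at one point of the fundamental alcove: a
  hyperplane separates two alcoves if and only if the corresponding affine root takes opposite
  signs at the two images of that point. An element \<open>x\<close> of the extended affine Weyl group reaches
  the coweight \<open>x 0\<close>.

  A folded walk in \<open>\<P>\<close> ends in a saturated weight because its end arises from the product of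
  all letters by deleting the letters at which it folds. The letters of \<open>u\<close> contribute an element
  of the finite Weyl group, under which \<open>\<Pi>\<^sub>\<lambda>\<close> is invariant. Deleting letters from the reduced word
  of \<open>m\<^sub>\<lambda>\<close> leads down in the Bruhat order (\<open>subword_bruhat\<close>), and each reflection on the way down
  moves the image of the origin towards the origin in the direction of a root. The saturated set
  is closed under such moves (\<open>saturated_string\<close>, \<open>bruhat_saturated\<close>), and it contains the image of
  the origin under \<open>m\<^sub>\<lambda>\<close>, a conjugate of \<open>\<lambda>\<close>.

  For the converse consider the positively folded walks of type \<open>m\<^sub>\<lambda>\<close> that start at any alcove
  \<open>v\<close> at the origin, and the set \<open>X\<close> of coweights that they reach. It contains \<open>\<lambda>\<close>. An induction
  along the word shows that the ends of the walks are arranged in strings in the direction of every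
  simple root \<open>\<alpha>\<^sub>i\<close> (\<open>has_string_step\<close>), which makes \<open>X\<close> contain \<open>\<nu> - j \<alpha>\<^sub>i\<^sup>\<or>\<close> along with \<open>\<nu>\<close> for
  \<open>0 \<le> j \<le> \<langle>\<nu>, \<alpha>\<^sub>i\<rangle>\<close> (\<open>vertex_string\<close>). This closure property alone forces \<open>X\<close> to contain \<open>\<Pi>\<^sub>\<lambda>\<close>
  (\<open>saturated_subset\<close>).

  It remains to restrict the start to the minimal representatives \<open>u\<close>, which are reached by the
  walk of type \<open>u\<close> without folds. If \<open>v\<close> is not minimal, then \<open>v = v' s\<^sub>j\<close> with \<open>v'\<close> shorter and \<open>s\<^sub>j\<close>
  fixing \<open>\<lambda>\<close>, and \<open>s\<^sub>j m\<^sub>\<lambda> = m\<^sub>\<lambda> s\<^sub>k\<close> for some \<open>k\<close>. The walks of type \<open>m\<^sub>\<lambda>\<close> from \<open>v\<close> are among those of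
  type \<open>s\<^sub>j m\<^sub>\<lambda>\<close> from \<open>v'\<close>. They end where the walks of type \<open>m\<^sub>\<lambda> s\<^sub>k\<close> end, since the set of ends depends
  only on the element and not on its reduced word (\<open>walk_ends_upward_word_independent\<close>), and the
  last letter does not affect the coweight that is reached. Independence of the word is the
  combinatorial shadow of the fact that the left and the right multiplications of a Hecke algebra
  commute: positive folds are folds away from an alcove deep inside the antidominant chamber, and the
  analogous steps that multiply from the left commute with them.
\<close>

section \<open>Dual bases\<close>

lemma dual_family_coefficient:
  fixes u v :: "nat \<Rightarrow> 'a::euclidean_space"
  assumes dual: "\<And>i j. i \<in> {1..DIM('a)} \<Longrightarrow> j \<in> {1..DIM('a)} \<Longrightarrow> u i \<bullet> v j = (if i = j then 1 else 0)"
    and j: "j \<in> {1..DIM('a)}"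
  shows "u j \<bullet> (\<Sum>i=1..DIM('a). c i *\<^sub>R v i) = c j"
proof -
  have "u j \<bullet> (\<Sum>i=1..DIM('a). c i *\<^sub>R v i) = (\<Sum>i=1..DIM('a). if i = j then c i else 0)"
    unfolding inner_sum_right using dual[OF j] by (intro sum.cong) auto
  also have "\<dots> = c j" using j by simp
  finally show ?thesis .
qed

text \<open>
  Duality makes the family \<open>v\<close> linearly independent, and it has as many members as the dimension.
\<close>

lemma dual_family_expansion:
  fixes u v :: "nat \<Rightarrow> 'a::euclidean_space"
  assumes dual: "\<And>i j. i \<in> {1..DIM('a)} \<Longrightarrow> j \<in> {1..DIM('a)} \<Longrightarrow> u i \<bullet> v j = (if i = j then 1 else 0)"
  shows "x = (\<Sum>i=1..DIM('a). (u i \<bullet> x) *\<^sub>R v i)"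
proof -
  let ?I = "{1..DIM('a)}"
  have coeff: "u j \<bullet> (\<Sum>i\<in>?I. c i *\<^sub>R v i) = c j" if "j \<in> ?I" for j c
    using dual that by (rule dual_family_coefficient)
  have inj: "inj_on v ?I"
    using dual by (intro inj_onI) (metis zero_neq_one)
  have "independent (v ` ?I)"
  proof (rule independent_if_scalars_zero)
    fix f x assume f: "(\<Sum>x\<in>v ` ?I. f x *\<^sub>R x) = 0" and x: "x \<in> v ` ?I"
    have "(\<Sum>i\<in>?I. f (v i) *\<^sub>R v i) = 0"
      using f unfolding sum.reindex[OF inj] by simp
    then have "f (v j) = 0" if "j \<in> ?I" for j
      using that coeff[of j "\<lambda>i. f (v i)"] by simp
    with x show "f x = 0" by blast
  qed simp
  moreover have "card (v ` ?I) = DIM('a)" using inj by (simp add: card_image)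
  ultimately have "UNIV \<subseteq> span (v ` ?I)"
    by (intro card_ge_dim_independent) auto
  then obtain c where "x = (\<Sum>y\<in>v ` ?I. c y *\<^sub>R y)"
    by (auto simp: span_finite)
  then have "x = (\<Sum>i\<in>?I. c (v i) *\<^sub>R v i)"
    unfolding sum.reindex[OF inj] by simp
  moreover from this have "u i \<bullet> x = c (v i)" if "i \<in> ?I" for i
    using coeff[OF that, of "\<lambda>i. c (v i)"] by simp
  then have "(\<Sum>i\<in>?I. (u i \<bullet> x) *\<^sub>R v i) = (\<Sum>i\<in>?I. c (v i) *\<^sub>R v i)"
    by (intro sum.cong) auto
  ultimately show ?thesis by argo
qed

lemma combinations_dual:
  fixes u v :: "nat \<Rightarrow> 'a::euclidean_space" and e :: "'b \<Rightarrow> real"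
  assumes dual: "\<And>i j. i \<in> {1..DIM('a)} \<Longrightarrow> j \<in> {1..DIM('a)} \<Longrightarrow> u i \<bullet> v j = (if i = j then 1 else 0)"
  shows "(\<exists>c. x = (\<Sum>i=1..DIM('a). e (c i) *\<^sub>R v i)) \<longleftrightarrow> (\<forall>i\<in>{1..DIM('a)}. u i \<bullet> x \<in> range e)"
proof
  assume "\<exists>c. x = (\<Sum>i=1..DIM('a). e (c i) *\<^sub>R v i)"
  then obtain c where c: "x = (\<Sum>i=1..DIM('a). e (c i) *\<^sub>R v i)" by blast
  show "\<forall>i\<in>{1..DIM('a)}. u i \<bullet> x \<in> range e"
    unfolding c by (intro ballI) (subst dual_family_coefficient[OF dual], auto)
next
  assume "\<forall>i\<in>{1..DIM('a)}. u i \<bullet> x \<in> range e"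
  then have "\<forall>i\<in>{1..DIM('a)}. \<exists>n. u i \<bullet> x = e n" by blast
  then obtain c where c: "\<forall>i\<in>{1..DIM('a)}. u i \<bullet> x = e (c i)" by metis
  have "x = (\<Sum>i=1..DIM('a). (u i \<bullet> x) *\<^sub>R v i)" by (rule dual_family_expansion[OF dual])
  also have "\<dots> = (\<Sum>i=1..DIM('a). e (c i) *\<^sub>R v i)" using c by (intro sum.cong) auto
  finally show "\<exists>c. x = (\<Sum>i=1..DIM('a). e (c i) *\<^sub>R v i)" by blast
qed

lemma nat_combinations_dual:
  fixes u v :: "nat \<Rightarrow> 'a::euclidean_space"
  assumes "\<And>i j. i \<in> {1..DIM('a)} \<Longrightarrow> j \<in> {1..DIM('a)} \<Longrightarrow> u i \<bullet> v j = (if i = j then 1 else 0)"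
  shows "x \<in> nat_combinations v \<longleftrightarrow> (\<forall>i\<in>{1..DIM('a)}. u i \<bullet> x \<in> \<nat>)"
  using combinations_dual[of u v x real] assms by (simp add: nat_combinations_def Nats_def)

lemma int_combinations_dual:
  fixes u v :: "nat \<Rightarrow> 'a::euclidean_space"
  assumes "\<And>i j. i \<in> {1..DIM('a)} \<Longrightarrow> j \<in> {1..DIM('a)} \<Longrightarrow> u i \<bullet> v j = (if i = j then 1 else 0)"
  shows "x \<in> int_combinations v \<longleftrightarrow> (\<forall>i\<in>{1..DIM('a)}. u i \<bullet> x \<in> \<int>)"
  using combinations_dual[of u v x real_of_int] assms by (simp add: int_combinations_def Ints_def)

section \<open>Roots and coroots\<close>

lemma inner_coroot_self: "a \<noteq> 0 \<Longrightarrow> a \<bullet> coroot a = 2"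
  by (simp add: coroot_def)

lemma coroot_minus: "coroot (- a) = - coroot a"
  by (simp add: coroot_def)

lemma reflection_minus: "reflection (- a) (- k) = reflection a k"
  by (auto simp: reflection_def coroot_minus fun_eq_iff algebra_simps)

lemma reflection_self: "a \<noteq> 0 \<Longrightarrow> reflection a 0 a = - a"
proof -
  assume "a \<noteq> 0"
  then have "reflection a 0 a = a - 2 *\<^sub>R a" by (simp add: reflection_def coroot_def)
  then show ?thesis by (simp add: scaleR_2)
qed

lemma reflection_inner:
  "a \<noteq> 0 \<Longrightarrow> reflection a k x \<bullet> a + of_int k = - (x \<bullet> a + of_int k)"
  by (simp add: reflection_def coroot_def inner_diff_left)

lemma reflection_involution [simp]: "a \<noteq> 0 \<Longrightarrow> reflection a k (reflection a k x) = x"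
proof -
  assume a: "a \<noteq> 0"
  have "reflection a k (reflection a k x)
      = reflection a k x - (reflection a k x \<bullet> a + of_int k) *\<^sub>R coroot a"
    by (simp add: reflection_def)
  also have "\<dots> = x" unfolding reflection_inner[OF a] by (simp add: reflection_def algebra_simps)
  finally show ?thesis .
qed

lemma reflection_orthogonal: "reflection a 0 x \<bullet> reflection a 0 y = x \<bullet> y"
  by (cases "a = 0") (simp_all add: reflection_def coroot_def inner_diff inner_commute)

lemma reflection_adjoint: "a \<noteq> 0 \<Longrightarrow> reflection a 0 x \<bullet> y = x \<bullet> reflection a 0 y"
  using reflection_orthogonal[of a x "reflection a 0 y"] by simp

lemma linear_reflection: "linear (reflection a 0)"
  by (rule linearI) (auto simp: reflection_def inner_add_left algebra_simps)

locale root_datum =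
  fixes R :: "'a::euclidean_space set" and \<alpha> \<omega> :: "nat \<Rightarrow> 'a" and \<theta> :: 'a and I :: "nat set"
  assumes index_set: "I = {1..DIM('a)}"
    and reduced: "reduced_root_system R"
    and simple: "simple_roots R \<alpha>"
    and highest: "highest_root R \<alpha> \<theta>"
    and dual: "fundamental_coweights \<alpha> \<omega>"
begin

lemma finite_I: "finite I"
  by (simp add: index_set)

lemma omega_alpha: "i \<in> I \<Longrightarrow> j \<in> I \<Longrightarrow> \<omega> i \<bullet> \<alpha> j = (if i = j then 1 else 0)"
  using dual by (simp add: fundamental_coweights_def index_set)

lemma alpha_omega: "i \<in> I \<Longrightarrow> j \<in> I \<Longrightarrow> \<alpha> i \<bullet> \<omega> j = (if i = j then 1 else 0)"
  using omega_alpha[of j i] by (auto simp: inner_commute)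

lemma alpha_expansion: "x = (\<Sum>i\<in>I. (\<omega> i \<bullet> x) *\<^sub>R \<alpha> i)"
  unfolding index_set by (rule dual_family_expansion[OF omega_alpha[unfolded index_set]])

lemma inner_expansion: "x \<bullet> y = (\<Sum>i\<in>I. (x \<bullet> \<alpha> i) * (\<omega> i \<bullet> y))"
proof -
  have "x \<bullet> y = x \<bullet> (\<Sum>i\<in>I. (\<omega> i \<bullet> y) *\<^sub>R \<alpha> i)" using alpha_expansion[of y] by metis
  then show ?thesis by (simp add: inner_sum_right mult.commute)
qed

lemma eq_if_omega_eq: "(\<And>i. i \<in> I \<Longrightarrow> \<omega> i \<bullet> x = \<omega> i \<bullet> y) \<Longrightarrow> x = y"
proof -
  assume "\<And>i. i \<in> I \<Longrightarrow> \<omega> i \<bullet> x = \<omega> i \<bullet> y"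
  then have "(\<Sum>i\<in>I. (\<omega> i \<bullet> x) *\<^sub>R \<alpha> i) = (\<Sum>i\<in>I. (\<omega> i \<bullet> y) *\<^sub>R \<alpha> i)"
    by (intro sum.cong) auto
  then show ?thesis using alpha_expansion[of x] alpha_expansion[of y] by argo
qed

lemma root_system_R: "root_system R"
  using reduced by (simp add: reduced_root_system_def)

lemma finite_R: "finite R" and zero_notin_R: "0 \<notin> R"
  and reflection_R: "a \<in> R \<Longrightarrow> b \<in> R \<Longrightarrow> reflection a 0 b \<in> R"
  and coroot_integral: "a \<in> R \<Longrightarrow> b \<in> R \<Longrightarrow> b \<bullet> coroot a \<in> \<int>"
  using root_system_R unfolding root_system_def by auto

lemma root_nonzero: "a \<in> R \<Longrightarrow> a \<noteq> 0"
  using zero_notin_R by auto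

lemma root_uminus: "a \<in> R \<Longrightarrow> - a \<in> R"
  using reflection_R[of a a] reflection_self[of a] root_nonzero by auto

lemma root_multiple: "a \<in> R \<Longrightarrow> c *\<^sub>R a \<in> R \<Longrightarrow> c *\<^sub>R a = a \<or> c *\<^sub>R a = - a"
  using reduced unfolding reduced_root_system_def by blast

lemma alpha_root: "i \<in> I \<Longrightarrow> \<alpha> i \<in> R"
  using simple by (auto simp: simple_roots_def index_set)

lemma alpha_nonzero: "i \<in> I \<Longrightarrow> \<alpha> i \<noteq> 0"
  using alpha_root root_nonzero by blast

lemma theta_root: "\<theta> \<in> R"
  using highest by (simp add: highest_root_def)

lemma nat_combinations_alpha: "x \<in> nat_combinations \<alpha> \<longleftrightarrow> (\<forall>i\<in>I. \<omega> i \<bullet> x \<in> \<nat>)"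
  unfolding index_set by (rule nat_combinations_dual[OF omega_alpha[unfolded index_set]])

lemma root_coefficients:
  assumes "b \<in> R"
  shows "(\<forall>i\<in>I. \<omega> i \<bullet> b \<in> \<nat>) \<or> (\<forall>i\<in>I. - (\<omega> i \<bullet> b) \<in> \<nat>)"
  using assms simple unfolding simple_roots_def nat_combinations_alpha by (metis inner_minus_right)

lemma root_coefficient_int: "b \<in> R \<Longrightarrow> i \<in> I \<Longrightarrow> \<omega> i \<bullet> b \<in> \<int>"
  using root_coefficients[of b] Nats_subset_Ints by (metis minus_in_Ints_iff subsetD)

definition positive :: "'a \<Rightarrow> bool" where
  "positive b \<longleftrightarrow> b \<in> R \<and> (\<forall>i\<in>I. 0 \<le> \<omega> i \<bullet> b)"

lemma positive_roots_eq: "b \<in> positive_roots R \<alpha> \<longleftrightarrow> positive b"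
  using root_coefficient_int
  by (auto simp: positive_roots_def positive_def nat_combinations_alpha Nats_altdef2)

lemma positive_root: "positive b \<Longrightarrow> b \<in> R"
  by (simp add: positive_def)

lemma positive_or_negative: "b \<in> R \<Longrightarrow> positive b \<or> positive (- b)"
  using root_coefficients[of b] root_uminus[of b] by (auto simp: positive_def Nats_altdef2)

lemma positive_has_coefficient: "positive b \<Longrightarrow> \<exists>i\<in>I. 0 < \<omega> i \<bullet> b"
proof (rule ccontr)
  assume b: "positive b" and "\<not> (\<exists>i\<in>I. 0 < \<omega> i \<bullet> b)"
  then have "\<omega> i \<bullet> b = \<omega> i \<bullet> 0" if "i \<in> I" for i
    using that by (auto simp: positive_def intro: antisym simp: not_less)
  then have "b = 0" by (rule eq_if_omega_eq)
  with b show False by (simp add: positive_def zero_notin_R)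
qed

lemma not_positive_both: "positive b \<Longrightarrow> \<not> positive (- b)"
  using positive_has_coefficient[of b] by (force simp: positive_def)

lemma not_positive_iff: "b \<in> R \<Longrightarrow> \<not> positive b \<longleftrightarrow> positive (- b)"
  using positive_or_negative not_positive_both by blast

lemma alpha_positive: "i \<in> I \<Longrightarrow> positive (\<alpha> i)"
  using alpha_root omega_alpha by (auto simp: positive_def)

lemma le_theta: "b \<in> R \<Longrightarrow> i \<in> I \<Longrightarrow> \<omega> i \<bullet> b \<le> \<omega> i \<bullet> \<theta>"
proof -
  assume b: "b \<in> R" and i: "i \<in> I"
  then have "\<omega> i \<bullet> (\<theta> - b) \<in> \<nat>"
    using highest unfolding highest_root_def nat_combinations_alpha by blast
  then show ?thesis by (simp add: Nats_altdef2 inner_diff_right)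
qed

lemma theta_positive: "positive \<theta>"
proof -
  have "0 \<le> \<omega> i \<bullet> \<theta>" if "i \<in> I" for i
    using le_theta[OF theta_root that] le_theta[OF root_uminus[OF theta_root] that] by simp
  then show ?thesis by (simp add: positive_def theta_root)
qed

lemma positive_not_simple_coefficient:
  assumes b: "positive b" "b \<noteq> \<alpha> i" and i: "i \<in> I"
  shows "\<exists>k\<in>I. k \<noteq> i \<and> 0 < \<omega> k \<bullet> b"
proof (rule ccontr)
  assume "\<not> ?thesis"
  then have zero: "\<omega> k \<bullet> b = 0" if "k \<in> I" "k \<noteq> i" for k
    using that b(1) by (auto simp: positive_def intro: antisym simp: not_less)
  have "b = (\<omega> i \<bullet> b) *\<^sub>R \<alpha> i"
    by (rule eq_if_omega_eq) (use zero i omega_alpha in auto)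
  then have "b = \<alpha> i \<or> b = - \<alpha> i"
    using root_multiple[OF alpha_root[OF i], of "\<omega> i \<bullet> b"] positive_root[OF b(1)] by metis
  then show False using b alpha_positive[OF i] not_positive_both by auto
qed

lemma omega_reflection_alpha:
  "i \<in> I \<Longrightarrow> k \<in> I \<Longrightarrow> k \<noteq> i \<Longrightarrow> \<omega> k \<bullet> reflection (\<alpha> i) j b = \<omega> k \<bullet> b"
  by (simp add: reflection_def coroot_def inner_diff_right omega_alpha)

lemma simple_reflection_permutes_positive:
  assumes b: "positive b" "b \<noteq> \<alpha> i" and i: "i \<in> I"
  shows "positive (reflection (\<alpha> i) 0 b)"
proof -
  obtain k where k: "k \<in> I" "k \<noteq> i" "0 < \<omega> k \<bullet> b"
    using positive_not_simple_coefficient[OF b i] by blast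
  let ?b = "reflection (\<alpha> i) 0 b"
  have "?b \<in> R" using b i by (simp add: reflection_R alpha_root positive_root)
  moreover have "\<not> positive (- ?b)"
    using k omega_reflection_alpha[OF i k(1,2), of 0 b] by (force simp: positive_def)
  ultimately show ?thesis using positive_or_negative by blast
qed

lemma simple_reflection_positive_iff:
  assumes "b \<in> R" "b \<noteq> \<alpha> i" "b \<noteq> - \<alpha> i" and i: "i \<in> I"
  shows "positive (reflection (\<alpha> i) 0 b) \<longleftrightarrow> positive b"
proof (cases "positive b")
  case True
  then show ?thesis using simple_reflection_permutes_positive assms by blast
next
  case False
  then have "positive (- b)" using assms not_positive_iff by blast
  then have "positive (reflection (\<alpha> i) 0 (- b))"
    using simple_reflection_permutes_positive[of "- b" i] assms by (metis minus_minus)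
  then have "positive (- reflection (\<alpha> i) 0 b)"
    using linear_neg[OF linear_reflection] by metis
  then show ?thesis using False not_positive_both by blast
qed

text \<open>
  Heights decrease along a chain of simple reflections that ends in a simple root, so properties
  of roots that are invariant under simple reflections need only be checked on simple roots.
\<close>

lemma positive_root_induct [consumes 1, case_names simple reflect]:
  assumes b: "positive b"
    and simple: "\<And>i. i \<in> I \<Longrightarrow> P (\<alpha> i)"
    and reflect: "\<And>b i. positive b \<Longrightarrow> i \<in> I \<Longrightarrow> P b \<Longrightarrow> P (reflection (\<alpha> i) 0 b)"
  shows "P b"
proof -
  define ht where "ht b = (\<Sum>i\<in>I. nat \<lfloor>\<omega> i \<bullet> b\<rfloor>)" for b
  show ?thesis using b
  proof (induction "ht b" arbitrary: b rule: less_induct)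
    case less
    show ?case
    proof (cases "\<exists>i\<in>I. b = \<alpha> i")
      case True
      then show ?thesis using simple by blast
    next
      case False
      have "0 < b \<bullet> b" using less.prems root_nonzero positive_root by simp
      then have "0 < (\<Sum>i\<in>I. (b \<bullet> \<alpha> i) * (\<omega> i \<bullet> b))" by (simp only: inner_expansion[symmetric])
      then have "\<not> (\<forall>i\<in>I. (b \<bullet> \<alpha> i) * (\<omega> i \<bullet> b) \<le> 0)"
        using sum_nonpos[of I "\<lambda>i. (b \<bullet> \<alpha> i) * (\<omega> i \<bullet> b)"] by force
      then obtain i where i: "i \<in> I" "0 < (b \<bullet> \<alpha> i) * (\<omega> i \<bullet> b)" by force
      then have bi: "0 < b \<bullet> \<alpha> i"
        using less.prems by (auto simp: positive_def zero_less_mult_iff)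
      let ?b = "reflection (\<alpha> i) 0 b"
      have pos: "positive ?b"
        using simple_reflection_permutes_positive[OF less.prems _ i(1)] False i(1) by blast
      have "\<omega> i \<bullet> ?b < \<omega> i \<bullet> b"
        using bi i(1) omega_alpha alpha_nonzero by (simp add: reflection_def coroot_def inner_diff_right)
      moreover have "\<omega> i \<bullet> ?b \<in> \<int>" "\<omega> i \<bullet> b \<in> \<int>" "0 \<le> \<omega> i \<bullet> ?b"
        using root_coefficient_int pos less.prems i(1) by (auto simp: positive_def)
      ultimately have drop: "nat \<lfloor>\<omega> i \<bullet> ?b\<rfloor> < nat \<lfloor>\<omega> i \<bullet> b\<rfloor>"
        by (auto elim!: Ints_cases)
      have "\<omega> k \<bullet> ?b = \<omega> k \<bullet> b" if "k \<in> I" "k \<noteq> i" for k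
        using omega_reflection_alpha[OF i(1) that] .
      then have "nat \<lfloor>\<omega> k \<bullet> ?b\<rfloor> \<le> nat \<lfloor>\<omega> k \<bullet> b\<rfloor>" if "k \<in> I" for k
        using that drop by (cases "k = i") auto
      then have "ht ?b < ht b"
        unfolding ht_def using finite_I drop i(1)
        by (intro sum_strict_mono_ex1 ballI bexI[of _ i])
      then have "P ?b" using pos by (rule less.hyps)
      then have "P (reflection (\<alpha> i) 0 ?b)" by (rule reflect[OF pos i(1)])
      then show ?thesis using alpha_nonzero[OF i(1)] by simp
    qed
  qed
qed

section \<open>Coweights and the coroot lattice\<close>

lemma coweights_iff: "x \<in> coweights \<omega> \<longleftrightarrow> (\<forall>i\<in>I. x \<bullet> \<alpha> i \<in> \<int>)"
  unfolding coweights_def index_set by (subst int_combinations_dual[OF alpha_omega[unfolded index_set]]) (auto simp: inner_commute)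

lemma dominant_coweights_iff: "x \<in> dominant_coweights \<omega> \<longleftrightarrow> (\<forall>i\<in>I. x \<bullet> \<alpha> i \<in> \<nat>)"
  unfolding dominant_coweights_def index_set
  by (subst nat_combinations_dual[OF alpha_omega[unfolded index_set]]) (auto simp: inner_commute)

lemma coweight_root_int: "x \<in> coweights \<omega> \<Longrightarrow> b \<in> R \<Longrightarrow> x \<bullet> b \<in> \<int>"
  unfolding inner_expansion[of x b] coweights_iff
  by (intro Ints_sum Ints_mult) (auto intro: root_coefficient_int)

lemma coweights_add: "x \<in> coweights \<omega> \<Longrightarrow> y \<in> coweights \<omega> \<Longrightarrow> x + y \<in> coweights \<omega>"
  by (simp add: coweights_iff inner_add_left)

lemma coweights_minus: "x \<in> coweights \<omega> \<Longrightarrow> - x \<in> coweights \<omega>"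
  by (simp add: coweights_iff)

lemma coweights_scale: "x \<in> coweights \<omega> \<Longrightarrow> of_int k *\<^sub>R x \<in> coweights \<omega>"
  by (simp add: coweights_iff)

lemma zero_coweight: "0 \<in> coweights \<omega>"
  by (simp add: coweights_iff)

lemma coroot_coweight: "a \<in> R \<Longrightarrow> coroot a \<in> coweights \<omega>"
  using coroot_integral alpha_root by (simp add: coweights_iff inner_commute[of "coroot a"])

lemma reflection_coweight: "a \<in> R \<Longrightarrow> x \<in> coweights \<omega> \<Longrightarrow> reflection a k x \<in> coweights \<omega>"
proof -
  assume a: "a \<in> R" and x: "x \<in> coweights \<omega>"
  obtain j where "x \<bullet> a + of_int k = of_int j"
    using coweight_root_int[OF x a] by (metis Ints_cases of_int_add)
  then have "reflection a k x = x + of_int (- j) *\<^sub>R coroot a" by (simp add: reflection_def)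
  then show ?thesis using coweights_add coweights_scale coroot_coweight a x by metis
qed

text \<open>
  Multiplying the coefficient of a vector at a simple root by half the squared length of that
  root yields its coefficient at the simple coroot.
\<close>

definition coroot_lattice :: "'a set" where
  "coroot_lattice = {q. \<forall>i\<in>I. (\<omega> i \<bullet> q) * (\<alpha> i \<bullet> \<alpha> i) / 2 \<in> \<int>}"

lemma pos_coroot_cone_iff:
  "q \<in> pos_coroot_cone \<alpha> \<longleftrightarrow> q \<in> coroot_lattice \<and> (\<forall>i\<in>I. 0 \<le> \<omega> i \<bullet> q)"
proof -
  have pos: "0 < \<alpha> i \<bullet> \<alpha> i" if "i \<in> I" for i using alpha_nonzero that by simp
  have "q \<in> pos_coroot_cone \<alpha> \<longleftrightarrow> (\<forall>i\<in>I. ((\<alpha> i \<bullet> \<alpha> i / 2) *\<^sub>R \<omega> i) \<bullet> q \<in> \<nat>)"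
    unfolding pos_coroot_cone_def index_set
    by (rule nat_combinations_dual) (use omega_alpha pos in \<open>auto simp: coroot_def index_set\<close>)
  also have "\<dots> \<longleftrightarrow> q \<in> coroot_lattice \<and> (\<forall>i\<in>I. 0 \<le> \<omega> i \<bullet> q)"
    using pos by (fastforce simp: coroot_lattice_def Nats_altdef2 mult_ac zero_le_mult_iff)
  finally show ?thesis .
qed

lemma coroot_lattice_add: "p \<in> coroot_lattice \<Longrightarrow> q \<in> coroot_lattice \<Longrightarrow> p + q \<in> coroot_lattice"
  by (simp add: coroot_lattice_def inner_add_right distrib_right add_divide_distrib)

lemma coroot_lattice_minus: "p \<in> coroot_lattice \<Longrightarrow> - p \<in> coroot_lattice"
  by (simp add: coroot_lattice_def)

lemma coroot_lattice_scale:
  assumes "p \<in> coroot_lattice" shows "of_int k *\<^sub>R p \<in> coroot_lattice"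
proof -
  have "(\<omega> i \<bullet> (of_int k *\<^sub>R p)) * (\<alpha> i \<bullet> \<alpha> i) / 2 = of_int k * ((\<omega> i \<bullet> p) * (\<alpha> i \<bullet> \<alpha> i) / 2)" for i
    by simp
  moreover have "of_int k * ((\<omega> i \<bullet> p) * (\<alpha> i \<bullet> \<alpha> i) / 2) \<in> \<int>" if "i \<in> I" for i
    using assms that by (intro Ints_mult Ints_of_int) (simp add: coroot_lattice_def)
  ultimately show ?thesis by (simp only: coroot_lattice_def mem_Collect_eq ball_simps) metis
qed

lemma zero_in_coroot_lattice: "0 \<in> coroot_lattice"
  by (simp add: coroot_lattice_def)

lemma coroot_alpha_in_lattice: "i \<in> I \<Longrightarrow> coroot (\<alpha> i) \<in> coroot_lattice"
  using omega_alpha alpha_nonzero by (simp add: coroot_lattice_def coroot_def)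

lemma coroot_reflection: "a \<in> R \<Longrightarrow> coroot (reflection a 0 b) = reflection a 0 (coroot b)"
  by (simp add: coroot_def reflection_orthogonal linear_cmul[OF linear_reflection])

lemma coroot_in_lattice:
  assumes "b \<in> R"
  shows "coroot b \<in> coroot_lattice"
proof -
  have pos: "coroot b \<in> coroot_lattice" if "positive b" for b
    using that
  proof (induction rule: positive_root_induct)
    case (reflect b i)
    obtain j where j: "coroot b \<bullet> \<alpha> i = of_int j"
      using coroot_integral[OF positive_root[OF reflect(1)] alpha_root[OF reflect(2)]]
      by (metis Ints_cases inner_commute)
    have "coroot (reflection (\<alpha> i) 0 b) = coroot b + of_int (- j) *\<^sub>R coroot (\<alpha> i)"
      using coroot_reflection[OF alpha_root[OF reflect(2)], of b] by (simp add: reflection_def j)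
    then show ?case
      using reflect coroot_lattice_add coroot_lattice_scale coroot_alpha_in_lattice by metis
  qed (rule coroot_alpha_in_lattice)
  show ?thesis
    using positive_or_negative[OF assms] pos coroot_lattice_minus coroot_minus by (metis minus_minus)
qed

lemma omega_coroot_nonneg: "positive b \<Longrightarrow> i \<in> I \<Longrightarrow> 0 \<le> \<omega> i \<bullet> coroot b"
  by (simp add: coroot_def positive_def)

end

section \<open>The finite and the extended affine Weyl group\<close>

lemma generated_by_reflections_comp:
  "v \<in> generated_by_reflections S \<Longrightarrow> w \<in> generated_by_reflections S
    \<Longrightarrow> v \<circ> w \<in> generated_by_reflections S"
  by (induction v rule: generated_by_reflections.induct)
    (auto simp: comp_assoc intro: generated_by_reflections.comp)

lemma generated_by_reflections_incl: "s \<in> S \<Longrightarrow> s \<in> generated_by_reflections S"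
  using generated_by_reflections.comp[OF _ generated_by_reflections.id] by fastforce

lemma generated_by_reflections_inverse:
  assumes invol: "\<And>s. s \<in> S \<Longrightarrow> s \<circ> s = id" and w: "w \<in> generated_by_reflections S"
  shows "\<exists>w'\<in>generated_by_reflections S. w' \<circ> w = id \<and> w \<circ> w' = id"
  using w
proof (induction rule: generated_by_reflections.induct)
  case id
  show ?case by (intro bexI[of _ id] conjI generated_by_reflections.id) simp_all
next
  case (comp s w)
  then obtain w' where w': "w' \<in> generated_by_reflections S" "w' \<circ> w = id" "w \<circ> w' = id" by blast
  have "(w' \<circ> s) \<circ> (s \<circ> w) = w' \<circ> (s \<circ> s) \<circ> w" "(s \<circ> w) \<circ> (w' \<circ> s) = s \<circ> (w \<circ> w') \<circ> s"
    by (simp_all add: comp_assoc)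
  then have "(w' \<circ> s) \<circ> (s \<circ> w) = id" "(s \<circ> w) \<circ> (w' \<circ> s) = id"
    using w' invol[OF comp(1)] by auto
  moreover have "w' \<circ> s \<in> generated_by_reflections S"
    using generated_by_reflections_comp[OF w'(1) generated_by_reflections_incl[OF comp(1)]] .
  ultimately show ?case by blast
qed

text \<open>
  Affine roots are functions, so that the group acts on them by composition: the hyperplane of \<open>f\<close>
  is carried by \<open>x\<close> to the hyperplane of \<open>f \<circ> inv x\<close>.
\<close>

definition aff :: "'a::euclidean_space \<Rightarrow> int \<Rightarrow> 'a \<Rightarrow> real" where
  "aff a k v = v \<bullet> a + of_int k"

lemma aff_minus: "aff (- a) (- k) = (\<lambda>v. - aff a k v)"
  by (auto simp: aff_def fun_eq_iff)

lemma aff_eq_iff: "aff a k = aff b j \<longleftrightarrow> a = b \<and> k = j"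
proof
  assume eq: "aff a k = aff b j"
  from fun_cong[OF this, of 0] have "k = j" by (simp add: aff_def)
  with eq have "v \<bullet> a = v \<bullet> b" for v by (auto simp: aff_def fun_eq_iff)
  then have "a = b" by (metis vector_eq_ldot)
  with \<open>k = j\<close> show "a = b \<and> k = j" by simp
qed simp

lemma reflection_aff: "reflection a k v = v - aff a k v *\<^sub>R coroot a"
  by (simp add: reflection_def aff_def)

lemma aff_reflection: "a \<noteq> 0 \<Longrightarrow> aff a k (reflection a k v) = - aff a k v"
  using reflection_inner[of a k v] by (simp add: aff_def)

context root_datum
begin

abbreviation W0 :: "('a \<Rightarrow> 'a) set" where "W0 \<equiv> finite_weyl R"

abbreviation We :: "('a \<Rightarrow> 'a) set" where "We \<equiv> ext_affine_weyl R \<omega>"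

lemma weyl_id: "id \<in> W0"
  by (simp add: finite_weyl_def generated_by_reflections.id)

lemma weyl_comp: "v \<in> W0 \<Longrightarrow> w \<in> W0 \<Longrightarrow> v \<circ> w \<in> W0"
  by (simp add: finite_weyl_def generated_by_reflections_comp)

lemma weyl_reflection: "a \<in> R \<Longrightarrow> reflection a 0 \<in> W0"
  unfolding finite_weyl_def by (rule generated_by_reflections_incl) blast

lemma weyl_induct [consumes 1, case_names id reflection]:
  assumes "w \<in> W0" "P id" "\<And>a w. a \<in> R \<Longrightarrow> w \<in> W0 \<Longrightarrow> P w \<Longrightarrow> P (reflection a 0 \<circ> w)"
  shows "P w"
  using assms unfolding finite_weyl_def
  by (induction rule: generated_by_reflections.induct) auto

lemma weyl_inverse: assumes "w \<in> W0" shows "bij w" "inv w \<in> W0"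
proof -
  have "\<exists>w'\<in>W0. w' \<circ> w = id \<and> w \<circ> w' = id"
    unfolding finite_weyl_def
    by (rule generated_by_reflections_inverse[OF _ assms[unfolded finite_weyl_def]])
      (auto simp: fun_eq_iff root_nonzero)
  then obtain w' where w': "w' \<in> W0" "w' \<circ> w = id" "w \<circ> w' = id" by blast
  then show "bij w" using o_bij by blast
  then have "inv w = w'" using w' by (simp add: inv_unique_comp)
  then show "inv w \<in> W0" using w' by simp
qed

lemma weyl_inv_apply [simp]: "w \<in> W0 \<Longrightarrow> inv w (w x) = x" "w \<in> W0 \<Longrightarrow> w (inv w x) = x"
  using weyl_inverse(1) by (auto simp: bij_is_inj bij_is_surj surj_f_inv_f)

lemma weyl_linear: "w \<in> W0 \<Longrightarrow> linear w"
proof (induction rule: weyl_induct)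
  case id
  then show ?case using linear_id by (simp add: id_def)
next
  case (reflection a w)
  then show ?case using linear_compose[OF _ linear_reflection] by blast
qed

lemma weyl_orthogonal: "w \<in> W0 \<Longrightarrow> w x \<bullet> w y = x \<bullet> y"
  by (induction arbitrary: x y rule: weyl_induct) (simp_all add: reflection_orthogonal)

lemma weyl_adjoint: "w \<in> W0 \<Longrightarrow> w x \<bullet> y = x \<bullet> inv w y"
  using weyl_orthogonal[of w x "inv w y"] by simp

lemma weyl_root: "w \<in> W0 \<Longrightarrow> b \<in> R \<Longrightarrow> w b \<in> R"
  by (induction arbitrary: b rule: weyl_induct) (simp_all add: reflection_R)

lemma weyl_coroot: "w \<in> W0 \<Longrightarrow> coroot (w b) = w (coroot b)"
  by (simp add: coroot_def weyl_orthogonal linear_cmul[OF weyl_linear])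

lemma weyl_minus: "w \<in> W0 \<Longrightarrow> w (- x) = - w x"
  and weyl_add: "w \<in> W0 \<Longrightarrow> w (x + y) = w x + w y"
  and weyl_diff: "w \<in> W0 \<Longrightarrow> w (x - y) = w x - w y"
  and weyl_scale: "w \<in> W0 \<Longrightarrow> w (c *\<^sub>R x) = c *\<^sub>R w x"
  and weyl_zero: "w \<in> W0 \<Longrightarrow> w 0 = 0"
  using weyl_linear[of w]
  by (auto simp: linear_neg linear_add linear_diff linear_cmul linear_0)

lemma weyl_coweight: "w \<in> W0 \<Longrightarrow> x \<in> coweights \<omega> \<Longrightarrow> w x \<in> coweights \<omega>"
  by (induction rule: weyl_induct) (simp_all add: reflection_coweight)

lemma weyl_coweight_diff:
  assumes "w \<in> W0" "x \<in> coweights \<omega>"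
  shows "x - w x \<in> coroot_lattice"
  using assms
proof (induction rule: weyl_induct)
  case (reflection a w)
  obtain j where "w x \<bullet> a = of_int j"
    using coweight_root_int[OF weyl_coweight[OF reflection(2,4)] reflection(1)] Ints_cases by blast
  then have "x - (reflection a 0 \<circ> w) x = (x - w x) + of_int j *\<^sub>R coroot a"
    by (simp add: reflection_def)
  then show ?case
    using reflection coroot_in_lattice coroot_lattice_add coroot_lattice_scale by metis
qed (simp add: zero_in_coroot_lattice)

lemma weyl_conj_reflection:
  "w \<in> W0 \<Longrightarrow> w \<circ> reflection a 0 = reflection (w a) 0 \<circ> w"
  by (auto simp: fun_eq_iff reflection_def weyl_diff weyl_scale weyl_coroot weyl_orthogonal)

lemma ext_iff: "x \<in> We \<longleftrightarrow> (\<exists>m\<in>coweights \<omega>. \<exists>w\<in>W0. x = (\<lambda>v. m + w v))"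
  by (auto simp: ext_affine_weyl_def fun_eq_iff)

lemma ext_cases:
  assumes "x \<in> We"
  obtains m w where "m \<in> coweights \<omega>" "w \<in> W0" "\<And>v. x v = m + w v"
  using assms by (auto simp: ext_iff)

lemma ext_id: "id \<in> We"
  unfolding ext_iff by (intro bexI[of _ 0] bexI[of _ id]) (auto simp: weyl_id zero_coweight)

lemma weyl_ext: "w \<in> W0 \<Longrightarrow> w \<in> We"
  unfolding ext_iff by (intro bexI[of _ 0] bexI[of _ w]) (auto simp: zero_coweight)

lemma translation_ext: "m \<in> coweights \<omega> \<Longrightarrow> (+) m \<in> We"
  unfolding ext_iff by (intro bexI[of _ m] bexI[of _ id]) (auto simp: weyl_id)

lemma ext_comp: assumes "x \<in> We" "y \<in> We" shows "x \<circ> y \<in> We"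
proof -
  obtain m w where x: "m \<in> coweights \<omega>" "w \<in> W0" "\<And>v. x v = m + w v"
    using ext_cases[OF assms(1)] by blast
  obtain m' w' where y: "m' \<in> coweights \<omega>" "w' \<in> W0" "\<And>v. y v = m' + w' v"
    using ext_cases[OF assms(2)] by blast
  have "x \<circ> y = (\<lambda>v. (m + w m') + (w \<circ> w') v)"
    by (auto simp: fun_eq_iff x y weyl_add add.assoc)
  moreover have "m + w m' \<in> coweights \<omega>" "w \<circ> w' \<in> W0"
    using x y by (simp_all add: coweights_add weyl_coweight weyl_comp)
  ultimately show ?thesis unfolding ext_iff by blast
qed

lemma ext_inverse: assumes "x \<in> We" shows "bij x" "inv x \<in> We"
proof -
  obtain m w where x: "m \<in> coweights \<omega>" "w \<in> W0" "\<And>v. x v = m + w v"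
    using ext_cases[OF assms(1)] by blast
  let ?y = "\<lambda>v. - inv w m + inv w v"
  have inv: "inv w \<in> W0" using x weyl_inverse by blast
  have y: "?y \<circ> x = id" "x \<circ> ?y = id"
    using x inv by (auto simp: fun_eq_iff weyl_add weyl_minus weyl_diff)
  then show "bij x" by (rule o_bij)
  have "inv x = ?y" by (rule inv_unique_comp) (use y in auto)
  moreover have "- inv w m \<in> coweights \<omega>" using inv x(1) coweights_minus weyl_coweight by blast
  ultimately show "inv x \<in> We" using inv unfolding ext_iff by blast
qed

lemma ext_inv_apply [simp]: "x \<in> We \<Longrightarrow> inv x (x v) = v" "x \<in> We \<Longrightarrow> x (inv x v) = v"
  using ext_inverse(1) by (auto simp: bij_is_inj bij_is_surj surj_f_inv_f)

lemma ext_inv_comp [simp]: "x \<in> We \<Longrightarrow> inv x \<circ> x = id" "x \<in> We \<Longrightarrow> x \<circ> inv x = id"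
  by (auto simp: fun_eq_iff)

lemma inv_comp_ext: "x \<in> We \<Longrightarrow> y \<in> We \<Longrightarrow> inv (x \<circ> y) = inv y \<circ> inv x"
  using ext_inverse(1) by (intro o_inv_distrib)

lemma inv_inv_ext: "x \<in> We \<Longrightarrow> inv (inv x) = x"
  using ext_inverse(1) by (rule inv_inv_eq)

lemma ext_reflection: assumes "a \<in> R" shows "reflection a k \<in> We"
proof -
  have "reflection a k = (+) (of_int (- k) *\<^sub>R coroot a) \<circ> reflection a 0"
    by (auto simp: reflection_def fun_eq_iff algebra_simps)
  then show ?thesis
    using assms ext_comp translation_ext weyl_ext weyl_reflection coweights_scale coroot_coweight
    by metis
qed

lemma inv_reflection: "a \<in> R \<Longrightarrow> inv (reflection a k) = reflection a k"
  by (rule inv_unique_comp) (auto simp: fun_eq_iff root_nonzero)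

lemma affine_ext: "x \<in> affine_weyl R \<Longrightarrow> x \<in> We"
  unfolding affine_weyl_def
proof (induction rule: generated_by_reflections.induct)
  case (comp s w)
  then show ?case using ext_comp ext_reflection by blast
qed (rule ext_id)

lemma affine_comp_reflection:
  assumes "x \<in> affine_weyl R" "a \<in> R" shows "x \<circ> reflection a k \<in> affine_weyl R"
proof -
  have "reflection a k \<in> affine_weyl R"
    unfolding affine_weyl_def using assms by (intro generated_by_reflections_incl) blast
  then show ?thesis using assms by (simp add: affine_weyl_def generated_by_reflections_comp)
qed

section \<open>Affine roots\<close>

definition affine_roots :: "('a \<Rightarrow> real) set" where
  "affine_roots = {aff a k | a k. a \<in> R}"

lemma aff_affine_root: "a \<in> R \<Longrightarrow> aff a k \<in> affine_roots"
  by (auto simp: affine_roots_def)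

lemma affine_root_cases:
  assumes "f \<in> affine_roots" obtains a k where "a \<in> R" "f = aff a k"
  using assms by (auto simp: affine_roots_def)

lemma affine_root_minus: assumes "f \<in> affine_roots" shows "(\<lambda>v. - f v) \<in> affine_roots"
proof -
  obtain a k where "a \<in> R" "f = aff a k" using assms affine_root_cases by blast
  then show ?thesis using aff_affine_root[OF root_uminus, of a "- k"] by (simp add: aff_minus)
qed

lemma aff_ext:
  assumes "m \<in> coweights \<omega>" "w \<in> W0" "\<And>v. x v = m + w v" "a \<in> R"
  obtains j where "aff a k \<circ> x = aff (inv w a) j"
proof -
  obtain i where "m \<bullet> a = of_int i" using coweight_root_int assms Ints_cases by blast
  then have "aff a k \<circ> x = aff (inv w a) (k + i)"
    using assms by (auto simp: fun_eq_iff aff_def weyl_adjoint inner_add_left)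
  then show ?thesis using that by blast
qed

lemma affine_root_comp: assumes "f \<in> affine_roots" "x \<in> We" shows "f \<circ> x \<in> affine_roots"
proof -
  obtain a k where f: "a \<in> R" "f = aff a k" using assms affine_root_cases by blast
  obtain m w where x: "m \<in> coweights \<omega>" "w \<in> W0" "\<And>v. x v = m + w v"
    using ext_cases[OF assms(2)] by blast
  show ?thesis
    using aff_ext[OF x f(1), of k] aff_affine_root weyl_root weyl_inverse x f by metis
qed

text \<open>
  Multiplying \<open>x\<close> by a reflection on the right amounts to reflecting the alcove of \<open>x\<close> in the
  image under \<open>x\<close> of the reflecting hyperplane.
\<close>

lemma comp_reflection:
  assumes x: "x \<in> We" and a: "a \<in> R" and eq: "aff a k \<circ> inv x = aff b j"
  shows "x \<circ> reflection a k = reflection b j \<circ> x"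
proof -
  obtain m w where m: "m \<in> coweights \<omega>" "w \<in> W0" "\<And>v. x v = m + w v"
    using ext_cases[OF x] by blast
  have "aff a k \<circ> (inv x \<circ> x) = aff b j \<circ> x" using eq by (metis comp_assoc)
  then have eq': "aff a k = aff b j \<circ> x" using x by simp
  obtain c l where c: "c \<in> R" "aff a k \<circ> inv x = aff c l"
    using affine_root_comp[OF aff_affine_root[OF a] ext_inverse(2)[OF x]] affine_root_cases by blast
  then have "b \<in> R" using eq by (simp add: aff_eq_iff)
  then have "a = inv w b" using aff_ext[OF m, of b j] eq' by (metis aff_eq_iff)
  then have "b = w a" using m by simp
  then show ?thesis
    using fun_cong[OF eq'] m
    by (auto simp: fun_eq_iff reflection_aff weyl_diff weyl_scale weyl_coroot)
qed

definition rho :: 'a where "rho = (\<Sum>i\<in>I. \<omega> i)"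

lemma rho_alpha: "i \<in> I \<Longrightarrow> rho \<bullet> \<alpha> i = 1"
  unfolding rho_def using finite_I by (simp add: inner_sum_left omega_alpha)

lemma rho_coweight: "rho \<in> coweights \<omega>"
  by (simp add: coweights_iff rho_alpha)

lemma rho_inner: "rho \<bullet> x = (\<Sum>i\<in>I. \<omega> i \<bullet> x)"
  by (simp add: rho_def inner_sum_left)

lemma rho_positive: assumes "positive b" shows "1 \<le> rho \<bullet> b"
proof -
  obtain i where i: "i \<in> I" "0 < \<omega> i \<bullet> b" using positive_has_coefficient assms by blast
  then have "1 \<le> \<omega> i \<bullet> b"
    using root_coefficient_int[OF positive_root[OF assms] i(1)] by (auto elim!: Ints_cases)
  also have "\<dots> \<le> rho \<bullet> b"
    unfolding rho_inner using assms i(1) finite_I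
    by (intro member_le_sum) (auto simp: positive_def)
  finally show ?thesis .
qed

definition p0 :: 'a where "p0 = (1 / (rho \<bullet> \<theta> + 1)) *\<^sub>R rho"

lemma p0_alcove: "p0 \<in> fund_alcove \<alpha> \<theta>"
proof -
  have "1 \<le> rho \<bullet> \<theta>" by (rule rho_positive[OF theta_positive])
  then show ?thesis unfolding fund_alcove_def index_set[symmetric] p0_def using rho_alpha by simp
qed

lemma alcove_positive:
  assumes v: "v \<in> fund_alcove \<alpha> \<theta>" and b: "positive b"
  shows "0 < v \<bullet> b" "v \<bullet> b < 1"
proof -
  have pos: "0 < v \<bullet> \<alpha> i" if "i \<in> I" for i
    using v that by (simp add: fund_alcove_def index_set)
  obtain i where i: "i \<in> I" "0 < \<omega> i \<bullet> b" using positive_has_coefficient b by blast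
  have "0 < (\<Sum>i\<in>I. (v \<bullet> \<alpha> i) * (\<omega> i \<bullet> b))"
    using i pos b finite_I by (intro sum_pos2[of _ i]) (auto simp: positive_def less_imp_le)
  then show "0 < v \<bullet> b" by (simp only: inner_expansion[symmetric])
  have "v \<bullet> b \<le> v \<bullet> \<theta>"
    unfolding inner_expansion[of v b] inner_expansion[of v \<theta>]
    using pos le_theta[OF positive_root[OF b]] by (intro sum_mono mult_left_mono) (auto simp: less_imp_le)
  also have "\<dots> < 1" using v by (simp add: fund_alcove_def)
  finally show "v \<bullet> b < 1" .
qed

lemma aff_positive_iff:
  assumes "v \<in> fund_alcove \<alpha> \<theta>" "positive b"
  shows "0 < aff b k v \<longleftrightarrow> 0 \<le> k" "aff b k v < 0 \<longleftrightarrow> k < 0"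
proof -
  note v = alcove_positive[OF assms]
  have "0 < aff b k v" if "0 \<le> k" using that v by (simp add: aff_def add_pos_nonneg)
  moreover have "aff b k v < 0" if "k < 0"
  proof -
    have "of_int k \<le> (-1::real)" using that by linarith
    then show ?thesis using v by (simp add: aff_def)
  qed
  ultimately show "0 < aff b k v \<longleftrightarrow> 0 \<le> k" "aff b k v < 0 \<longleftrightarrow> k < 0" by force+
qed

lemma aff_negative_iff:
  assumes "v \<in> fund_alcove \<alpha> \<theta>" "positive b"
  shows "0 < aff (- b) k v \<longleftrightarrow> 0 < k" "aff (- b) k v < 0 \<longleftrightarrow> k \<le> 0"
  using aff_positive_iff[OF assms, of "- k"] aff_minus[of b "- k"] by auto

text \<open>
  On the fundamental alcove a positive root takes values strictly between \<open>0\<close> and \<open>1\<close>, so the sign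
  of an affine root there is determined by its constant term and the sign of its gradient. Hence one
  point represents the alcove.
\<close>

lemma affine_root_sign:
  assumes "f \<in> affine_roots" "v \<in> fund_alcove \<alpha> \<theta>"
  shows "0 < f v \<longleftrightarrow> 0 < f p0" "f v < 0 \<longleftrightarrow> f p0 < 0"
proof -
  obtain b k where f: "b \<in> R" "f = aff b k" using assms affine_root_cases by blast
  then consider "positive b" | "positive (- b)" using positive_or_negative by blast
  then show "0 < f v \<longleftrightarrow> 0 < f p0" "f v < 0 \<longleftrightarrow> f p0 < 0"
    using aff_positive_iff[of v b] aff_positive_iff[OF p0_alcove, of b]
      aff_negative_iff[of v "- b"] aff_negative_iff[OF p0_alcove, of "- b"] assms(2) f(2)
    by (cases; simp)+
qed

lemma affine_root_p0_nonzero: assumes "f \<in> affine_roots" shows "f p0 \<noteq> 0"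
proof -
  obtain b k where f: "b \<in> R" "f = aff b k" using assms affine_root_cases by blast
  then consider "positive b" | "positive (- b)" using positive_or_negative by blast
  then show ?thesis
    using aff_positive_iff[OF p0_alcove, of b k] aff_negative_iff[OF p0_alcove, of "- b" k] f(2)
    by cases auto
qed

text \<open>
  The origin is in the closure of the fundamental alcove. This links the sides on which alcoves lie
  to the coweights that they reach.
\<close>

lemma affine_root_zero: assumes "f \<in> affine_roots" "0 < f p0" shows "0 \<le> f 0"
proof -
  obtain b k where f: "b \<in> R" "f = aff b k" using assms affine_root_cases by blast
  then consider "positive b" | "positive (- b)" using positive_or_negative by blast
  then show ?thesis
    using aff_positive_iff[OF p0_alcove, of b k] aff_negative_iff[OF p0_alcove, of "- b" k] f(2)
      assms(2)
    by cases (auto simp: aff_def)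
qed

lemma affine_root_orbit:
  assumes "f \<in> affine_roots" "x \<in> We"
  shows "f (x p0) \<noteq> 0" "f (x p0) < 0 \<longleftrightarrow> \<not> 0 < f (x p0)"
  using affine_root_p0_nonzero[OF affine_root_comp[OF assms]] by auto

lemma alcove_side:
  assumes "a \<in> R" "x \<in> We"
  shows "x ` fund_alcove \<alpha> \<theta> \<subseteq> pos_side a k \<longleftrightarrow> 0 < aff a k (x p0)"
    and "x ` fund_alcove \<alpha> \<theta> \<subseteq> neg_side a k \<longleftrightarrow> aff a k (x p0) < 0"
proof -
  have f: "aff a k \<circ> x \<in> affine_roots" using assms affine_root_comp aff_affine_root by blast
  have sides: "v \<in> pos_side a k \<longleftrightarrow> 0 \<le> aff a k v" "v \<in> neg_side a k \<longleftrightarrow> aff a k v \<le> 0" for v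
    by (auto simp: pos_side_def neg_side_def aff_def)
  have sgn: "0 < aff a k (x v) \<longleftrightarrow> 0 < aff a k (x p0)" "aff a k (x v) < 0 \<longleftrightarrow> aff a k (x p0) < 0"
    if "v \<in> fund_alcove \<alpha> \<theta>" for v
    using affine_root_sign[OF f that] by simp_all
  have nz: "aff a k (x p0) \<noteq> 0" using affine_root_p0_nonzero[OF f] by simp
  show "x ` fund_alcove \<alpha> \<theta> \<subseteq> pos_side a k \<longleftrightarrow> 0 < aff a k (x p0)"
    unfolding image_subset_iff sides using sgn p0_alcove nz by (meson less_le not_less)
  show "x ` fund_alcove \<alpha> \<theta> \<subseteq> neg_side a k \<longleftrightarrow> aff a k (x p0) < 0"
    unfolding image_subset_iff sides using sgn p0_alcove nz by (meson less_le not_less)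
qed

end

context root_datum
begin

section \<open>Inversions and length\<close>

text \<open>
  Each separating hyperplane is represented once, by the one of its two affine roots that is
  positive on the fundamental alcove.
\<close>

definition inversions :: "('a \<Rightarrow> 'a) \<Rightarrow> ('a \<Rightarrow> real) set" where
  "inversions x = {f \<in> affine_roots. 0 < f p0 \<and> f (x p0) < 0}"

abbreviation len :: "('a \<Rightarrow> 'a) \<Rightarrow> nat" where
  "len x \<equiv> card (inversions x)"

lemma finite_inversions: "finite (inversions x)"
proof -
  let ?K = "SIGMA a:R. {\<lfloor>- (p0 \<bullet> a)\<rfloor>..\<lceil>- (x p0 \<bullet> a)\<rceil>}"
  have "inversions x \<subseteq> (\<lambda>(a, k). aff a k) ` ?K"
  proof
    fix f assume f: "f \<in> inversions x"
    then have "f \<in> affine_roots" by (simp add: inversions_def)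
    then obtain a k where a: "a \<in> R" "f = aff a k" by (rule affine_root_cases)
    then have "- (p0 \<bullet> a) < of_int k" "of_int k < - (x p0 \<bullet> a)"
      using f by (auto simp: inversions_def aff_def)
    then have "(a, k) \<in> ?K" using a by (simp add: floor_le_iff le_ceiling_iff)
    then show "f \<in> (\<lambda>(a, k). aff a k) ` ?K" using a by force
  qed
  moreover have "finite ?K" using finite_R by simp
  ultimately show ?thesis using finite_subset by blast
qed

lemma hyperplane_aff: "hyperplane a k = {v. aff a k v = 0}"
  by (auto simp: hyperplane_def aff_def)

text \<open>
  The gradients of two affine functions with the same zero set are proportional, and a reduced root
  system contains no multiples of a root besides its negative.
\<close>

lemma same_zero_set:
  assumes a: "a \<in> R" and b: "b \<in> R" and eq: "hyperplane a k = hyperplane b j"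
  shows "aff b j = aff a k \<or> aff b j = (\<lambda>v. - aff a k v)"
proof -
  have a0: "a \<bullet> a \<noteq> 0" using a root_nonzero by simp
  have iff: "aff a k v = 0 \<longleftrightarrow> aff b j v = 0" for v
    using eq unfolding hyperplane_aff by blast
  define v where "v = (- of_int k / (a \<bullet> a)) *\<^sub>R a"
  define u where "u = b - (b \<bullet> a / (a \<bullet> a)) *\<^sub>R a"
  have v: "aff a k v = 0" using a0 by (simp add: aff_def v_def)
  have ua: "u \<bullet> a = 0" using a0 by (simp add: u_def inner_diff_left)
  have "aff a k (v + u) = 0" using v ua by (simp add: aff_def inner_add_left)
  then have "u \<bullet> b = 0" using iff[of v] iff[of "v + u"] v by (simp add: aff_def inner_add_left)
  then have "u \<bullet> u = 0" using ua by (simp add: u_def inner_diff_right)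
  then have "b = (b \<bullet> a / (a \<bullet> a)) *\<^sub>R a" by (simp add: u_def)
  then have "b = a \<or> b = - a" using root_multiple[OF a] b by metis
  then show ?thesis
  proof
    assume "b = a"
    then show ?thesis using iff[of v] v by (simp add: aff_def fun_eq_iff)
  next
    assume "b = - a"
    then show ?thesis using iff[of v] v by (simp add: aff_def fun_eq_iff)
  qed
qed

lemma weyl_length_eq_len:
  assumes x: "x \<in> We" shows "weyl_length R \<alpha> \<theta> x = len x"
proof -
  have sides: "aff a k \<in> inversions x \<longleftrightarrow>
      fund_alcove \<alpha> \<theta> \<subseteq> pos_side a k \<and> x ` fund_alcove \<alpha> \<theta> \<subseteq> neg_side a k" if "a \<in> R" for a k
    using alcove_side[OF that ext_id, of k] alcove_side[OF that x, of k] that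
    by (simp add: inversions_def aff_affine_root)
  have "separating_hyperplanes R (fund_alcove \<alpha> \<theta>) (x ` fund_alcove \<alpha> \<theta>)
      = (\<lambda>f. {v. f v = 0}) ` inversions x" (is "?H = ?Z")
  proof
    show "?H \<subseteq> ?Z" using sides by (auto simp: separating_hyperplanes_def hyperplane_aff)
    show "?Z \<subseteq> ?H"
    proof
      fix H assume "H \<in> ?Z"
      then obtain f where f: "f \<in> inversions x" "H = {v. f v = 0}" by blast
      then have "f \<in> affine_roots" by (simp add: inversions_def)
      then obtain a k where a: "a \<in> R" "f = aff a k" by (rule affine_root_cases)
      then show "H \<in> ?H"
        using f sides[OF a(1), of k] by (auto simp: separating_hyperplanes_def hyperplane_aff)
    qed
  qed
  moreover have "inj_on (\<lambda>f. {v. f v = 0}) (inversions x)"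
  proof (rule inj_onI)
    fix f g assume f: "f \<in> inversions x" and g: "g \<in> inversions x" and eq: "{v. f v = 0} = {v. g v = 0}"
    obtain a k where a: "a \<in> R" "f = aff a k"
      using f affine_root_cases by (auto simp: inversions_def)
    obtain b j where b: "b \<in> R" "g = aff b j"
      using g affine_root_cases by (auto simp: inversions_def)
    have "g = f \<or> g = (\<lambda>v. - f v)"
      using same_zero_set[OF a(1) b(1), of k j] eq a(2) b(2) by (simp add: hyperplane_aff)
    then show "f = g" using f g by (auto simp: inversions_def)
  qed
  ultimately show ?thesis by (simp add: weyl_length_def card_image)
qed

lemma len_inverse: assumes x: "x \<in> We" shows "len (inv x) = len x"
proof -
  have le: "len y \<le> len (inv y)" if y: "y \<in> We" for y
  proof (rule card_inj_on_le[of "\<lambda>f v. - f (y v)"])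
    show "inj_on (\<lambda>f v. - f (y v)) (inversions y)"
    proof (rule inj_onI)
      fix f g :: "'a \<Rightarrow> real" assume "(\<lambda>v. - f (y v)) = (\<lambda>v. - g (y v))"
      from fun_cong[OF this] have "f (y (inv y v)) = g (y (inv y v))" for v by simp
      then show "f = g" using y by (auto simp: fun_eq_iff)
    qed
    show "(\<lambda>f v. - f (y v)) ` inversions y \<subseteq> inversions (inv y)"
    proof
      fix g assume "g \<in> (\<lambda>f v. - f (y v)) ` inversions y"
      then obtain f where f: "f \<in> inversions y" "g = (\<lambda>v. - (f \<circ> y) v)" by auto
      have "f \<circ> y \<in> affine_roots" using f(1) y affine_root_comp by (simp add: inversions_def)
      then have "g \<in> affine_roots" unfolding f(2) by (rule affine_root_minus)
      then show "g \<in> inversions (inv y)" using f y by (simp add: inversions_def)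
    qed
  qed (rule finite_inversions)
  show ?thesis
    using le[OF x] le[OF ext_inverse(2)[OF x]] x by (simp add: inv_inv_ext)
qed

text \<open>
  These are the elements of length zero; \<open>x\<close> and \<open>x \<circ> g\<close> then place the fundamental alcove on the
  same sides of all hyperplanes.
\<close>

definition flat :: "('a \<Rightarrow> 'a) \<Rightarrow> bool" where
  "flat g \<longleftrightarrow> g \<in> We \<and> (\<forall>f\<in>affine_roots. 0 < f (g p0) \<longleftrightarrow> 0 < f p0)"

lemma flatD:
  assumes "flat g" "f \<in> affine_roots"
  shows "0 < f (g p0) \<longleftrightarrow> 0 < f p0" "f (g p0) < 0 \<longleftrightarrow> f p0 < 0"
  using assms affine_root_orbit[of f g] affine_root_orbit[of f id] ext_id by (auto simp: flat_def)

lemma flat_id: "flat id"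
  by (simp add: flat_def ext_id)

lemma flat_ext: "flat g \<Longrightarrow> g \<in> We"
  by (simp add: flat_def)

lemma flat_if_no_inversions:
  assumes x: "x \<in> We" and "inversions x = {}" shows "flat x"
proof -
  have pos: "0 < f (x p0)" if "f \<in> affine_roots" "0 < f p0" for f
    using that assms affine_root_orbit[of f x] by (auto simp: inversions_def)
  have "0 < f p0" if f: "f \<in> affine_roots" and "0 < f (x p0)" for f
  proof (rule ccontr)
    assume "\<not> 0 < f p0"
    then have "0 < - f p0" using affine_root_p0_nonzero[OF f] by simp
    then show False using pos[OF affine_root_minus[OF f]] that by simp
  qed
  then show ?thesis using pos x by (auto simp: flat_def)
qed

lemma length_zero_flat: "g \<in> length_zero_elements R \<alpha> \<theta> \<omega> \<Longrightarrow> flat g"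
  using flat_if_no_inversions finite_inversions weyl_length_eq_len
  by (auto simp: length_zero_elements_def)

lemma flat_inverse: assumes g: "flat g" shows "flat (inv g)"
proof -
  have ext: "g \<in> We" using g by (simp add: flat_def)
  then have "f (g (inv g p0)) = f p0" for f :: "'a \<Rightarrow> real" by simp
  have "0 < f (inv g p0) \<longleftrightarrow> 0 < f p0" if f: "f \<in> affine_roots" for f
    using flatD(1)[OF g affine_root_comp[OF f ext_inverse(2)[OF ext]]] ext by simp
  then show ?thesis using ext ext_inverse by (simp add: flat_def)
qed

lemma inversions_comp_flat:
  assumes "x \<in> We" "flat g" shows "inversions (x \<circ> g) = inversions x"
proof -
  have "f (x (g p0)) < 0 \<longleftrightarrow> f (x p0) < 0" if "f \<in> affine_roots" for f
    using flatD(2)[OF assms(2) affine_root_comp[OF that assms(1)]] by simp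
  then show ?thesis by (auto simp: inversions_def)
qed

section \<open>Walls of the fundamental alcove\<close>

text \<open>
  Reflecting the fundamental alcove in a wall crosses no other hyperplane. Words are formed from all
  reflections with this property instead of the indexed simple ones, because conjugation by an
  element of length zero preserves it (\<open>wall_conj_flat\<close>).
\<close>

definition wall :: "'a \<Rightarrow> int \<Rightarrow> bool" where
  "wall a k \<longleftrightarrow> a \<in> R \<and> 0 < aff a k p0 \<and>
     (\<forall>g\<in>affine_roots. 0 < g p0 \<longrightarrow> g (reflection a k p0) < 0 \<longrightarrow> g = aff a k)"

lemma wall_root: "wall a k \<Longrightarrow> a \<in> R" and wall_pos: "wall a k \<Longrightarrow> 0 < aff a k p0"
  by (simp_all add: wall_def)

lemma wallD:
  "wall a k \<Longrightarrow> g \<in> affine_roots \<Longrightarrow> 0 < g p0 \<Longrightarrow> g (reflection a k p0) < 0 \<Longrightarrow> g = aff a k"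
  by (simp add: wall_def)

lemma wall_ext: "wall a k \<Longrightarrow> reflection a k \<in> We"
  by (simp add: wall_root ext_reflection)

lemma aff_p0_positive_cases:
  assumes "b \<in> R" "0 < aff b k p0"
  shows "positive b \<and> 0 \<le> k \<or> positive (- b) \<and> 1 \<le> k"
  using positive_or_negative[OF assms(1)] aff_positive_iff(1)[OF p0_alcove, of b k]
    aff_negative_iff(1)[OF p0_alcove, of "- b" k] assms(2) by auto

text \<open>
  An affine root that changes its sign has its gradient turned from positive to negative, and
  \<open>\<alpha> i\<close> is the only positive root to which its reflection does that.
\<close>

lemma wall_alpha: assumes i: "i \<in> I" shows "wall (\<alpha> i) 0"
  unfolding wall_def
proof (intro conjI ballI impI)
  show "\<alpha> i \<in> R" by (rule alpha_root[OF i])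
  show "0 < aff (\<alpha> i) 0 p0" using aff_positive_iff[OF p0_alcove alpha_positive[OF i]] by simp
  fix g assume g: "g \<in> affine_roots" "0 < g p0" "g (reflection (\<alpha> i) 0 p0) < 0"
  obtain b k where b: "b \<in> R" "g = aff b k" using g(1) by (rule affine_root_cases)
  let ?b = "reflection (\<alpha> i) 0 b"
  have neg: "aff ?b k p0 < 0"
    using g(3) b alpha_nonzero[OF i] by (simp add: aff_def reflection_adjoint)
  consider "positive b" "0 \<le> k" | "positive (- b)" "1 \<le> k"
    using aff_p0_positive_cases b g(2) by blast
  then show "g = aff (\<alpha> i) 0"
  proof cases
    case 1
    have "b = \<alpha> i"
      using simple_reflection_permutes_positive[OF 1(1) _ i] aff_positive_iff(2)[OF p0_alcove, of ?b k] neg 1(2)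
      by fastforce
    moreover from this have "k = 0"
      using neg reflection_self[OF alpha_nonzero[OF i]] 1(2)
        aff_negative_iff(2)[OF p0_alcove alpha_positive[OF i], of k] by simp
    ultimately show ?thesis using b by simp
  next
    case 2
    have "?b \<in> R" using b(1) alpha_root[OF i] reflection_R by blast
    then have "- 1 < p0 \<bullet> ?b"
      using positive_or_negative[of ?b] alcove_positive[OF p0_alcove, of ?b]
        alcove_positive[OF p0_alcove, of "- ?b"] by auto
    then have "0 < aff ?b k p0" using 2(2) by (simp add: aff_def)
    then show ?thesis using neg by simp
  qed
qed

text \<open>
  The reflection of \<open>b\<close> in the highest root is a root again, and therefore lies between
  \<open>- \<theta>\<close> and \<open>\<theta>\<close>; this leaves only two values for the pairing of \<open>b\<close> with the coroot of \<open>\<theta>\<close>.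
\<close>

lemma theta_string:
  assumes b: "positive b" "b \<noteq> \<theta>"
  shows "b \<bullet> coroot \<theta> = 0 \<and> reflection \<theta> 0 b = b \<or>
         b \<bullet> coroot \<theta> = 1 \<and> positive (\<theta> - b) \<and> reflection \<theta> 0 b = b - \<theta>"
proof -
  have t0: "0 < \<theta> \<bullet> \<theta>" using theta_root root_nonzero by simp
  define r where "r = reflection \<theta> 0 b"
  obtain c where c: "b \<bullet> coroot \<theta> = of_int c"
    using coroot_integral[OF theta_root positive_root[OF b(1)]] Ints_cases by blast
  have r: "r = b - of_int c *\<^sub>R \<theta>"
  proof -
    have "(b \<bullet> \<theta>) *\<^sub>R coroot \<theta> = (b \<bullet> coroot \<theta>) *\<^sub>R \<theta>" by (simp add: coroot_def)
    then show ?thesis by (simp add: r_def reflection_def c)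
  qed
  have rR: "r \<in> R" unfolding r_def using reflection_R theta_root positive_root[OF b(1)] by blast
  obtain i where i: "i \<in> I" "\<omega> i \<bullet> b \<noteq> \<omega> i \<bullet> \<theta>" using eq_if_omega_eq b(2) by blast
  then have lt: "\<omega> i \<bullet> b < \<omega> i \<bullet> \<theta>" using le_theta[OF positive_root[OF b(1)] i(1)] by simp
  have bi: "0 \<le> \<omega> i \<bullet> b" using b(1) i(1) by (simp add: positive_def)
  have up: "\<omega> i \<bullet> b - of_int c * (\<omega> i \<bullet> \<theta>) \<le> \<omega> i \<bullet> \<theta>"
    using le_theta[OF rR i(1)] by (simp add: r inner_diff_right)
  have down: "- (\<omega> i \<bullet> \<theta>) \<le> \<omega> i \<bullet> b - of_int c * (\<omega> i \<bullet> \<theta>)"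
    using le_theta[OF root_uminus[OF rR] i(1)] by (simp add: r inner_diff_right)
  have "c < 2"
  proof (rule ccontr)
    assume "\<not> c < 2"
    then have "2 * (\<omega> i \<bullet> \<theta>) \<le> of_int c * (\<omega> i \<bullet> \<theta>)" using lt bi by (intro mult_right_mono) auto
    then show False using down lt by simp
  qed
  moreover have "0 \<le> c"
  proof (rule ccontr)
    assume neg: "\<not> 0 \<le> c"
    obtain j where j: "j \<in> I" "0 < \<omega> j \<bullet> b" using positive_has_coefficient[OF b(1)] by blast
    have "\<omega> j \<bullet> b - of_int c * (\<omega> j \<bullet> \<theta>) \<le> \<omega> j \<bullet> \<theta>"
      using le_theta[OF rR j(1)] by (simp add: r inner_diff_right)
    moreover have "0 \<le> \<omega> j \<bullet> \<theta>" using theta_positive j(1) by (simp add: positive_def)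
    then have "of_int c * (\<omega> j \<bullet> \<theta>) \<le> (-1) * (\<omega> j \<bullet> \<theta>)"
      using neg by (intro mult_right_mono) (auto simp: of_int_le_iff[of c "-1", simplified])
    ultimately show False using j(2) by simp
  qed
  ultimately consider "c = 0" | "c = 1" by linarith
  then show ?thesis
  proof cases
    case 1
    then show ?thesis using c r by (simp add: r_def)
  next
    case 2
    then have "r = b - \<theta>" using r by simp
    moreover have "- r \<in> R" using rR by (rule root_uminus)
    moreover have "0 \<le> \<omega> j \<bullet> (\<theta> - b)" if "j \<in> I" for j
      using le_theta[OF positive_root[OF b(1)] that] by (simp add: inner_diff_right)
    moreover have "\<theta> - b = - r" using \<open>r = b - \<theta>\<close> by simp
    ultimately have "positive (\<theta> - b)" unfolding positive_def by metis
    then show ?thesis using 2 c \<open>r = b - \<theta>\<close> by (simp add: r_def)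
  qed
qed

lemma wall_theta: "wall (- \<theta>) 1"
  unfolding wall_def
proof (intro conjI ballI impI)
  show "- \<theta> \<in> R" by (rule root_uminus[OF theta_root])
  show "0 < aff (- \<theta>) 1 p0" using aff_negative_iff[OF p0_alcove theta_positive] by simp
  fix g assume g: "g \<in> affine_roots" "0 < g p0" "g (reflection (- \<theta>) 1 p0) < 0"
  obtain b k where b: "b \<in> R" "g = aff b k" using g(1) by (rule affine_root_cases)
  have t: "0 < p0 \<bullet> \<theta>" "p0 \<bullet> \<theta> < 1" using alcove_positive[OF p0_alcove theta_positive] by auto
  have "reflection (- \<theta>) 1 p0 = reflection \<theta> 0 p0 + coroot \<theta>"
    by (simp add: reflection_def coroot_minus algebra_simps)
  then have val: "g (reflection (- \<theta>) 1 p0) = p0 \<bullet> reflection \<theta> 0 b + b \<bullet> coroot \<theta> + of_int k"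
    using b(2) root_nonzero[OF theta_root]
    by (simp add: aff_def inner_add_left reflection_adjoint inner_commute[of "coroot \<theta>"])
  have self: "reflection \<theta> 0 \<theta> = - \<theta>" "\<theta> \<bullet> coroot \<theta> = 2"
    using root_nonzero[OF theta_root] by (simp_all add: reflection_self inner_coroot_self)
  consider "positive b" "0 \<le> k" | "positive (- b)" "1 \<le> k"
    using aff_p0_positive_cases b g(2) by blast
  then show "g = aff (- \<theta>) 1"
  proof cases
    case 1
    have k: "0 \<le> (of_int k :: real)" using 1(2) by simp
    have "0 < g (reflection (- \<theta>) 1 p0)"
    proof (cases "b = \<theta>")
      case True
      then show ?thesis using val self t k by simp
    next
      case False
      from theta_string[OF 1(1) this] show ?thesis
        using val t k alcove_positive[OF p0_alcove 1(1)] by (auto simp: inner_diff_right)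
    qed
    then show ?thesis using g(3) by simp
  next
    case 2
    define d where "d = - b"
    have d: "positive d" "b = - d" using 2 by (simp_all add: d_def)
    have k: "1 \<le> (of_int k :: real)" using 2(2) by simp
    have val': "g (reflection (- \<theta>) 1 p0) = of_int k - p0 \<bullet> reflection \<theta> 0 d - d \<bullet> coroot \<theta>"
      using val d by (simp add: linear_neg[OF linear_reflection])
    have "d = \<theta>"
    proof (rule ccontr)
      assume "d \<noteq> \<theta>"
      from theta_string[OF d(1) this] have "0 < g (reflection (- \<theta>) 1 p0)"
      proof
        assume "d \<bullet> coroot \<theta> = 0 \<and> reflection \<theta> 0 d = d"
        then show ?thesis using val' k alcove_positive[OF p0_alcove d(1)] by simp
      next
        assume *: "d \<bullet> coroot \<theta> = 1 \<and> positive (\<theta> - d) \<and> reflection \<theta> 0 d = d - \<theta>"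
        then have "0 < p0 \<bullet> (\<theta> - d)" using alcove_positive[OF p0_alcove] by blast
        then show ?thesis using val' k * by (simp add: inner_diff_right)
      qed
      then show False using g(3) by simp
    qed
    then have "of_int k + p0 \<bullet> \<theta> - 2 < 0" using val' self g(3) by simp
    then have "(of_int k :: real) < 2" using t by simp
    then have "k = 1" using 2(2) by simp
    then show ?thesis using b(2) d(2) \<open>d = \<theta>\<close> by simp
  qed
qed

lemma wall_aff_reflection: "wall a k \<Longrightarrow> aff a k (reflection a k v) = - aff a k v"
  by (simp add: aff_reflection root_nonzero wall_root)

text \<open>
  The walls of the alcove of \<open>b\<close>, in the same sense.
\<close>

definition wall_of :: "('a \<Rightarrow> 'a) \<Rightarrow> 'a \<Rightarrow> int \<Rightarrow> bool" where
  "wall_of b c j \<longleftrightarrow> c \<in> R \<and> 0 < aff c j (b p0) \<and>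
     (\<forall>g\<in>affine_roots. 0 < g (b p0) \<longrightarrow> g (reflection c j (b p0)) < 0 \<longrightarrow> g = aff c j)"

lemma wall_of_image:
  assumes w: "wall a k" and b: "b \<in> We" and eq: "aff a k \<circ> inv b = aff c j"
  shows "wall_of b c j"
  unfolding wall_of_def
proof (intro conjI ballI impI)
  have "aff c j \<in> affine_roots"
    using affine_root_comp[OF aff_affine_root[OF wall_root[OF w], of k] ext_inverse(2)[OF b]] eq by simp
  then show "c \<in> R" by (metis affine_root_cases aff_eq_iff)
  have F: "aff c j (b v) = aff a k v" for v using fun_cong[OF eq, of "b v"] b by simp
  show "0 < aff c j (b p0)" using F wall_pos[OF w] by simp
  fix g assume g: "g \<in> affine_roots" "0 < g (b p0)" "g (reflection c j (b p0)) < 0"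
  have "reflection c j (b p0) = b (reflection a k p0)"
    using fun_cong[OF comp_reflection[OF b wall_root[OF w] eq], of p0] by simp
  then have "g \<circ> b = aff a k" using wallD[OF w affine_root_comp[OF g(1) b]] g by simp
  then have "g \<circ> (b \<circ> inv b) = aff a k \<circ> inv b" by (metis comp_assoc)
  then show "g = aff c j" using b eq by simp
qed

lemma wall_conj_flat:
  assumes w: "wall a k" and g: "flat g" and eq: "aff a k \<circ> inv g = aff b j"
  shows "wall b j"
proof -
  have wg: "wall_of g b j" by (rule wall_of_image[OF w flat_ext[OF g] eq])
  then have b: "b \<in> R" by (simp add: wall_of_def)
  have "h (reflection b j (g p0)) < 0 \<longleftrightarrow> h (reflection b j p0) < 0" if "h \<in> affine_roots" for h
    using flatD(2)[OF g affine_root_comp[OF that ext_reflection[OF b]]] by simp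
  then show ?thesis
    using wg flatD(1)[OF g] aff_affine_root[OF b] by (simp add: wall_of_def wall_def)
qed

text \<open>
  Apart from the wall itself, reflecting in a wall permutes the affine roots that are positive on
  the fundamental alcove.
\<close>

lemma inversions_wall:
  assumes w: "wall a k" and x: "x \<in> We" and g: "g \<in> inversions (reflection a k \<circ> x)" "g \<noteq> aff a k"
  shows "g \<circ> reflection a k \<in> inversions x"
proof -
  have g': "g \<in> affine_roots" "0 < g p0" "g (reflection a k (x p0)) < 0"
    using g by (auto simp: inversions_def)
  have "0 < g (reflection a k p0)"
    using wallD[OF w g'(1,2)] g(2) affine_root_orbit[OF g'(1) wall_ext[OF w]] by auto
  then show ?thesis using g' affine_root_comp[OF g'(1) wall_ext[OF w]] by (simp add: inversions_def)
qed

lemma reflect_fun_twice: "a \<in> R \<Longrightarrow> g \<circ> reflection a k \<circ> reflection a k = g"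
  by (auto simp: fun_eq_iff root_nonzero)

lemma len_wall_less:
  assumes w: "wall a k" and x: "x \<in> We" and neg: "aff a k (x p0) < 0"
  shows "len (reflection a k \<circ> x) < len x"
proof -
  let ?r = "\<lambda>g. g \<circ> reflection a k"
  have not_self: "aff a k \<notin> inversions (reflection a k \<circ> x)"
    using neg by (simp add: inversions_def wall_aff_reflection[OF w])
  have "?r ` inversions (reflection a k \<circ> x) \<subseteq> inversions x - {aff a k}"
  proof
    fix h assume "h \<in> ?r ` inversions (reflection a k \<circ> x)"
    then obtain g where g: "g \<in> inversions (reflection a k \<circ> x)" "h = ?r g" by blast
    have "h \<noteq> aff a k"
    proof
      assume "h = aff a k"
      then have "g p0 = aff a k (reflection a k p0)"
        using g(2) reflect_fun_twice[OF wall_root[OF w], of g k] by (metis comp_apply)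
      then show False using g(1) wall_pos[OF w] by (simp add: inversions_def wall_aff_reflection[OF w])
    qed
    then show "h \<in> inversions x - {aff a k}"
      using inversions_wall[OF w x g(1)] g not_self by auto
  qed
  moreover have "inj_on ?r (inversions (reflection a k \<circ> x))"
    by (rule inj_on_inverseI[of _ ?r]) (rule reflect_fun_twice[OF wall_root[OF w]])
  ultimately have "len (reflection a k \<circ> x) \<le> card (inversions x - {aff a k})"
    by (intro card_inj_on_le[of ?r]) (auto intro: finite_inversions)
  also have "\<dots> < len x"
  proof (rule psubset_card_mono[OF finite_inversions])
    have "aff a k \<in> inversions x"
      using neg w by (simp add: inversions_def wall_pos aff_affine_root wall_root)
    then show "inversions x - {aff a k} \<subset> inversions x" by blast
  qed
  finally show ?thesis .
qed

lemma len_wall_le: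
  assumes w: "wall a k" and x: "x \<in> We"
  shows "len (reflection a k \<circ> x) \<le> Suc (len x)"
proof -
  let ?r = "\<lambda>g. g \<circ> reflection a k"
  have "inversions (reflection a k \<circ> x) \<subseteq> insert (aff a k) (?r ` inversions x)"
  proof
    fix g assume g: "g \<in> inversions (reflection a k \<circ> x)"
    show "g \<in> insert (aff a k) (?r ` inversions x)"
      using inversions_wall[OF w x g] reflect_fun_twice[OF wall_root[OF w], of g k]
      by (metis image_eqI insertCI)
  qed
  then have "len (reflection a k \<circ> x) \<le> card (insert (aff a k) (?r ` inversions x))"
    by (intro card_mono) (auto intro: finite_inversions)
  also have "\<dots> \<le> Suc (card (?r ` inversions x))" by (rule card_insert_le_m1) auto
  also have "\<dots> \<le> Suc (len x)" using card_image_le[OF finite_inversions] by simp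
  finally show ?thesis .
qed

lemma len_wall_greater:
  assumes w: "wall a k" and x: "x \<in> We" and pos: "0 < aff a k (x p0)"
  shows "len x < len (reflection a k \<circ> x)"
proof -
  have "reflection a k \<circ> (reflection a k \<circ> x) = x"
    using wall_root[OF w] by (auto simp: fun_eq_iff root_nonzero)
  then show ?thesis
    using len_wall_less[OF w ext_comp[OF wall_ext[OF w] x]] pos by (simp add: wall_aff_reflection[OF w])
qed

text \<open>
  The hyperplanes that bound the fundamental alcove. An alcove other than the fundamental one is
  separated from it by one of them, which is what makes induction on the length possible.
\<close>

definition simple_wall :: "'a \<Rightarrow> int \<Rightarrow> bool" where
  "simple_wall a k \<longleftrightarrow> a = - \<theta> \<and> k = 1 \<or> (\<exists>i\<in>I. a = \<alpha> i \<and> k = 0)"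

lemma simple_wall_wall: "simple_wall a k \<Longrightarrow> wall a k"
  using wall_theta wall_alpha by (auto simp: simple_wall_def)

lemma flat_or_descent:
  assumes x: "x \<in> We"
  shows "flat x \<or> (\<exists>a k. simple_wall a k \<and> aff a k (x p0) < 0)"
proof (cases "\<exists>a k. simple_wall a k \<and> aff a k (x p0) < 0")
  case False
  have pos: "0 < aff a k (x p0)" if "simple_wall a k" for a k
    using False that affine_root_orbit[OF aff_affine_root x, of a k] wall_root[OF simple_wall_wall[OF that]]
    by auto
  have "x p0 \<in> fund_alcove \<alpha> \<theta>"
    unfolding fund_alcove_def index_set[symmetric]
    using pos[of "- \<theta>" 1] pos[of "\<alpha> _" 0] by (auto simp: simple_wall_def aff_def)
  then have "flat x" using affine_root_sign x by (simp add: flat_def)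
  then show ?thesis ..
qed blast

end

definition word :: "('a::euclidean_space \<times> int) list \<Rightarrow> 'a \<Rightarrow> 'a" where
  "word ws = foldr (\<lambda>(a, k) v. reflection a k \<circ> v) ws id"

lemma word_simps [simp]:
  "word [] = id" "word ((a, k) # ws) = reflection a k \<circ> word ws"
  by (simp_all add: word_def)

lemma word_append: "word (us @ vs) = word us \<circ> word vs"
  by (induction us) (auto simp: comp_assoc)

context root_datum
begin

section \<open>Reduced words\<close>

definition walls :: "('a \<times> int) list \<Rightarrow> bool" where
  "walls ws \<longleftrightarrow> (\<forall>(a, k)\<in>set ws. wall a k)"

lemma walls_simps [simp]:
  "walls []" "walls ((a, k) # ws) \<longleftrightarrow> wall a k \<and> walls ws"
  "walls (us @ vs) \<longleftrightarrow> walls us \<and> walls vs" "walls (rev ws) \<longleftrightarrow> walls ws"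
  by (auto simp: walls_def)

definition reduced_word :: "('a \<times> int) list \<Rightarrow> bool" where
  "reduced_word ws \<longleftrightarrow> len (word ws) = length ws"

lemma word_ext: "walls ws \<Longrightarrow> word ws \<in> We"
  by (induction ws) (auto simp: ext_id wall_ext intro!: ext_comp)

lemma len_flat: assumes "flat g" shows "len g = 0"
proof -
  have "f \<notin> inversions g" for f using flatD(2)[OF assms, of f] by (auto simp: inversions_def)
  then have "inversions g = {}" by blast
  then show ?thesis by simp
qed

lemma len_word_le: "walls ws \<Longrightarrow> len (word ws) \<le> length ws"
proof (induction ws)
  case Nil
  then show ?case using len_flat[OF flat_id] by (simp del: id_apply)
next
  case (Cons p ws)
  obtain a k where p: "p = (a, k)" by (cases p)
  have "wall a k" "walls ws" using Cons.prems by (simp_all add: p)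
  then have "len (reflection a k \<circ> word ws) \<le> Suc (length ws)"
    using Cons.IH len_wall_le[OF _ word_ext] le_trans by blast
  then show ?case by (simp add: p del: comp_apply)
qed

text \<open>
  A letter changes the length by at most one, so in a reduced word each letter increases it.
\<close>

lemma reduced_word_Cons:
  assumes "walls ((a, k) # ws)" "reduced_word ((a, k) # ws)"
  shows "reduced_word ws" "0 < aff a k (word ws p0)"
proof -
  have w: "wall a k" "walls ws" "word ws \<in> We" using assms(1) word_ext by simp_all
  have len: "len (reflection a k \<circ> word ws) = Suc (length ws)"
    using assms(2) by (simp add: reduced_word_def)
  show "reduced_word ws"
    using len len_wall_le[OF w(1,3)] len_word_le[OF w(2)] by (simp add: reduced_word_def)
  have "\<not> aff a k (word ws p0) < 0"
    using len len_wall_less[OF w(1,3)] len_word_le[OF w(2)] by force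
  then show "0 < aff a k (word ws p0)"
    using affine_root_orbit[OF aff_affine_root[OF wall_root[OF w(1)]] w(3), of k] by simp
qed

lemma word_rev: "walls ws \<Longrightarrow> word (rev ws) = inv (word ws)"
proof (induction ws)
  case (Cons p ws)
  obtain a k where p: "p = (a, k)" by (cases p)
  have "wall a k" "walls ws" using Cons.prems by (simp_all add: p)
  then show ?case
    using Cons.IH
    by (simp add: p word_append inv_comp_ext wall_ext word_ext inv_reflection wall_root del: comp_apply)
qed (simp add: inv_id)

lemma reduced_word_rev: "walls ws \<Longrightarrow> reduced_word (rev ws) \<longleftrightarrow> reduced_word ws"
  by (simp add: reduced_word_def word_rev len_inverse word_ext)

lemma reduced_word_snoc:
  assumes "walls (ws @ [(a, k)])" "reduced_word (ws @ [(a, k)])"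
  shows "reduced_word ws" "0 < aff a k (inv (word ws) p0)"
proof -
  have "walls ((a, k) # rev ws)" "reduced_word ((a, k) # rev ws)"
    using assms reduced_word_rev[OF assms(1)] by simp_all
  from reduced_word_Cons[OF this] show "reduced_word ws" "0 < aff a k (inv (word ws) p0)"
    using assms(1) by (simp_all add: reduced_word_rev word_rev)
qed

section \<open>The Bruhat order\<close>

text \<open>
  The Bruhat order, generated by reflections in hyperplanes that separate \<open>y\<close> from the fundamental
  alcove.
\<close>

inductive_set below :: "('a \<Rightarrow> 'a) \<Rightarrow> ('a \<Rightarrow> 'a) set" for z where
  refl: "z \<in> below z"
| step: "y \<in> below z \<Longrightarrow> a \<in> R \<Longrightarrow> 0 < aff a k p0 \<Longrightarrow> aff a k (y p0) < 0
    \<Longrightarrow> reflection a k \<circ> y \<in> below z"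

abbreviation bruhat :: "('a \<Rightarrow> 'a) \<Rightarrow> ('a \<Rightarrow> 'a) \<Rightarrow> bool" where
  "bruhat y z \<equiv> y \<in> below z"

lemma bruhat_trans: "bruhat x y \<Longrightarrow> bruhat y z \<Longrightarrow> bruhat x z"
  by (induction rule: below.induct) (auto intro: below.step)

lemma bruhat_ext: "bruhat y z \<Longrightarrow> z \<in> We \<Longrightarrow> y \<in> We"
  by (induction rule: below.induct) (auto intro: ext_comp ext_reflection)

text \<open>
  If a reflection \<open>t\<close> takes \<open>y\<close> down and is not the simple reflection \<open>s\<close>, then its conjugate
  under \<open>s\<close> takes \<open>s y\<close> down, since \<open>s\<close> moves no other hyperplane across the fundamental alcove.
\<close>

lemma bruhat_lifting:
  assumes w: "wall b j" and yz: "bruhat y z"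
  shows "bruhat (reflection b j \<circ> y) z \<or> bruhat (reflection b j \<circ> y) (reflection b j \<circ> z)"
  using yz
proof (induction rule: below.induct)
  case refl
  then show ?case using below.refl by blast
next
  case (step y a k)
  let ?s = "reflection b j"
  show ?case
  proof (cases "aff a k = aff b j")
    case True
    then have "a = b" "k = j" by (simp_all add: aff_eq_iff)
    then have "?s \<circ> (reflection a k \<circ> y) = y"
      using wall_root[OF w] by (auto simp: fun_eq_iff root_nonzero)
    then have "bruhat (?s \<circ> (reflection a k \<circ> y)) z" using step(1) by simp
    then show ?thesis by blast
  next
    case False
    have f: "aff a k \<in> affine_roots" using step(2) by (rule aff_affine_root)
    obtain a' k' where c: "a' \<in> R" "aff a k \<circ> inv ?s = aff a' k'"
      using affine_root_comp[OF f ext_inverse(2)[OF wall_ext[OF w]]] affine_root_cases by blast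
    have conj: "?s \<circ> reflection a k = reflection a' k' \<circ> ?s"
      by (rule comp_reflection[OF wall_ext[OF w] step(2) c(2)])
    have eval: "aff a' k' v = aff a k (?s v)" for v
      using fun_cong[OF c(2), of v] by (simp add: inv_reflection[OF wall_root[OF w]])
    have "0 < aff a' k' p0"
      using wallD[OF w f step(3)] False affine_root_orbit[OF f wall_ext[OF w]] by (auto simp: eval)
    moreover have "aff a' k' ((?s \<circ> y) p0) < 0"
      using step(4) wall_root[OF w] by (simp add: eval root_nonzero)
    moreover have "?s \<circ> (reflection a k \<circ> y) = reflection a' k' \<circ> (?s \<circ> y)"
      using conj by (metis comp_assoc)
    ultimately show ?thesis using step.IH c(1) below.step by metis
  qed
qed

fun subword_products :: "('a \<times> int) list \<Rightarrow> ('a \<Rightarrow> 'a) set" where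
  "subword_products [] = {id}"
| "subword_products ((a, k) # ws) =
     subword_products ws \<union> (\<lambda>y. reflection a k \<circ> y) ` subword_products ws"

text \<open>
  Induction on the word from the left. A subword that uses the first letter \<open>s\<close> is handled by
  lifting the comparison of the remaining subword with the remaining word.
\<close>

lemma subword_bruhat:
  assumes "walls ws" "reduced_word ws" "flat g" "y \<in> subword_products ws"
  shows "bruhat (y \<circ> g) (word ws \<circ> g)"
  using assms(1,2,4)
proof (induction ws arbitrary: y rule: subword_products.induct)
  case 1
  then show ?case using below.refl by simp
next
  case (2 a k ws)
  let ?s = "reflection a k" and ?z = "word ws \<circ> g"
  have w: "wall a k" "walls ws" "word ws \<in> We" using "2.prems"(1) by (simp_all add: word_ext)
  have red: "reduced_word ws" "0 < aff a k (word ws p0)" using reduced_word_Cons[OF "2.prems"(1,2)] .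
  have "0 < (aff a k \<circ> word ws) (g p0)"
    using flatD(1)[OF assms(3) affine_root_comp[OF aff_affine_root[OF wall_root[OF w(1)]] w(3)]] red(2)
    by simp
  then have "bruhat (?s \<circ> (?s \<circ> ?z)) (?s \<circ> ?z)"
    by (intro below.step below.refl wall_root[OF w(1)] wall_pos[OF w(1)])
      (simp add: wall_aff_reflection[OF w(1)])
  moreover have "?s \<circ> (?s \<circ> ?z) = ?z"
    using wall_root[OF w(1)] by (auto simp: fun_eq_iff root_nonzero)
  ultimately have up: "bruhat ?z (?s \<circ> ?z)" by simp
  have IH: "bruhat (y \<circ> g) ?z" if "y \<in> subword_products ws" for y
    using "2.IH" that w(2) red(1) by blast
  have "bruhat (y \<circ> g) (?s \<circ> ?z)"
  proof (cases "y \<in> subword_products ws")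
    case True
    then show ?thesis using IH up bruhat_trans by blast
  next
    case False
    then obtain y' where y': "y' \<in> subword_products ws" "y = ?s \<circ> y'" using "2.prems"(3) by auto
    then show ?thesis
      using bruhat_lifting[OF w(1) IH[OF y'(1)]] up bruhat_trans by (auto simp: comp_assoc)
  qed
  then show ?case by (simp add: comp_assoc del: comp_apply)
qed

lemma subword_products_append:
  "x \<in> subword_products (us @ vs) \<Longrightarrow> \<exists>y\<in>subword_products us. \<exists>z\<in>subword_products vs. x = y \<circ> z"
proof (induction us arbitrary: x rule: subword_products.induct)
  case (2 a k us)
  then consider "x \<in> subword_products (us @ vs)"
    | x' where "x' \<in> subword_products (us @ vs)" "x = reflection a k \<circ> x'" by auto
  then show ?case
  proof cases
    case 1
    then show ?thesis using 2(1) by fastforce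
  next
    case (2 x')
    then obtain y z where "y \<in> subword_products us" "z \<in> subword_products vs" "x' = y \<circ> z"
      using "2.IH" by blast
    then show ?thesis using 2 by (intro bexI[of _ "reflection a k \<circ> y"] bexI[of _ z]) (auto simp: comp_assoc)
  qed
qed simp

section \<open>Dominance\<close>

definition simple_letters :: "nat list \<Rightarrow> ('a \<times> int) list" where
  "simple_letters = map (\<lambda>i. (\<alpha> i, 0))"

lemma reflection_simple_word:
  assumes "positive b"
  shows "\<exists>is. set is \<subseteq> I \<and> reflection b 0 = word (simple_letters is)"
  using assms
proof (induction rule: positive_root_induct)
  case (simple i)
  then show ?case by (intro exI[of _ "[i]"]) (simp add: simple_letters_def)
next
  case (reflect b i)
  then obtain "is" where "is": "set is \<subseteq> I" "reflection b 0 = word (simple_letters is)" by blast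
  let ?s = "reflection (\<alpha> i) 0"
  have ss: "?s \<circ> ?s = id" using alpha_nonzero[OF reflect(2)] by (auto simp: fun_eq_iff)
  have "?s \<circ> reflection b 0 = reflection (?s b) 0 \<circ> ?s"
    by (rule weyl_conj_reflection[OF weyl_reflection[OF alpha_root[OF reflect(2)]]])
  then have "reflection (?s b) 0 = ?s \<circ> reflection b 0 \<circ> ?s" using ss by (metis comp_assoc comp_id)
  then show ?case
    using "is" reflect(2)
    by (intro exI[of _ "i # is @ [i]"]) (simp add: simple_letters_def word_append comp_assoc)
qed

lemma weyl_simple_word:
  assumes "w \<in> W0"
  shows "\<exists>is. set is \<subseteq> I \<and> w = word (simple_letters is)"
  using assms
proof (induction rule: weyl_induct)
  case id
  then show ?case by (intro exI[of _ "[]"]) (simp add: simple_letters_def)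
next
  case (reflection a w)
  have "\<exists>js. set js \<subseteq> I \<and> reflection a 0 = word (simple_letters js)"
    using positive_or_negative[OF reflection(1)] reflection_simple_word[of a]
      reflection_simple_word[of "- a"] reflection_minus[of a 0] by auto
  then obtain js "is" where "set js \<subseteq> I" "reflection a 0 = word (simple_letters js)"
    "set is \<subseteq> I" "w = word (simple_letters is)" using reflection(3) by blast
  then show ?case
    by (intro exI[of _ "js @ is"]) (simp add: simple_letters_def word_append)
qed

text \<open>
  A gallery that returns to the positive side of a simple hyperplane crosses it on the way back;
  reflecting the part before that crossing shortens the word.
\<close>

lemma deletion:
  assumes i: "i \<in> I" and "x \<in> We" "set js \<subseteq> I"
    and "aff (\<alpha> i) 0 (x p0) < 0" "0 < aff (\<alpha> i) 0 ((x \<circ> word (simple_letters js)) p0)"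
  shows "\<exists>js'. set js' \<subseteq> I \<and> length js' < length js \<and>
    x \<circ> word (simple_letters js) = reflection (\<alpha> i) 0 \<circ> x \<circ> word (simple_letters js')"
  using assms(2-)
proof (induction js arbitrary: x)
  case Nil
  then show ?case by (simp add: simple_letters_def)
next
  case (Cons j js)
  let ?f = "aff (\<alpha> i) 0" and ?s = "reflection (\<alpha> j) 0" and ?js = "word (simple_letters js)"
  have j: "j \<in> I" "set js \<subseteq> I" using Cons.prems by auto
  have w: "wall (\<alpha> j) 0" by (rule wall_alpha[OF j(1)])
  have xs: "x \<circ> ?s \<in> We" using Cons.prems(1) w ext_comp wall_ext by blast
  have split: "x \<circ> word (simple_letters (j # js)) = (x \<circ> ?s) \<circ> ?js"
    by (simp add: simple_letters_def comp_assoc)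
  have f: "?f \<in> affine_roots" by (rule aff_affine_root[OF alpha_root[OF i]])
  consider "?f ((x \<circ> ?s) p0) < 0" | "0 < ?f ((x \<circ> ?s) p0)"
    using affine_root_orbit[OF f xs] by linarith
  then show ?case
  proof cases
    case 1
    then obtain js' where js': "set js' \<subseteq> I" "length js' < length js"
      "x \<circ> ?s \<circ> ?js = reflection (\<alpha> i) 0 \<circ> (x \<circ> ?s) \<circ> word (simple_letters js')"
      using Cons.IH[OF xs j(2)] Cons.prems(4) split by metis
    show ?thesis
      using js' j split
      by (intro exI[of _ "j # js'"]) (simp add: simple_letters_def comp_assoc del: comp_apply)
  next
    case 2
    have g: "(\<lambda>v. - (?f \<circ> x) v) \<in> affine_roots"
      by (rule affine_root_minus[OF affine_root_comp[OF f Cons.prems(1)]])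
    have eq: "(\<lambda>v. - (?f \<circ> x) v) = aff (\<alpha> j) 0"
      using wallD[OF w g] Cons.prems(3) 2 by simp
    have "aff (\<alpha> j) 0 \<circ> inv x = aff (- \<alpha> i) 0"
      using Cons.prems(1) aff_minus[of "\<alpha> i" 0] by (auto simp: fun_eq_iff simp flip: eq)
    then have "x \<circ> ?s = reflection (- \<alpha> i) 0 \<circ> x"
      by (rule comp_reflection[OF Cons.prems(1) alpha_root[OF j(1)]])
    then have "x \<circ> ?s = reflection (\<alpha> i) 0 \<circ> x" using reflection_minus[of "\<alpha> i" 0] by simp
    then show ?thesis using split j(2) by (intro exI[of _ js]) simp
  qed
qed

definition dominant :: "'a \<Rightarrow> bool" where
  "dominant x \<longleftrightarrow> (\<forall>i\<in>I. 0 \<le> x \<bullet> \<alpha> i)"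

lemma dominant_positive: "dominant x \<Longrightarrow> positive b \<Longrightarrow> 0 \<le> x \<bullet> b"
  unfolding inner_expansion[of x b] by (intro sum_nonneg) (auto simp: dominant_def positive_def)

lemma omega_dominant: "i \<in> I \<Longrightarrow> dominant (\<omega> i)"
  by (simp add: dominant_def omega_alpha)

lemma positive_iff_p0: "b \<in> R \<Longrightarrow> positive b \<longleftrightarrow> 0 < p0 \<bullet> b"
  using alcove_positive(1)[OF p0_alcove, of b] alcove_positive(1)[OF p0_alcove, of "- b"]
    positive_or_negative by fastforce

text \<open>
  Induction on the length of a word for \<open>w\<close> in simple reflections. If the first letter takes the
  alcove of the remaining word away from the dominant chamber, then removing that letter can only
  increase the inner product. Otherwise the word can be shortened by deletion.
\<close>

lemma dominant_maximizes:
  assumes x: "dominant x" and y: "dominant y" and w: "w \<in> W0"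
  shows "x \<bullet> w y \<le> x \<bullet> y"
proof -
  have "x \<bullet> word (simple_letters is) y \<le> x \<bullet> y" if "set is \<subseteq> I" for "is"
    using that
  proof (induction "length is" arbitrary: "is" rule: less_induct)
    case less
    show ?case
    proof (cases "is")
      case Nil
      then show ?thesis by (simp add: simple_letters_def)
    next
      case (Cons i js)
      let ?s = "reflection (\<alpha> i) 0" and ?w = "word (simple_letters is)"
      have i: "i \<in> I" "set js \<subseteq> I" using less.prems Cons by auto
      have w: "?w = ?s \<circ> word (simple_letters js)" by (simp add: Cons simple_letters_def)
      have "word (simple_letters ks) \<in> W0" if "set ks \<subseteq> I" for ks
        using that by (induction ks) (auto simp: simple_letters_def weyl_id intro!: weyl_comp weyl_reflection alpha_root)
      then have wW: "?w \<in> W0" using less.prems by blast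
      have f: "aff (\<alpha> i) 0 \<in> affine_roots" by (rule aff_affine_root[OF alpha_root[OF i(1)]])
      consider "aff (\<alpha> i) 0 (?w p0) < 0" | "0 < aff (\<alpha> i) 0 (?w p0)"
        using affine_root_orbit[OF f weyl_ext[OF wW]] by linarith
      then show ?thesis
      proof cases
        case 1
        let ?b = "inv ?w (\<alpha> i)"
        have b: "?b \<in> R" using weyl_root weyl_inverse(2) wW alpha_root i(1) by blast
        have "p0 \<bullet> ?b < 0" using 1 wW by (simp add: aff_def weyl_adjoint)
        then have "positive (- ?b)" using positive_iff_p0[OF b] not_positive_iff[OF b] by simp
        then have neg: "?w y \<bullet> \<alpha> i \<le> 0" using dominant_positive[OF y] wW by (fastforce simp: weyl_adjoint)
        have "0 \<le> x \<bullet> coroot (\<alpha> i)" using x i(1) by (simp add: dominant_def coroot_def)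
        then have "(?w y \<bullet> \<alpha> i) * (x \<bullet> coroot (\<alpha> i)) \<le> 0" using neg by (rule mult_nonpos_nonneg[rotated])
        then have "x \<bullet> ?w y \<le> x \<bullet> ?s (?w y)" by (simp add: reflection_def inner_diff_right)
        also have "?s (?w y) = word (simple_letters js) y" using w alpha_nonzero[OF i(1)] by simp
        also have "x \<bullet> \<dots> \<le> x \<bullet> y" using less.hyps[of js] i(2) Cons by simp
        finally show ?thesis .
      next
        case 2
        have "aff (\<alpha> i) 0 (?s p0) < 0"
          using wall_alpha[OF i(1)] by (simp add: wall_aff_reflection wall_pos)
        then obtain js' where js': "set js' \<subseteq> I" "length js' < length js"
          "?s \<circ> word (simple_letters js) = ?s \<circ> ?s \<circ> word (simple_letters js')"
          using deletion[OF i(1) wall_ext[OF wall_alpha[OF i(1)]] i(2)] 2 w by metis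
        moreover have "?s \<circ> ?s = id" using alpha_nonzero[OF i(1)] by (auto simp: fun_eq_iff)
        ultimately have "?w = word (simple_letters js')" using w by simp
        then show ?thesis using less.hyps[of js'] js' Cons by simp
      qed
    qed
  qed
  then show ?thesis using weyl_simple_word[OF w] by blast
qed

lemma dominant_unique:
  assumes y: "dominant y" and w: "w \<in> W0" and wy: "dominant (w y)"
  shows "w y = y"
proof (rule eq_if_omega_eq)
  fix i assume "i \<in> I"
  then show "\<omega> i \<bullet> w y = \<omega> i \<bullet> y"
    using dominant_maximizes[OF omega_dominant y w] w
      dominant_maximizes[OF omega_dominant wy weyl_inverse(2)[OF w]] by (intro antisym) auto
qed

section \<open>The saturated set\<close>

lemma saturated_set_iff:
  "x \<in> saturated_set R \<alpha> l \<longleftrightarrow> (\<forall>w\<in>W0. l - w x \<in> pos_coroot_cone \<alpha>)"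
proof -
  have "x \<in> w ` {l - q | q. q \<in> pos_coroot_cone \<alpha>} \<longleftrightarrow> l - inv w x \<in> pos_coroot_cone \<alpha>" if "w \<in> W0" for w
  proof
    assume "x \<in> w ` {l - q | q. q \<in> pos_coroot_cone \<alpha>}"
    then show "l - inv w x \<in> pos_coroot_cone \<alpha>" using that by auto
  next
    assume "l - inv w x \<in> pos_coroot_cone \<alpha>"
    moreover have "x = w (l - (l - inv w x))" using that by simp
    ultimately show "x \<in> w ` {l - q | q. q \<in> pos_coroot_cone \<alpha>}" by blast
  qed
  then have "x \<in> saturated_set R \<alpha> l \<longleftrightarrow> (\<forall>w\<in>W0. l - inv w x \<in> pos_coroot_cone \<alpha>)"
    by (simp add: saturated_set_def)
  also have "\<dots> \<longleftrightarrow> (\<forall>w\<in>W0. l - w x \<in> pos_coroot_cone \<alpha>)"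
    using weyl_inverse by (metis inv_inv_eq)
  finally show ?thesis .
qed

lemma saturated_weyl: "x \<in> saturated_set R \<alpha> l \<Longrightarrow> w \<in> W0 \<Longrightarrow> w x \<in> saturated_set R \<alpha> l"
  unfolding saturated_set_iff using weyl_comp by (metis comp_apply)

text \<open>
  It has to be seen that each \<open>w\<close> maps the string below \<open>l\<close>. If \<open>w\<close> makes \<open>b\<close> positive, then the
  string descends from \<open>w x\<close>. Otherwise it descends from the image of its other end, which is
  conjugate to \<open>x\<close> by the reflection in \<open>b\<close>.
\<close>

lemma saturated_string:
  assumes x: "x \<in> saturated_set R \<alpha> l" and b: "b \<in> R" and c: "0 \<le> c" "of_int c \<le> x \<bullet> b"
  shows "x - of_int c *\<^sub>R coroot b \<in> saturated_set R \<alpha> l"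
  unfolding saturated_set_iff
proof
  fix w assume w: "w \<in> W0"
  let ?y = "x - of_int c *\<^sub>R coroot b"
  have wb: "w b \<in> R" using weyl_root w b by blast
  have diff: "l - w ?y = (l - w x) + of_int c *\<^sub>R coroot (w b)"
    using w by (simp add: weyl_diff weyl_scale weyl_coroot)
  have cone: "l - v x \<in> coroot_lattice" "\<And>i. i \<in> I \<Longrightarrow> 0 \<le> \<omega> i \<bullet> (l - v x)" if "v \<in> W0" for v
    using x that by (auto simp: saturated_set_iff pos_coroot_cone_iff)
  have "l - w ?y \<in> coroot_lattice"
    unfolding diff using cone(1)[OF w] wb coroot_lattice_add coroot_lattice_scale coroot_in_lattice by blast
  moreover have "0 \<le> \<omega> i \<bullet> (l - w ?y)" if i: "i \<in> I" for i
  proof (cases "positive (w b)")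
    case True
    then show ?thesis
      unfolding diff using cone(2)[OF w i] omega_coroot_nonneg[OF True i] c(1)
      by (simp add: inner_add_right)
  next
    case False
    then have neg: "positive (- w b)" using not_positive_iff wb by blast
    let ?v = "w \<circ> reflection b 0"
    have v: "?v \<in> W0" using w b weyl_comp weyl_reflection by blast
    have flip: "l - w ?y = (l - ?v x) + (x \<bullet> b - of_int c) *\<^sub>R coroot (- w b)"
      using w by (simp add: reflection_def weyl_diff weyl_scale weyl_coroot coroot_minus algebra_simps)
    show ?thesis
      unfolding flip using cone(2)[OF v i] omega_coroot_nonneg[OF neg i] c(2) by (simp add: inner_add_right)
  qed
  ultimately show "l - w ?y \<in> pos_coroot_cone \<alpha>" by (simp add: pos_coroot_cone_iff)
qed

lemma highest_in_saturated:
  assumes "l \<in> coweights \<omega>" "dominant l"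
  shows "l \<in> saturated_set R \<alpha> l"
  unfolding saturated_set_iff pos_coroot_cone_iff
  using assms weyl_coweight_diff dominant_maximizes[OF omega_dominant]
  by (auto simp: inner_diff_right)

lemma ext_zero_coweight: "x \<in> We \<Longrightarrow> x 0 \<in> coweights \<omega>"
  by (erule ext_cases) (simp add: weyl_zero)

text \<open>
  Descending in the Bruhat order moves the image of the origin towards the origin, along a string
  in the direction of a root.
\<close>

lemma bruhat_saturated:
  assumes "bruhat y z" and z: "z \<in> We" "z 0 \<in> saturated_set R \<alpha> l"
  shows "y 0 \<in> saturated_set R \<alpha> l"
  using assms(1)
proof (induction rule: below.induct)
  case refl
  then show ?case using z by simp
next
  case (step y a k)
  have y: "y \<in> We" using bruhat_ext step(1) z(1) by blast
  have f: "aff a k \<in> affine_roots" using step(2) by (rule aff_affine_root)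
  have "0 \<le> aff a k 0" using affine_root_zero[OF f step(3)] .
  then have k: "0 \<le> k" by (simp add: aff_def)
  have "0 \<le> - (aff a k \<circ> y) 0"
    using affine_root_zero[OF affine_root_minus[OF affine_root_comp[OF f y]]] step(4) by simp
  then have le: "of_int k \<le> y 0 \<bullet> (- a)" by (simp add: aff_def)
  obtain j where j: "y 0 \<bullet> (- a) = of_int j"
    using coweight_root_int[OF ext_zero_coweight[OF y] root_uminus[OF step(2)]] Ints_cases by blast
  have "y 0 - of_int (j - k) *\<^sub>R coroot (- a) \<in> saturated_set R \<alpha> l"
    using step.IH root_uminus[OF step(2)] le k j by (intro saturated_string) auto
  moreover have "y 0 \<bullet> a = - of_int j" using j by simp
  then have "(reflection a k \<circ> y) 0 = y 0 - of_int (j - k) *\<^sub>R coroot (- a)"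
    by (simp add: reflection_def coroot_minus algebra_simps)
  ultimately show ?case by simp
qed

section \<open>Ends of folded walks lie in the saturated set\<close>

definition letter :: "nat \<Rightarrow> 'a \<times> int" where
  "letter i = (if i = 0 then (- \<theta>, 1) else (\<alpha> i, 0))"

lemma simple_reflection_letter: "simple_reflection \<alpha> \<theta> i = reflection (fst (letter i)) (snd (letter i))"
  by (simp add: simple_reflection_def letter_def)

lemma foldr_simple_reflection:
  "foldr (\<lambda>i v. simple_reflection \<alpha> \<theta> i \<circ> v) is g = word (map letter is) \<circ> g"
  by (induction "is") (auto simp: letter_def simple_reflection_letter comp_assoc)

lemma index_cases: "i \<in> {0..DIM('a)} \<Longrightarrow> i = 0 \<or> i \<in> I"
  by (auto simp: index_set)

lemma letter_wall: "i \<in> {0..DIM('a)} \<Longrightarrow> letter i = (a, k) \<Longrightarrow> wall a k"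
  using index_cases wall_theta wall_alpha by (auto simp: letter_def split: if_splits)

lemma walls_letters: "set is \<subseteq> {0..DIM('a)} \<Longrightarrow> walls (map letter is)"
  using letter_wall by (fastforce simp: walls_def)

lemma reduced_expressionD:
  assumes "reduced_expression R \<alpha> \<theta> \<omega> is g w"
  shows "set is \<subseteq> {0..DIM('a)}" "flat g" "w = word (map letter is) \<circ> g"
    "walls (map letter is)" "reduced_word (map letter is)" "w \<in> We"
proof -
  show s: "set is \<subseteq> {0..DIM('a)}" and g: "flat g" and w: "w = word (map letter is) \<circ> g"
    using assms length_zero_flat by (auto simp: reduced_expression_def foldr_simple_reflection)
  show l: "walls (map letter is)" by (rule walls_letters[OF s])
  show e: "w \<in> We" using w word_ext[OF l] flat_ext[OF g] ext_comp by simp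
  have "length is = len w"
    using assms weyl_length_eq_len[OF e] by (simp add: reduced_expression_def)
  then show "reduced_word (map letter is)"
    unfolding reduced_word_def w using inversions_comp_flat[OF word_ext[OF l] g] by simp
qed

text \<open>
  An alcove at the origin lies on the same side of the affine wall as the fundamental alcove, so
  the first letter of a reduced word for it is not the affine reflection.
\<close>

lemma finite_reduced_word:
  assumes "set is \<subseteq> {0..DIM('a)}" "reduced_word (map letter is)" "word (map letter is) \<in> W0"
  shows "set is \<subseteq> I"
  using assms
proof (induction "is")
  case (Cons i "is")
  obtain a k where a: "letter i = (a, k)" by fastforce
  let ?w = "word (map letter (i # is))"
  have w: "wall a k" using letter_wall[OF _ a] Cons.prems(1) by simp
  have "walls ((a, k) # map letter is)" "reduced_word ((a, k) # map letter is)"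
    using Cons.prems walls_letters[of "is"] w a by simp_all
  note red = reduced_word_Cons[OF this]
  have "i \<noteq> 0"
  proof
    assume "i = 0"
    then have ak: "a = - \<theta>" "k = 1" using a by (simp_all add: letter_def)
    have "aff a k (?w p0) < 0" using red(2) a by (simp add: wall_aff_reflection[OF w])
    then have "1 < p0 \<bullet> inv ?w \<theta>" using Cons.prems(3) by (simp add: ak aff_def weyl_adjoint)
    moreover have "inv ?w \<theta> \<in> R" using weyl_root weyl_inverse(2) Cons.prems(3) theta_root by blast
    ultimately show False
      using positive_or_negative[of "inv ?w \<theta>"] alcove_positive[OF p0_alcove, of "inv ?w \<theta>"]
        alcove_positive[OF p0_alcove, of "- inv ?w \<theta>"] by fastforce
  qed
  then have i: "i \<in> I" "a = \<alpha> i" "k = 0"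
    using Cons.prems(1) index_cases a by (auto simp: letter_def)
  have "word (map letter is) = reflection (\<alpha> i) 0 \<circ> ?w"
    using a i alpha_nonzero by (auto simp: fun_eq_iff)
  then have "word (map letter is) \<in> W0"
    using Cons.prems(3) weyl_comp weyl_reflection alpha_root i(1) by metis
  then show ?case using Cons.IH Cons.prems(1) red(1) i(1) by simp
qed simp

lemma subword_products_finite:
  assumes "set is \<subseteq> I" "x \<in> subword_products (map letter is)" shows "x \<in> W0"
  using assms
proof (induction "is" arbitrary: x)
  case (Cons i "is")
  have "i \<noteq> 0" using Cons.prems(1) by (auto simp: index_set)
  then show ?case
    using Cons by (auto simp: letter_def intro!: weyl_comp weyl_reflection alpha_root)
qed (simp add: weyl_id)

lemma folded_steps_subword:
  assumes "length p = Suc (length is)"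
    and "\<And>k. k < length is \<Longrightarrow> folded_step R \<alpha> \<theta> (is ! k) (p ! k) (p ! Suc k)"
  shows "\<exists>y\<in>subword_products (map letter is). last p = p ! 0 \<circ> y"
  using assms
proof (induction "is" arbitrary: p)
  case Nil
  then obtain x where "p = [x]" by (auto simp: length_Suc_conv)
  then show ?case by simp
next
  case (Cons i "is")
  then obtain x q where p: "p = x # q" "length q = Suc (length is)" by (auto simp: length_Suc_conv)
  have "folded_step R \<alpha> \<theta> (is ! k) (q ! k) (q ! Suc k)" if "k < length is" for k
    using Cons.prems(2)[of "Suc k"] that p by simp
  then obtain y where y: "y \<in> subword_products (map letter is)" "last q = q ! 0 \<circ> y"
    using Cons.IH p(2) by blast
  obtain a k where a: "letter i = (a, k)" by fastforce
  have "q ! 0 = x \<or> q ! 0 = x \<circ> reflection a k"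
    using Cons.prems(2)[of 0] p a by (auto simp: folded_step_def Let_def simple_reflection_letter)
  moreover have "last p = q ! 0 \<circ> y" using p y(2) by auto
  ultimately have "last p = x \<circ> y \<or> last p = x \<circ> (reflection a k \<circ> y)" by (auto simp: comp_assoc)
  moreover have "y \<in> subword_products (map letter (i # is))"
    "reflection a k \<circ> y \<in> subword_products (map letter (i # is))"
    using y(1) a by simp_all
  ultimately show ?case using p(1) by (metis nth_Cons_0)
qed

lemma folded_walk_end_saturated:
  assumes l: "l \<in> coweights \<omega>" "dominant l"
    and U: "reduced_expression R \<alpha> \<theta> \<omega> U id u" "u \<in> W0"
    and M: "reduced_expression R \<alpha> \<theta> \<omega> M g m" "m \<in> weyl_double_coset R l"
    and p: "folded_walk R \<alpha> \<theta> (U @ M) p" and e: "walk_end p g = (+) x \<circ> w" "w \<in> W0"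
  shows "x \<in> saturated_set R \<alpha> l"
proof -
  note U' = reduced_expressionD[OF U(1)] and M' = reduced_expressionD[OF M(1)]
  have "set U \<subseteq> I" using finite_reduced_word U' U(2) by simp
  obtain y where y: "y \<in> subword_products (map letter (U @ M))" "last p = p ! 0 \<circ> y"
    using folded_steps_subword[of p "U @ M"] p by (auto simp: folded_walk_def)
  then have "last p = y" using p by (simp add: folded_walk_def)
  obtain a b where ab: "a \<in> subword_products (map letter U)" "b \<in> subword_products (map letter M)"
    "y = a \<circ> b" using subword_products_append y(1) by (metis map_append)
  have a: "a \<in> W0" using subword_products_finite[OF \<open>set U \<subseteq> I\<close> ab(1)] .
  obtain v1 v2 where v: "v1 \<in> W0" "v2 \<in> W0" "m = v1 \<circ> (+) l \<circ> v2"
    using M(2) by (auto simp: weyl_double_coset_def)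
  then have "m 0 = v1 l" by (simp add: weyl_zero)
  then have "m 0 \<in> saturated_set R \<alpha> l" using saturated_weyl[OF highest_in_saturated[OF l] v(1)] by simp
  moreover have "bruhat (b \<circ> g) m" using subword_bruhat[OF M'(4,5,2) ab(2)] M'(3) by simp
  ultimately have "(b \<circ> g) 0 \<in> saturated_set R \<alpha> l" using bruhat_saturated M'(6) by blast
  then have "a ((b \<circ> g) 0) \<in> saturated_set R \<alpha> l" using saturated_weyl a by blast
  moreover have "walk_end p g 0 = x" using e weyl_zero by simp
  then have "x = a ((b \<circ> g) 0)" using \<open>last p = y\<close> ab(3) by (simp add: walk_end_def)
  ultimately show ?thesis by simp
qed

end

lemma uminus_fun_eq_iff: "(\<lambda>v. - f v) = g \<longleftrightarrow> f = (\<lambda>v. - (g v :: real))"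
proof
  assume eq: "(\<lambda>v. - f v) = g"
  have "f v = - g v" for v using fun_cong[OF eq, of v] by simp
  then show "f = (\<lambda>v. - g v)" by blast
qed simp

context root_datum
begin

section \<open>Sets of ends of folded walks\<close>

text \<open>
  All alcoves that one step can lead to from an alcove in \<open>Y\<close>. Crossing is always possible. The
  affine root \<open>aff a k \<circ> inv y\<close> vanishes on the hyperplane between \<open>y\<close> and its neighbour and is
  positive on the side of \<open>y\<close>; the predicate \<open>ok\<close> tells from it whether a fold at \<open>y\<close> is allowed.
\<close>

definition fold_step ::
  "(('a \<Rightarrow> real) \<Rightarrow> bool) \<Rightarrow> 'a \<Rightarrow> int \<Rightarrow> ('a \<Rightarrow> 'a) set \<Rightarrow> ('a \<Rightarrow> 'a) set" where
  "fold_step ok a k Y = (\<lambda>y. y \<circ> reflection a k) ` Y \<union> {y \<in> Y. ok (aff a k \<circ> inv y)}"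

definition walk_ends ::
  "(('a \<Rightarrow> real) \<Rightarrow> bool) \<Rightarrow> ('a \<times> int) list \<Rightarrow> ('a \<Rightarrow> 'a) set \<Rightarrow> ('a \<Rightarrow> 'a) set" where
  "walk_ends ok ws Y = fold (\<lambda>(a, k). fold_step ok a k) ws Y"

lemma walk_ends_simps [simp]:
  "walk_ends ok [] Y = Y"
  "walk_ends ok ((a, k) # ws) Y = walk_ends ok ws (fold_step ok a k Y)"
  by (simp_all add: walk_ends_def)

lemma walk_ends_append: "walk_ends ok (us @ vs) Y = walk_ends ok vs (walk_ends ok us Y)"
  by (simp add: walk_ends_def)

lemma fold_step_ext: "a \<in> R \<Longrightarrow> Y \<subseteq> We \<Longrightarrow> fold_step ok a k Y \<subseteq> We"
  using ext_comp ext_reflection by (auto simp: fold_step_def)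

lemma fold_step_mono: "Y \<subseteq> Z \<Longrightarrow> fold_step ok a k Y \<subseteq> fold_step ok a k Z"
  by (auto simp: fold_step_def)

lemma fold_step_Union: "fold_step ok a k (\<Union>y\<in>Y. F y) = (\<Union>y\<in>Y. fold_step ok a k (F y))"
  by (auto simp: fold_step_def)

lemma finite_fold_step: "finite Y \<Longrightarrow> finite (fold_step ok a k Y)"
  by (simp add: fold_step_def)

lemma walk_ends_ext: "walls ws \<Longrightarrow> Y \<subseteq> We \<Longrightarrow> walk_ends ok ws Y \<subseteq> We"
proof (induction ws arbitrary: Y)
  case (Cons p ws)
  obtain a k where p: "p = (a, k)" by (cases p)
  have "a \<in> R" "walls ws" using Cons.prems(1) p wall_root by auto
  then have "fold_step ok a k Y \<subseteq> We" using Cons.prems(2) fold_step_ext by blast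
  then show ?case using Cons.IH[OF \<open>walls ws\<close>] p by simp
qed simp

lemma walk_ends_mono: "Y \<subseteq> Z \<Longrightarrow> walk_ends ok ws Y \<subseteq> walk_ends ok ws Z"
  by (induction ws arbitrary: Y Z) (auto dest: fold_step_mono, blast dest: fold_step_mono)

lemma walk_ends_Union: "walk_ends ok ws (\<Union>y\<in>Y. F y) = (\<Union>y\<in>Y. walk_ends ok ws (F y))"
  by (induction ws arbitrary: F) (auto simp: fold_step_Union)

lemma walk_ends_singletons: "walk_ends ok ws Y = (\<Union>y\<in>Y. walk_ends ok ws {y})"
  using walk_ends_Union[of ok ws "\<lambda>y. {y}" Y] by simp

lemma unfolded_end: "y \<in> Y \<Longrightarrow> y \<circ> word ws \<in> walk_ends ok ws Y"
proof (induction ws arbitrary: y Y)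
  case (Cons p ws)
  obtain a k where p: "p = (a, k)" by (cases p)
  have "y \<circ> reflection a k \<in> fold_step ok a k Y" using Cons.prems by (simp add: fold_step_def)
  then have "(y \<circ> reflection a k) \<circ> word ws \<in> walk_ends ok ws (fold_step ok a k Y)" by (rule Cons.IH)
  then show ?case by (simp add: p comp_assoc del: comp_apply)
qed simp

lemma adjacent_side:
  assumes w: "wall a k" and y: "y \<in> We" and f: "f \<in> affine_roots"
    and ne: "f \<noteq> aff a k \<circ> inv y" "f \<noteq> (\<lambda>v. - (aff a k \<circ> inv y) v)"
  shows "0 < f (y (reflection a k p0)) \<longleftrightarrow> 0 < f (y p0)"
proof -
  have imp: "0 < g (y (reflection a k p0))"
    if g: "g \<in> affine_roots" "0 < g (y p0)" and "g \<noteq> aff a k \<circ> inv y" for g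
  proof (rule ccontr)
    assume "\<not> 0 < g (y (reflection a k p0))"
    then have "(g \<circ> y) (reflection a k p0) < 0"
      using affine_root_orbit[OF affine_root_comp[OF g(1) y] wall_ext[OF w]] by simp
    then have "g \<circ> y = aff a k" using wallD[OF w affine_root_comp[OF g(1) y]] g(2) by simp
    then have "g \<circ> (y \<circ> inv y) = aff a k \<circ> inv y" by (metis comp_assoc)
    then show False using that y by simp
  qed
  have "0 < f (y p0)" if pos: "0 < f (y (reflection a k p0))"
  proof (rule ccontr)
    assume "\<not> 0 < f (y p0)"
    then have "0 < - f (y p0)" using affine_root_orbit[OF f y] by linarith
    moreover have "(\<lambda>v. - f v) \<noteq> aff a k \<circ> inv y" using ne(2) unfolding uminus_fun_eq_iff .
    ultimately have "0 < - f (y (reflection a k p0))" using imp[OF affine_root_minus[OF f]] by simp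
    then show False using pos by simp
  qed
  then show ?thesis using imp f ne(1) by blast
qed

section \<open>Walks folded away from a base alcove\<close>

text \<open>
  A fold is allowed here if the base alcove \<open>b\<close> is on the other side of the hyperplane, so that
  folding avoids a step towards \<open>b\<close>.
\<close>

definition beyond :: "('a \<Rightarrow> 'a) \<Rightarrow> ('a \<Rightarrow> real) \<Rightarrow> bool" where
  "beyond b f \<longleftrightarrow> f (b p0) < 0"

text \<open>
  The counterpart of a step for multiplication from the left: the alcove is reflected in a wall of the
  base alcove, and it may also stay if the reflection takes it towards the base alcove.
\<close>

definition left_fold :: "'a \<Rightarrow> int \<Rightarrow> ('a \<Rightarrow> 'a) set \<Rightarrow> ('a \<Rightarrow> 'a) set" where
  "left_fold c j Y = (\<lambda>y. reflection c j \<circ> y) ` Y \<union> {y \<in> Y. aff c j (y p0) < 0}"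

lemma left_fold_Union: "left_fold c j (\<Union>y\<in>Y. F y) = (\<Union>y\<in>Y. left_fold c j (F y))"
  by (auto simp: left_fold_def)

lemma fold_step_single:
  "fold_step ok a k {y} = insert (y \<circ> reflection a k) (if ok (aff a k \<circ> inv y) then {y} else {})"
  by (auto simp: fold_step_def)

lemma fold_step_insert: "fold_step ok a k (insert y Y) = fold_step ok a k {y} \<union> fold_step ok a k Y"
  by (auto simp: fold_step_def)

lemma left_fold_single:
  "left_fold c j {y} = insert (reflection c j \<circ> y) (if aff c j (y p0) < 0 then {y} else {})"
  by (auto simp: left_fold_def)

lemma left_fold_insert: "left_fold c j (insert y Y) = left_fold c j {y} \<union> left_fold c j Y"
  by (auto simp: left_fold_def)

lemma wall_of_side:
  assumes w: "wall_of b c j" and b: "b \<in> We" and f: "f \<in> affine_roots"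
    and ne: "f \<noteq> aff c j" "f \<noteq> (\<lambda>v. - aff c j v)"
  shows "f (reflection c j (b p0)) < 0 \<longleftrightarrow> f (b p0) < 0"
proof -
  have c: "c \<in> R" using w by (simp add: wall_of_def)
  have tb: "reflection c j \<circ> b \<in> We" using ext_comp ext_reflection c b by blast
  have imp: "0 < g (reflection c j (b p0))"
    if "g \<in> affine_roots" "0 < g (b p0)" "g \<noteq> aff c j" for g
    using w that affine_root_orbit[OF that(1) tb] by (force simp: wall_of_def)
  have "(\<lambda>v. - f v) \<noteq> aff c j" using ne(2) unfolding uminus_fun_eq_iff .
  then show ?thesis
    using imp[OF f] imp[OF affine_root_minus[OF f]] ne(1)
      affine_root_orbit[OF f tb] affine_root_orbit[OF f b] by fastforce
qed

text \<open>
  Right steps compare an alcove with a neighbour, left steps with its mirror image in a wall of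
  the base alcove. Both decide about a fold by asking which side of a hyperplane the base alcove
  is on, and the answers of one kind are unaffected by steps of the other kind, unless both
  reflect the alcove in the same hyperplane; then both orders yield both alcoves.
\<close>

lemma left_fold_step_commute_single:
  assumes t: "wall_of b c j" and b: "b \<in> We" and w: "wall a k" and y: "y \<in> We"
  shows "left_fold c j (fold_step (beyond b) a k {y}) = fold_step (beyond b) a k (left_fold c j {y})"
proof -
  let ?t = "reflection c j" and ?r = "reflection a k" and ?F = "aff c j"
  define h where "h = aff a k \<circ> inv y"
  have c: "c \<in> R" and Fb: "0 < ?F (b p0)" using t by (simp_all add: wall_of_def)
  have a: "a \<in> R" using w by (rule wall_root)
  have h: "h \<in> affine_roots"
    unfolding h_def using affine_root_comp[OF aff_affine_root[OF a] ext_inverse(2)[OF y]] .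
  have hy: "h (y v) = aff a k v" for v using y by (simp add: h_def)
  have ht: "aff a k \<circ> inv (?t \<circ> y) = h \<circ> ?t"
    using y c by (simp add: h_def inv_comp_ext ext_reflection inv_reflection comp_assoc)
  have Ft: "?F (?t v) = - ?F v" for v using c by (simp add: aff_reflection root_nonzero)
  have hr: "h (y (?r p0)) = - h (y p0)" "0 < h (y p0)"
    using wall_aff_reflection[OF w] wall_pos[OF w] by (simp_all add: hy)
  have lhs: "left_fold c j (fold_step (beyond b) a k {y}) =
    {?t \<circ> (y \<circ> ?r)} \<union> (if h (b p0) < 0 then {?t \<circ> y} else {}) \<union>
    (if ?F (y (?r p0)) < 0 then {y \<circ> ?r} else {}) \<union> (if h (b p0) < 0 \<and> ?F (y p0) < 0 then {y} else {})"
    using left_fold_insert[of c j "y \<circ> ?r" "{y}"] Ft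
    by (simp add: left_fold_single fold_step_single beyond_def h_def) blast
  have rhs: "fold_step (beyond b) a k (left_fold c j {y}) =
    {(?t \<circ> y) \<circ> ?r} \<union> (if h (?t (b p0)) < 0 then {?t \<circ> y} else {}) \<union>
    (if ?F (y p0) < 0 then {y \<circ> ?r} else {}) \<union> (if h (b p0) < 0 \<and> ?F (y p0) < 0 then {y} else {})"
    using fold_step_insert[of "beyond b" a k "?t \<circ> y" "{y}"] ht
    by (simp add: left_fold_single fold_step_single beyond_def h_def del: comp_apply) (simp; blast)
  have tt: "?t \<circ> (?t \<circ> y) = y" using c by (auto simp: fun_eq_iff root_nonzero)
  consider "h = ?F" | "h = (\<lambda>v. - ?F v)" | "h \<noteq> ?F" "h \<noteq> (\<lambda>v. - ?F v)" by blast
  then show ?thesis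
  proof cases
    case 1
    then have yr: "y \<circ> ?r = ?t \<circ> y" by (intro comp_reflection[OF y a]) (simp add: h_def)
    have "?F (y (?r p0)) < 0" "\<not> ?F (y p0) < 0" "\<not> h (b p0) < 0" "h (?t (b p0)) < 0"
      using hr Fb 1 Ft by simp_all
    then show ?thesis unfolding lhs rhs by (auto simp: yr comp_assoc)
  next
    case 2
    then have "aff a k \<circ> inv y = aff (- c) (- j)" by (simp add: h_def aff_minus)
    from comp_reflection[OF y a this] have yr: "y \<circ> ?r = ?t \<circ> y" by (simp add: reflection_minus)
    have "\<not> ?F (y (?r p0)) < 0" "?F (y p0) < 0" "h (b p0) < 0" "\<not> h (?t (b p0)) < 0"
      using hr Fb 2 Ft by simp_all
    then show ?thesis unfolding lhs rhs by (auto simp: yr comp_assoc tt)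
  next
    case 3
    have F: "?F \<in> affine_roots" using c by (rule aff_affine_root)
    have "?F \<noteq> (\<lambda>v. - h v)" using 3(2) by (metis uminus_fun_eq_iff)
    then have "0 < ?F (y (?r p0)) \<longleftrightarrow> 0 < ?F (y p0)"
      using adjacent_side[OF w y F] 3(1) by (simp add: h_def)
    then have "?F (y (?r p0)) < 0 \<longleftrightarrow> ?F (y p0) < 0"
      using affine_root_orbit[OF F y] affine_root_orbit[OF F ext_comp[OF y wall_ext[OF w]]] by simp
    moreover have "h (?t (b p0)) < 0 \<longleftrightarrow> h (b p0) < 0" using wall_of_side[OF t b h 3] .
    ultimately show ?thesis unfolding lhs rhs by (simp add: comp_assoc)
  qed
qed

lemma left_fold_step_commute:
  assumes "wall_of b c j" "b \<in> We" "wall a k" "Y \<subseteq> We"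
  shows "left_fold c j (fold_step (beyond b) a k Y) = fold_step (beyond b) a k (left_fold c j Y)"
proof -
  have "left_fold c j (fold_step (beyond b) a k Y)
      = (\<Union>y\<in>Y. left_fold c j (fold_step (beyond b) a k {y}))"
    using fold_step_Union[of "beyond b" a k "\<lambda>y. {y}" Y] left_fold_Union by simp
  also have "\<dots> = (\<Union>y\<in>Y. fold_step (beyond b) a k (left_fold c j {y}))"
    using assms by (intro SUP_cong left_fold_step_commute_single) auto
  also have "\<dots> = fold_step (beyond b) a k (\<Union>y\<in>Y. left_fold c j {y})"
    by (rule fold_step_Union[symmetric])
  also have "\<dots> = fold_step (beyond b) a k (left_fold c j Y)"
    using left_fold_Union[of c j "\<lambda>y. {y}" Y] by simp
  finally show ?thesis .
qed

lemma left_fold_walk_ends: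
  assumes "wall_of b c j" "b \<in> We" "walls ws" "Y \<subseteq> We"
  shows "left_fold c j (walk_ends (beyond b) ws Y) = walk_ends (beyond b) ws (left_fold c j Y)"
  using assms(3,4)
proof (induction ws arbitrary: Y)
  case (Cons p ws)
  obtain a k where p: "p = (a, k)" by (cases p)
  have "a \<in> R" using Cons.prems p wall_root by auto
  then have "fold_step (beyond b) a k Y \<subseteq> We" using Cons.prems(2) by (rule fold_step_ext)
  then show ?case
    using Cons p left_fold_step_commute[OF assms(1,2), of a k Y] by simp
qed simp

text \<open>Along a reduced word from the base alcove all steps lead away from it.\<close>

lemma walk_ends_from_base:
  assumes g: "flat (inv b \<circ> x)" and b: "b \<in> We" and x: "x \<in> We"
    and ws: "walls ws" "reduced_word ws"
  shows "walk_ends (beyond b) ws {x} = {x \<circ> word ws}"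
  using ws
proof (induction ws rule: rev_induct)
  case (snoc p ws)
  obtain a k where p: "p = (a, k)" by (cases p)
  have w: "walls (ws @ [(a, k)])" "reduced_word (ws @ [(a, k)])" using snoc.prems p by simp_all
  note red = reduced_word_snoc[OF this]
  have e: "word ws \<in> We" "wall a k" using w word_ext by simp_all
  let ?f = "aff a k \<circ> inv (word ws)"
  have f: "?f \<in> affine_roots"
    using affine_root_comp[OF aff_affine_root[OF wall_root[OF e(2)]] ext_inverse(2)[OF e(1)]] .
  have "inv (inv b \<circ> x) = inv x \<circ> b" using b x by (simp add: inv_comp_ext ext_inverse inv_inv_ext)
  then have "flat (inv x \<circ> b)" using flat_inverse[OF g] by simp
  then have "0 < ?f (inv x (b p0))" using flatD(1)[of "inv x \<circ> b" ?f] f red(2) by simp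
  then have "\<not> beyond b (aff a k \<circ> inv (x \<circ> word ws))"
    using x e(1) by (simp add: beyond_def inv_comp_ext)
  then have "fold_step (beyond b) a k {x \<circ> word ws} = {x \<circ> word ws \<circ> reflection a k}"
    by (auto simp: fold_step_def)
  then show ?case
    using snoc.IH w(1) red(1) p by (simp add: walk_ends_append word_append comp_assoc del: comp_apply)
qed simp

text \<open>
  Every alcove arises from the base alcove by left steps that lead away from it and hence involve no
  choice. Since they commute with the steps of the walk, they can be postponed. What remains is a walk
  from the base alcove, and its only end is the product of the word.
\<close>

lemma walk_ends_beyond_word_independent:
  assumes b: "b \<in> We" and A: "walls A" "reduced_word A" and B: "walls B" "reduced_word B"
    and eq: "word A = word B" and x: "x \<in> We"
  shows "walk_ends (beyond b) A {x} = walk_ends (beyond b) B {x}"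
  using x
proof (induction "len (inv b \<circ> x)" arbitrary: x rule: less_induct)
  case less
  have bx: "inv b \<circ> x \<in> We" using b less.prems ext_comp ext_inverse by blast
  show ?case
  proof (cases "flat (inv b \<circ> x)")
    case True
    then show ?thesis
      using walk_ends_from_base[OF True b less.prems] A B eq by simp
  next
    case False
    then obtain a k where a: "simple_wall a k" "aff a k ((inv b \<circ> x) p0) < 0"
      using flat_or_descent[OF bx] by blast
    have w: "wall a k" using a(1) by (rule simple_wall_wall)
    obtain c j where c: "c \<in> R" "aff a k \<circ> inv b = aff c j"
      using affine_root_comp[OF aff_affine_root[OF wall_root[OF w]] ext_inverse(2)[OF b]]
        affine_root_cases by blast
    have t: "wall_of b c j" by (rule wall_of_image[OF w b c(2)])
    let ?x = "reflection c j \<circ> x"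
    have x': "?x \<in> We" using c(1) less.prems ext_comp ext_reflection by blast
    have "b \<circ> reflection a k = reflection c j \<circ> b" by (rule comp_reflection[OF b wall_root[OF w] c(2)])
    from fun_cong[OF this] have "inv b (reflection c j (b v)) = reflection a k v" for v
      using b by (metis comp_apply ext_inv_apply(1))
    from this[of "inv b _"] have move: "inv b \<circ> ?x = reflection a k \<circ> (inv b \<circ> x)"
      using b by (auto simp: fun_eq_iff)
    have "len (inv b \<circ> ?x) < len (inv b \<circ> x)"
      unfolding move by (rule len_wall_less[OF w bx a(2)])
    then have IH: "walk_ends (beyond b) A {?x} = walk_ends (beyond b) B {?x}"
      using x' by (rule less.hyps)
    have F: "aff c j (x p0) < 0" using a(2) fun_cong[OF c(2), of "x p0"] by simp
    have "left_fold c j {?x} = {x}"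
      using F c(1) by (auto simp: left_fold_def aff_reflection root_nonzero fun_eq_iff)
    then have *: "walk_ends (beyond b) ws {x} = left_fold c j (walk_ends (beyond b) ws {?x})"
      if "walls ws" for ws
      using left_fold_walk_ends[OF t b that, of "{?x}"] x' by simp
    show ?thesis using *[OF A(1)] *[OF B(1)] IH by simp
  qed
qed

section \<open>Positively folded walks\<close>

text \<open>
  The orientation of positive folds: an alcove is on the positive side of a hyperplane if and only if
  the affine root that is positive at the alcove has a positive root as its gradient.
\<close>

definition upward :: "('a \<Rightarrow> real) \<Rightarrow> bool" where
  "upward f \<longleftrightarrow> (\<exists>b k. positive b \<and> f = aff b k)"

lemma upward_aff [simp]: "upward (aff b k) \<longleftrightarrow> positive b"
  by (auto simp: upward_def aff_eq_iff)

text \<open>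
  A base alcove deep inside the antidominant chamber lies on the negative side of any given
  hyperplane.
\<close>

lemma eventually_beyond_upward:
  assumes f: "f \<in> affine_roots"
  shows "eventually (\<lambda>N. beyond ((+) (- (real N *\<^sub>R rho))) f = upward f) sequentially"
proof -
  obtain b k where b: "b \<in> R" "f = aff b k" using f by (rule affine_root_cases)
  obtain N0 where N0: "\<bar>p0 \<bullet> b + of_int k\<bar> < real N0" using reals_Archimedean2 by blast
  have "beyond ((+) (- (real N *\<^sub>R rho))) f = upward f" if N: "N0 \<le> N" for N
  proof (cases "positive b")
    case True
    then have "real N * 1 \<le> real N * (rho \<bullet> b)" using rho_positive by (intro mult_left_mono) auto
    then show ?thesis using N0 N True b by (simp add: beyond_def aff_def inner_diff_left)
  next
    case False
    then have "1 \<le> rho \<bullet> (- b)" using not_positive_iff[OF b(1)] rho_positive by blast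
    then have "real N * 1 \<le> real N * (- (rho \<bullet> b))" by (intro mult_left_mono) auto
    then show ?thesis using N0 N False b by (simp add: beyond_def aff_def inner_diff_left)
  qed
  then show ?thesis unfolding eventually_sequentially by blast
qed

lemma eventually_fold_step_beyond_upward:
  assumes a: "a \<in> R" and Y: "finite Y" "Y \<subseteq> We"
  shows "eventually (\<lambda>N. fold_step (beyond ((+) (- (real N *\<^sub>R rho)))) a k Y = fold_step upward a k Y)
    sequentially"
proof -
  have "eventually (\<lambda>N. \<forall>y\<in>Y. beyond ((+) (- (real N *\<^sub>R rho))) (aff a k \<circ> inv y)
      = upward (aff a k \<circ> inv y)) sequentially"
  proof (intro eventually_ball_finite[OF Y(1)] ballI eventually_beyond_upward)
    fix y assume "y \<in> Y"
    then show "aff a k \<circ> inv y \<in> affine_roots"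
      using affine_root_comp[OF aff_affine_root[OF a] ext_inverse(2)] Y(2) by blast
  qed
  then show ?thesis by (rule eventually_mono) (auto simp: fold_step_def)
qed

lemma eventually_walk_ends_beyond_upward:
  assumes "walls ws" "finite Y" "Y \<subseteq> We"
  shows "eventually (\<lambda>N. walk_ends (beyond ((+) (- (real N *\<^sub>R rho)))) ws Y = walk_ends upward ws Y)
    sequentially"
  using assms
proof (induction ws arbitrary: Y)
  case (Cons p ws)
  obtain a k where p: "p = (a, k)" by (cases p)
  have a: "a \<in> R" "walls ws" using Cons.prems p wall_root by auto
  have "eventually (\<lambda>N. walk_ends (beyond ((+) (- (real N *\<^sub>R rho)))) ws (fold_step upward a k Y)
      = walk_ends upward ws (fold_step upward a k Y)) sequentially"
    using Cons a by (intro Cons.IH finite_fold_step fold_step_ext)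
  with eventually_fold_step_beyond_upward[OF a(1) Cons.prems(2,3), of k]
  show ?case by eventually_elim (simp only: p walk_ends_simps)
qed simp

theorem walk_ends_upward_word_independent:
  assumes "walls A" "reduced_word A" "walls B" "reduced_word B" "word A = word B" "x \<in> We"
  shows "walk_ends upward A {x} = walk_ends upward B {x}"
proof -
  have x: "finite {x}" "{x} \<subseteq> We" using assms by simp_all
  have "eventually (\<lambda>N. walk_ends upward A {x} = walk_ends upward B {x}) sequentially"
    using eventually_walk_ends_beyond_upward[OF assms(1) x] eventually_walk_ends_beyond_upward[OF assms(3) x]
  proof eventually_elim
    case (elim N)
    have "- (real N *\<^sub>R rho) \<in> coweights \<omega>"
      using coweights_minus[OF coweights_scale[OF rho_coweight, of "int N"]] by simp
    then have "(+) (- (real N *\<^sub>R rho)) \<in> We" by (rule translation_ext)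
    from walk_ends_beyond_word_independent[OF this assms] elim show ?case by metis
  qed
  then show ?thesis by simp
qed

section \<open>Strings in the direction of a simple root\<close>

definition level :: "nat \<Rightarrow> ('a \<Rightarrow> 'a) \<Rightarrow> int" where
  "level i x = \<lfloor>x p0 \<bullet> \<alpha> i\<rfloor>"

definition shift :: "nat \<Rightarrow> int \<Rightarrow> ('a \<Rightarrow> 'a) \<Rightarrow> 'a \<Rightarrow> 'a" where
  "shift i j x = (+) (- (of_int j *\<^sub>R coroot (\<alpha> i))) \<circ> x"

definition flip :: "nat \<Rightarrow> int \<Rightarrow> ('a \<Rightarrow> 'a) \<Rightarrow> 'a \<Rightarrow> 'a" where
  "flip i q x = reflection (\<alpha> i) (- q) \<circ> x"

text \<open>
  The translates of \<open>x\<close> by \<open>0, \<dots>, J\<close> coroots downwards belong to \<open>G\<close>, and so does one more alcove,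
  the mirror image of the lowest translate in the hyperplane immediately below it. The value
  \<open>J = -1\<close> describes the alcove \<open>x\<close> at the lower end of a string: then only the mirror image of \<open>x\<close> in
  the hyperplane immediately above it is required. The lowest alcove has level
  \<open>level i x - 2 J - 1\<close>. The mirror image of \<open>x\<close> in the hyperplane through the origin has level
  \<open>- level i x - 1\<close>, so the condition \<open>level i x \<le> J\<close> makes the string reach at least that far down.
\<close>

definition has_string :: "nat \<Rightarrow> ('a \<Rightarrow> 'a) set \<Rightarrow> ('a \<Rightarrow> 'a) \<Rightarrow> bool" where
  "has_string i G x \<longleftrightarrow> (\<exists>J\<ge>-1. level i x \<le> J \<and> (\<forall>j\<in>{0..J}. shift i j x \<in> G) \<and>
     flip i (level i x - J) x \<in> G)"

lemma flip_flip: "i \<in> I \<Longrightarrow> flip i p (flip i q x) = shift i (q - p) x"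
proof -
  assume i: "i \<in> I"
  let ?c = "coroot (\<alpha> i)"
  have "?c \<bullet> \<alpha> i = 2" using inner_coroot_self[OF alpha_nonzero[OF i]] by (simp add: inner_commute)
  then show ?thesis
    by (auto simp: flip_def shift_def reflection_def fun_eq_iff inner_diff_left algebra_simps
        scaleR_2 simp flip: scaleR_add_left scaleR_diff_left mult_2)
qed

lemma shift_flip: "i \<in> I \<Longrightarrow> shift i j (flip i q x) = flip i (q - j) x"
  by (auto simp: flip_def shift_def reflection_def fun_eq_iff algebra_simps)

lemma shift_zero: "shift i 0 x = x"
  by (auto simp: shift_def)

lemma shift_comp: "shift i j (x \<circ> r) = shift i j x \<circ> r"
  and flip_comp: "flip i q (x \<circ> r) = flip i q x \<circ> r"
  by (simp_all add: shift_def flip_def comp_assoc)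

lemma level_ge_iff:
  assumes i: "i \<in> I" and x: "x \<in> We"
  shows "q \<le> level i x \<longleftrightarrow> 0 < aff (\<alpha> i) (- q) (x p0)"
  using affine_root_orbit(1)[OF aff_affine_root[OF alpha_root[OF i]] x, of "- q"]
  by (auto simp: level_def le_floor_iff aff_def)

lemma upward_shift:
  assumes i: "i \<in> I" and x: "x \<in> We" and c: "c \<in> R" and h: "aff a k \<circ> inv x = aff c l"
  shows "upward (aff a k \<circ> inv (shift i j x)) \<longleftrightarrow> positive c"
proof -
  let ?m = "of_int j *\<^sub>R coroot (\<alpha> i)"
  have m: "?m \<in> coweights \<omega>" "- ?m \<in> coweights \<omega>"
    using coweights_scale coroot_coweight alpha_root i coweights_minus by blast+
  have "inv ((+) (- ?m)) = (+) ?m" by (rule inv_unique_comp) auto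
  then have eq: "aff a k \<circ> inv (shift i j x) = aff c l \<circ> (+) ?m"
    unfolding shift_def using inv_comp_ext[OF translation_ext[OF m(2)] x] h by (metis comp_assoc)
  obtain p where "?m \<bullet> c = of_int p" using coweight_root_int[OF m(1) c] Ints_cases by blast
  then have "aff c l \<circ> (+) ?m = aff c (l + p)" by (auto simp: aff_def fun_eq_iff inner_add_left)
  then show ?thesis using eq by simp
qed

lemma upward_flip:
  assumes i: "i \<in> I" and x: "x \<in> We" and c: "c \<in> R" and h: "aff a k \<circ> inv x = aff c l"
  shows "upward (aff a k \<circ> inv (flip i q x)) \<longleftrightarrow> positive (reflection (\<alpha> i) 0 c)"
proof -
  let ?t = "reflection (\<alpha> i) (- q)" and ?s = "reflection (\<alpha> i) 0"
  have "inv (?t \<circ> x) = inv x \<circ> ?t"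
    using inv_comp_ext[OF ext_reflection[OF alpha_root[OF i]] x] inv_reflection[OF alpha_root[OF i]] by simp
  then have eq: "aff a k \<circ> inv (flip i q x) = aff c l \<circ> ?t"
    unfolding flip_def using h by (metis comp_assoc)
  have t: "?t v = of_int q *\<^sub>R coroot (\<alpha> i) + ?s v" for v by (simp add: reflection_def algebra_simps)
  obtain j where "aff c l \<circ> ?t = aff (inv ?s c) j"
    using aff_ext[OF coweights_scale[OF coroot_coweight[OF alpha_root[OF i]]]
        weyl_reflection[OF alpha_root[OF i]] t c] by blast
  then show ?thesis using eq inv_reflection[OF alpha_root[OF i], of 0] by simp
qed

text \<open>
  The reflections and translations in the direction of the simple root \<open>\<alpha> i\<close> preserve the
  orientation of all hyperplanes except those of \<open>\<alpha> i\<close>, so a step across a hyperplane of another root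
  can be imitated along the whole string. At a hyperplane of \<open>\<alpha> i\<close> all translates of \<open>x\<close> do the
  same, while mirror images do the opposite: one crosses upwards when the other may cross downwards or
  fold. Below the new alcove the string is longer by one alcove if \<open>x\<close> crosses upwards and shorter by
  one if \<open>x\<close> crosses downwards, apart from the lower end of a string.
\<close>

lemma has_string_step:
  assumes i: "i \<in> I" and w: "wall a k" and G: "G \<subseteq> We" and str: "\<And>x. x \<in> G \<Longrightarrow> has_string i G x"
    and y: "y \<in> fold_step upward a k G"
  shows "has_string i (fold_step upward a k G) y"
proof -
  let ?G = "fold_step upward a k G" and ?r = "reflection a k" and ?al = "\<alpha> i"
  obtain x where x: "x \<in> G" and yx: "y = x \<circ> ?r \<or> y = x \<and> upward (aff a k \<circ> inv x)"
    using y by (auto simp: fold_step_def)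
  have ext: "x \<in> We" "x \<circ> ?r \<in> We" using x G ext_comp wall_ext[OF w] by blast+
  define h where "h = aff a k \<circ> inv x"
  have h: "h \<in> affine_roots"
    unfolding h_def using affine_root_comp[OF aff_affine_root[OF wall_root[OF w]] ext_inverse(2)[OF ext(1)]] .
  then obtain c l where c: "c \<in> R" "h = aff c l" by (rule affine_root_cases)
  have hx: "0 < h (x p0)" "h ((x \<circ> ?r) p0) < 0"
    using ext(1) wall_pos[OF w] wall_aff_reflection[OF w] by (simp_all add: h_def)
  have cross: "z \<circ> ?r \<in> ?G" if "z \<in> G" for z using that by (simp add: fold_step_def)
  have fold: "z \<in> ?G" if "z \<in> G" "upward (aff a k \<circ> inv z)" for z
    using that by (simp add: fold_step_def)
  have F: "aff ?al (- q) \<in> affine_roots" for q by (rule aff_affine_root[OF alpha_root[OF i]])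
  have side: "q \<le> level i (x \<circ> ?r) \<longleftrightarrow> q \<le> level i x"
    if "aff ?al (- q) \<noteq> h" "aff ?al (- q) \<noteq> (\<lambda>v. - h v)" for q
    using adjacent_side[OF w ext(1) F] that level_ge_iff[OF i ext(1)] level_ge_iff[OF i ext(2)]
    by (simp add: h_def)
  have up_shift: "upward (aff a k \<circ> inv (shift i j x)) \<longleftrightarrow> positive c" for j
    using upward_shift[OF i ext(1) c(1), of a k l j] c(2) h_def by simp
  have up_x: "upward (aff a k \<circ> inv x) \<longleftrightarrow> positive c" using c(2) h_def by simp
  have up_flip: "upward (aff a k \<circ> inv (flip i q x)) \<longleftrightarrow> positive (reflection ?al 0 c)" for q
    using upward_flip[OF i ext(1) c(1), of a k l q] c(2) h_def by simp
  define p where "p = level i x"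
  obtain J where J: "- 1 \<le> J" "p \<le> J" "\<And>j. 0 \<le> j \<Longrightarrow> j \<le> J \<Longrightarrow> shift i j x \<in> G"
    "flip i (p - J) x \<in> G"
    using str[OF x] by (auto simp: has_string_def p_def)
  have al: "positive ?al" "\<not> positive (- ?al)"
    using alpha_positive[OF i] not_positive_both by blast+
  consider (other) "c \<noteq> ?al" "c \<noteq> - ?al" | (up) "c = - ?al" | (down) "c = ?al" by blast
  then show ?thesis
  proof cases
    \<comment> \<open>The hyperplane is not parallel to those of \<open>\<alpha> i\<close>, so the whole string makes the same step.\<close>
    case other
    have "aff ?al (- q) \<noteq> h" "aff ?al (- q) \<noteq> (\<lambda>v. - h v)" for q
      using other c(2) by (auto simp: aff_eq_iff aff_minus[symmetric])
    then have lev: "level i (x \<circ> ?r) = p"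
      unfolding p_def using side by (meson antisym order.refl)
    from yx show ?thesis
    proof
      assume y: "y = x \<circ> ?r"
      show ?thesis
        unfolding has_string_def y lev using J cross by (intro exI[of _ J]) (auto simp: shift_comp flip_comp)
    next
      assume y: "y = x \<and> upward (aff a k \<circ> inv x)"
      then have "positive c" using up_x by simp
      then have "positive (reflection ?al 0 c)" using simple_reflection_positive_iff c(1) other i by blast
      then show ?thesis
        unfolding has_string_def using J fold up_shift up_flip y \<open>positive c\<close>
        by (intro exI[of _ J]) (auto simp: p_def)
    qed
  next
    \<comment> \<open>The alcove \<open>x\<close> crosses upwards. The mirror image at the lower end of its string may fold and thereby becomes another translate of \<open>y\<close>.\<close>
    case up
    define q where "q = l"
    have hq: "h = (\<lambda>v. - aff ?al (- q) v)" using c(2) up aff_minus[of ?al "- q"] by (simp add: q_def)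
    have "\<not> q \<le> p" "q \<le> level i (x \<circ> ?r)"
      using hx level_ge_iff[OF i ext(1), of q] level_ge_iff[OF i ext(2), of q] by (simp_all add: hq p_def)
    moreover have ne: "aff ?al (- m) \<noteq> h" "aff ?al (- m) \<noteq> (\<lambda>v. - h v)" if "m \<noteq> q" for m
    proof -
      show "aff ?al (- m) \<noteq> h" using c(2) up al by (auto simp: aff_eq_iff)
      show "aff ?al (- m) \<noteq> (\<lambda>v. - h v)" using that by (simp add: hq aff_eq_iff)
    qed
    then have "q - 1 \<le> level i (x \<circ> ?r) \<longleftrightarrow> q - 1 \<le> p" "q + 1 \<le> level i (x \<circ> ?r) \<longleftrightarrow> q + 1 \<le> p"
      using side[OF ne(1)[of "q - 1"] ne(2)[of "q - 1"]] side[OF ne(1)[of "q + 1"] ne(2)[of "q + 1"]]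
      by (simp_all add: p_def)
    ultimately have p: "p = q - 1" and lev: "level i (x \<circ> ?r) = q" by linarith+
    have "aff a k \<circ> inv x = aff (- ?al) (- (- q))" using c(2) up by (simp add: h_def q_def)
    from comp_reflection[OF ext(1) wall_root[OF w] this]
    have xr: "x \<circ> ?r = flip i q x" using reflection_minus[of ?al "- q"] by (simp add: flip_def)
    have y: "y = x \<circ> ?r" using yx up_x up al by simp
    have upf: "upward (aff a k \<circ> inv (flip i m x))" for m
    proof -
      have "reflection ?al 0 (- ?al) = ?al"
        using reflection_self[OF alpha_nonzero[OF i]] linear_neg[OF linear_reflection, of ?al ?al] by simp
      then show ?thesis using up_flip up al by simp
    qed
    \<comment> \<open>The first translate that is not the crossing of a translate of \<open>x\<close>.\<close>
    have low: "shift i (J + 1) y = flip i (p - J) x"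
      unfolding y xr shift_flip[OF i] by (simp add: p algebra_simps)
    have "shift i j y \<in> ?G" if "0 \<le> j" "j \<le> J + 1" for j
    proof (cases "j = J + 1")
      case True
      then show ?thesis using low fold[OF J(4) upf] by simp
    next
      case False
      then show ?thesis using that J(3) cross unfolding y shift_comp by simp
    qed
    moreover have "flip i (q - (J + 1)) y \<in> ?G"
      using cross[OF J(4)] unfolding y flip_comp by (simp add: p algebra_simps)
    ultimately show ?thesis
      unfolding has_string_def using lev y J p by (intro exI[of _ "J + 1"]) auto
  next
    \<comment> \<open>The alcove \<open>x\<close> crosses downwards or folds, and so do its translates, while the mirror image at the lower end has to cross upwards.\<close>
    case down
    define q where "q = - l"
    have hq: "h = aff ?al (- q)" using c(2) down by (simp add: q_def)
    have "q \<le> p" "\<not> q \<le> level i (x \<circ> ?r)"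
      using hx level_ge_iff[OF i ext(1), of q] level_ge_iff[OF i ext(2), of q] by (simp_all add: hq p_def)
    moreover have ne: "aff ?al (- m) \<noteq> h" "aff ?al (- m) \<noteq> (\<lambda>v. - h v)" if "m \<noteq> q" for m
    proof -
      show "aff ?al (- m) \<noteq> h" using that by (simp add: hq aff_eq_iff)
      show "aff ?al (- m) \<noteq> (\<lambda>v. - h v)"
        using al by (auto simp: hq aff_eq_iff simp flip: aff_minus)
    qed
    then have "q - 1 \<le> level i (x \<circ> ?r) \<longleftrightarrow> q - 1 \<le> p" "q + 1 \<le> level i (x \<circ> ?r) \<longleftrightarrow> q + 1 \<le> p"
      using side[OF ne(1)[of "q - 1"] ne(2)[of "q - 1"]] side[OF ne(1)[of "q + 1"] ne(2)[of "q + 1"]]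
      by (simp_all add: p_def)
    ultimately have p: "p = q" and lev: "level i (x \<circ> ?r) = q - 1" by linarith+
    have "aff a k \<circ> inv x = aff ?al (- q)" using hq by (simp add: h_def)
    from comp_reflection[OF ext(1) wall_root[OF w] this]
    have xr: "x \<circ> ?r = flip i q x" by (simp add: flip_def)
    have upx: "x \<in> ?G" using fold x up_x down al by simp
    have ups: "shift i j x \<in> ?G" if "0 \<le> j" "j \<le> J" for j
      using fold J(3)[OF that] up_shift down al by simp
    from yx show ?thesis
    proof
      assume y: "y = x \<circ> ?r"
      show ?thesis
      proof (cases "0 \<le> J")
        case True
        have "shift i j y \<in> ?G" if "0 \<le> j" "j \<le> J - 1" for j
          using that J(3) cross unfolding y shift_comp by simp
        moreover have "flip i (q - 1 - (J - 1)) y \<in> ?G"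
          using cross[OF J(4)] unfolding y flip_comp by (simp add: p)
        ultimately show ?thesis
          unfolding has_string_def using lev y J(2) p True by (intro exI[of _ "J - 1"]) auto
      next
        case False
        then have "J = - 1" using J(1) by simp
        moreover have "flip i q y = x" unfolding y xr flip_flip[OF i] by (simp add: shift_zero)
        ultimately show ?thesis
          unfolding has_string_def using lev y J(2) p upx by (intro exI[of _ "- 1"]) auto
      qed
    next
      assume "y = x \<and> upward (aff a k \<circ> inv x)"
      then have y: "y = x" by simp
      show ?thesis
      proof (cases "0 \<le> J")
        case True
        have "shift i J x \<circ> ?r = flip i (q - J) x"
          unfolding shift_comp[symmetric] xr by (rule shift_flip[OF i])
        then have "flip i (q - J) x \<in> ?G" using cross[OF J(3)[of J]] True by simp
        then show ?thesis
          unfolding has_string_def using y J p ups by (intro exI[of _ J]) (auto simp: p_def)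
      next
        case False
        then have "J = - 1" using J(1) by simp
        moreover have "flip i q x \<in> ?G" using cross[OF x] xr by simp
        ultimately show ?thesis
          unfolding has_string_def using y J(2) p upx
          by (intro exI[of _ 0]) (auto simp: p_def shift_zero)
      qed
    qed
  qed
qed

lemma has_string_weyl:
  assumes i: "i \<in> I" and x: "x \<in> W0"
  shows "has_string i W0 x"
proof -
  have fl: "flip i 0 x \<in> W0"
    unfolding flip_def using weyl_comp weyl_reflection alpha_root i x by simp
  have b: "inv x (\<alpha> i) \<in> R" using weyl_root weyl_inverse(2) x alpha_root i by blast
  have lev: "level i x = \<lfloor>p0 \<bullet> inv x (\<alpha> i)\<rfloor>" using x by (simp add: level_def weyl_adjoint)
  show ?thesis
  proof (cases "positive (inv x (\<alpha> i))")
    case True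
    then have "level i x = 0"
      using alcove_positive[OF p0_alcove True] lev by (simp add: floor_eq_iff)
    then show ?thesis
      unfolding has_string_def using fl x by (intro exI[of _ 0]) (auto simp: shift_zero)
  next
    case False
    then have "positive (- inv x (\<alpha> i))" using not_positive_iff[OF b] by simp
    from alcove_positive[OF p0_alcove this] have "level i x = - 1"
      using lev by (simp add: floor_eq_iff)
    then show ?thesis
      unfolding has_string_def using fl by (intro exI[of _ "- 1"]) auto
  qed
qed

lemma walk_ends_has_string:
  assumes i: "i \<in> I" and "walls ws" "x \<in> walk_ends upward ws W0"
  shows "has_string i (walk_ends upward ws W0) x"
proof -
  have "has_string i (walk_ends upward ws G) x"
    if "walls ws" "G \<subseteq> We" "\<And>x. x \<in> G \<Longrightarrow> has_string i G x" "x \<in> walk_ends upward ws G" for G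
    using that
  proof (induction ws arbitrary: G)
    case (Cons p ws)
    obtain a k where p: "p = (a, k)" by (cases p)
    have w: "wall a k" "walls ws" using Cons.prems(1) p by simp_all
    have "has_string i (fold_step upward a k G) z" if "z \<in> fold_step upward a k G" for z
      by (rule has_string_step[OF i w(1) Cons.prems(2,3) that])
    then show ?case
      using Cons.IH[OF w(2) fold_step_ext[OF wall_root[OF w(1)] Cons.prems(2)]] Cons.prems(4)
      unfolding p walk_ends_simps by blast
  qed simp
  then show ?thesis using assms has_string_weyl[OF i] weyl_ext by blast
qed

end

context root_datum
begin

section \<open>Vertices reached by walks from the alcoves at the origin\<close>

lemma vertex_level:
  assumes i: "i \<in> I" and x: "x \<in> We" and g: "flat g"
  obtains h where "x (g 0) \<bullet> \<alpha> i = of_int h" "level i x \<le> h" "h \<le> level i x + 1"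
proof -
  have xg: "x \<circ> g \<in> We" using x g flat_ext ext_comp by blast
  then have "x (g 0) \<in> coweights \<omega>" using ext_zero_coweight[OF xg] by simp
  then obtain h where h: "x (g 0) \<bullet> \<alpha> i = of_int h"
    using coweight_root_int[OF _ alpha_root[OF i]] Ints_cases by blast
  have F: "aff (\<alpha> i) (- q) \<in> affine_roots" for q by (rule aff_affine_root[OF alpha_root[OF i]])
  have same: "0 < aff (\<alpha> i) (- q) (x (g p0)) \<longleftrightarrow> q \<le> level i x" for q
    using flatD(1)[OF g affine_root_comp[OF F x], of q] level_ge_iff[OF i x, of q] by simp
  have "0 \<le> aff (\<alpha> i) (- level i x) (x (g 0))"
    using affine_root_zero[OF affine_root_comp[OF F xg], of "level i x"] same by simp
  then have "level i x \<le> h" by (simp add: aff_def h)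
  moreover have "aff (\<alpha> i) (- (level i x + 1)) (x (g p0)) < 0"
    using same[of "level i x + 1"] affine_root_orbit[OF F xg, of "level i x + 1"] by simp
  then have "0 \<le> - aff (\<alpha> i) (- (level i x + 1)) (x (g 0))"
    using affine_root_zero[OF affine_root_minus[OF affine_root_comp[OF F xg]], of "level i x + 1"] by simp
  then have "of_int h \<le> (of_int (level i x + 1) :: real)" by (simp add: aff_def h)
  then have "h \<le> level i x + 1" by (simp only: of_int_le_iff)
  ultimately show ?thesis using h that by blast
qed

text \<open>
  The coweight reached by \<open>x\<close> has height \<open>level i x\<close> or \<open>level i x + 1\<close>. The translates in the
  string supply all values of \<open>j\<close> except possibly \<open>j = level i x + 1\<close>; that value is needed only if
  the coweight is the upper vertex, and then it comes from the mirror image at the end of the string.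
\<close>

lemma vertex_string:
  assumes i: "i \<in> I" and ws: "walls ws" and g: "flat g"
    and x: "x \<in> walk_ends upward ws W0" and G: "walk_ends upward ws W0 \<subseteq> We"
    and j: "0 \<le> j" "of_int j \<le> x (g 0) \<bullet> \<alpha> i"
  shows "\<exists>y\<in>walk_ends upward ws W0. y (g 0) = x (g 0) - of_int j *\<^sub>R coroot (\<alpha> i)"
proof -
  obtain J where J: "- 1 \<le> J" "level i x \<le> J" "\<And>j. 0 \<le> j \<Longrightarrow> j \<le> J \<Longrightarrow> shift i j x \<in> walk_ends upward ws W0"
    "flip i (level i x - J) x \<in> walk_ends upward ws W0"
    using walk_ends_has_string[OF i ws x] by (auto simp: has_string_def)
  have "x \<in> We" using x G by blast
  then obtain h where h: "x (g 0) \<bullet> \<alpha> i = of_int h" "level i x \<le> h" "h \<le> level i x + 1"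
    using vertex_level[OF i _ g] by blast
  have jh: "j \<le> h" using j(2) h(1) by simp
  show ?thesis
  proof (cases "j \<le> J")
    case True
    then show ?thesis using J(3)[OF j(1)] by (intro bexI[of _ "shift i j x"]) (auto simp: shift_def)
  next
    case False
    then have eq: "level i x - J = 0" "j = h" using J(2) h(3) jh by linarith+
    then have "flip i 0 x \<in> walk_ends upward ws W0" using J(4) by simp
    moreover have "flip i 0 x (g 0) = x (g 0) - of_int j *\<^sub>R coroot (\<alpha> i)"
      using h(1) eq(2) by (simp add: flip_def reflection_def)
    ultimately show ?thesis by blast
  qed
qed

text \<open>
  The sum of the coefficients at the simple coroots.
\<close>

definition coroot_height :: "'a \<Rightarrow> real" where
  "coroot_height d = (\<Sum>i\<in>I. (\<omega> i \<bullet> d) * (\<alpha> i \<bullet> \<alpha> i) / 2)"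

lemma coroot_height_diff: "coroot_height (d - e) = coroot_height d - coroot_height e"
  by (simp add: coroot_height_def inner_diff_right left_diff_distrib diff_divide_distrib sum_subtractf)

lemma coroot_height_scale: "coroot_height (c *\<^sub>R d) = c * coroot_height d"
  by (simp add: coroot_height_def sum_distrib_left mult.assoc)

lemma coroot_height_alpha: assumes "i \<in> I" shows "coroot_height (coroot (\<alpha> i)) = 1"
proof -
  have "coroot_height (coroot (\<alpha> i)) = (\<Sum>k\<in>I. if k = i then 1 else 0)"
    unfolding coroot_height_def using assms alpha_nonzero
    by (intro sum.cong) (auto simp: coroot_def omega_alpha)
  then show ?thesis using assms finite_I by simp
qed

lemma coroot_height_int: "d \<in> coroot_lattice \<Longrightarrow> coroot_height d \<in> \<int>"
  unfolding coroot_height_def by (intro Ints_sum) (simp add: coroot_lattice_def)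

lemma coroot_height_nonneg: "d \<in> pos_coroot_cone \<alpha> \<Longrightarrow> 0 \<le> coroot_height d"
  unfolding coroot_height_def by (intro sum_nonneg) (auto simp: pos_coroot_cone_iff)

lemma coroot_height_less:
  assumes "d \<in> coroot_lattice" "e \<in> coroot_lattice" "coroot_height e < coroot_height d"
    "0 \<le> coroot_height e"
  shows "nat \<lfloor>coroot_height e\<rfloor> < nat \<lfloor>coroot_height d\<rfloor>"
proof -
  obtain p q where "coroot_height d = of_int p" "coroot_height e = of_int q"
    using coroot_height_int assms(1,2) Ints_cases by metis
  then show ?thesis using assms(3,4) by simp
qed

text \<open>
  From an element of the set above a dominant \<open>x\<close> one can descend towards \<open>x\<close>: the difference has
  a positive inner product with itself, hence with a simple root in its support.
\<close>

lemma descend_to_dominant: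
  assumes X: "X \<subseteq> coweights \<omega>"
    and lower: "\<And>v i. v \<in> X \<Longrightarrow> i \<in> I \<Longrightarrow> 1 \<le> v \<bullet> \<alpha> i \<Longrightarrow> v - coroot (\<alpha> i) \<in> X"
    and x: "dominant x" and v: "v \<in> X" "v - x \<in> pos_coroot_cone \<alpha>"
  shows "x \<in> X"
  using v
proof (induction "nat \<lfloor>coroot_height (v - x)\<rfloor>" arbitrary: v rule: less_induct)
  case less
  let ?d = "v - x"
  show ?case
  proof (cases "?d = 0")
    case True
    then show ?thesis using less.prems by simp
  next
    case False
    have d: "?d \<in> coroot_lattice" "\<And>i. i \<in> I \<Longrightarrow> 0 \<le> \<omega> i \<bullet> ?d"
      using less.prems(2) by (auto simp: pos_coroot_cone_iff)
    have "0 < ?d \<bullet> ?d" using False by simp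
    then have "0 < (\<Sum>i\<in>I. (?d \<bullet> \<alpha> i) * (\<omega> i \<bullet> ?d))" by (simp only: inner_expansion[symmetric])
    then have "\<not> (\<forall>i\<in>I. (?d \<bullet> \<alpha> i) * (\<omega> i \<bullet> ?d) \<le> 0)"
      using sum_nonpos[of I "\<lambda>i. (?d \<bullet> \<alpha> i) * (\<omega> i \<bullet> ?d)"] by force
    then obtain i where i: "i \<in> I" "0 < (?d \<bullet> \<alpha> i) * (\<omega> i \<bullet> ?d)" by force
    then have di: "0 < ?d \<bullet> \<alpha> i" "0 < \<omega> i \<bullet> ?d" using d(2)[OF i(1)] by (auto simp: zero_less_mult_iff)
    have "0 \<le> x \<bullet> \<alpha> i" using x i(1) by (simp add: dominant_def)
    then have "0 < v \<bullet> \<alpha> i" using di(1) by (simp add: inner_diff_left)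
    moreover have "v \<bullet> \<alpha> i \<in> \<int>" using X less.prems(1) i(1) coweights_iff by blast
    ultimately have "1 \<le> v \<bullet> \<alpha> i" by (auto elim!: Ints_cases)
    then have v': "v - coroot (\<alpha> i) \<in> X" using lower less.prems(1) i(1) by blast
    have eq: "v - coroot (\<alpha> i) - x = ?d - coroot (\<alpha> i)" by simp
    have aa: "0 < \<alpha> i \<bullet> \<alpha> i" using alpha_nonzero[OF i(1)] by simp
    have lat: "?d - coroot (\<alpha> i) \<in> coroot_lattice"
      using coroot_lattice_add[OF d(1) coroot_lattice_minus[OF coroot_alpha_in_lattice[OF i(1)]]] by simp
    have "(\<omega> i \<bullet> ?d) * (\<alpha> i \<bullet> \<alpha> i) / 2 \<in> \<int>" using d(1) i(1) by (simp add: coroot_lattice_def)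
    moreover have "0 < (\<omega> i \<bullet> ?d) * (\<alpha> i \<bullet> \<alpha> i) / 2" using di(2) aa by simp
    ultimately have "1 \<le> (\<omega> i \<bullet> ?d) * (\<alpha> i \<bullet> \<alpha> i) / 2" by (auto elim!: Ints_cases)
    then have "2 / (\<alpha> i \<bullet> \<alpha> i) \<le> \<omega> i \<bullet> ?d" using aa by (simp add: field_simps)
    then have "0 \<le> \<omega> k \<bullet> (?d - coroot (\<alpha> i))" if "k \<in> I" for k
      using d(2)[OF that] that i(1) by (cases "k = i") (simp_all add: inner_diff_right coroot_def omega_alpha)
    then have cone: "?d - coroot (\<alpha> i) \<in> pos_coroot_cone \<alpha>" using lat by (simp add: pos_coroot_cone_iff)
    have "nat \<lfloor>coroot_height (?d - coroot (\<alpha> i))\<rfloor> < nat \<lfloor>coroot_height ?d\<rfloor>"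
      using coroot_height_less[OF d(1) lat] coroot_height_nonneg[OF cone]
      by (simp add: coroot_height_diff[of ?d "coroot _"] coroot_height_alpha[OF i(1)])
    then show ?thesis using less.hyps[of "v - coroot (\<alpha> i)"] v' cone unfolding eq by blast
  qed
qed

text \<open>
  Dominant elements are reached by descending from \<open>l\<close>. Any other element \<open>x\<close> has a negative
  coefficient at some \<open>\<alpha> i\<close>; its reflection is higher, and \<open>x\<close> is the lower end of a string
  that starts there.
\<close>

lemma saturated_subset:
  assumes X: "X \<subseteq> coweights \<omega>" and l: "l \<in> X"
    and lower: "\<And>v i j. v \<in> X \<Longrightarrow> i \<in> I \<Longrightarrow> 0 \<le> j \<Longrightarrow> of_int j \<le> v \<bullet> \<alpha> i
      \<Longrightarrow> v - of_int j *\<^sub>R coroot (\<alpha> i) \<in> X"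
    and x: "x \<in> coweights \<omega>" "x \<in> saturated_set R \<alpha> l"
  shows "x \<in> X"
  using x
proof (induction "nat \<lfloor>coroot_height (l - x)\<rfloor>" arbitrary: x rule: less_induct)
  case less
  have cone: "l - y \<in> pos_coroot_cone \<alpha>" if "y \<in> saturated_set R \<alpha> l" for y
    using that weyl_id by (auto simp: saturated_set_iff)
  show ?case
  proof (cases "dominant x")
    case True
    show ?thesis
    proof (rule descend_to_dominant[OF X _ True l cone[OF less.prems(2)]])
      fix v i assume "v \<in> X" "i \<in> I" "1 \<le> v \<bullet> \<alpha> i"
      then show "v - coroot (\<alpha> i) \<in> X" using lower[of v i 1] by simp
    qed
  next
    case False
    then obtain i where i: "i \<in> I" "x \<bullet> \<alpha> i < 0" by (auto simp: dominant_def)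
    obtain j where j: "x \<bullet> \<alpha> i = of_int j" using less.prems(1) i(1) coweights_iff Ints_cases by metis
    define y where "y = reflection (\<alpha> i) 0 x"
    have yx: "y = x - of_int j *\<^sub>R coroot (\<alpha> i)" by (simp add: y_def reflection_def j)
    have y: "y \<in> coweights \<omega>" "y \<in> saturated_set R \<alpha> l"
      unfolding y_def using less.prems reflection_coweight saturated_weyl weyl_reflection alpha_root[OF i(1)] by blast+
    have "coroot_height (l - y) = coroot_height (l - x) + of_int j"
      unfolding yx by (simp add: coroot_height_diff coroot_height_scale coroot_height_alpha[OF i(1)])
    then have "nat \<lfloor>coroot_height (l - y)\<rfloor> < nat \<lfloor>coroot_height (l - x)\<rfloor>"
      using cone[OF y(2)] cone[OF less.prems(2)] coroot_height_nonneg[OF cone[OF y(2)]] i(2) j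
      by (intro coroot_height_less) (simp_all add: pos_coroot_cone_iff)
    then have "y \<in> X" using y by (rule less.hyps)
    moreover have "y \<bullet> \<alpha> i = of_int (- j)"
      using reflection_inner[OF alpha_nonzero[OF i(1)], of 0 x] j by (simp add: y_def)
    ultimately have "y - of_int (- j) *\<^sub>R coroot (\<alpha> i) \<in> X" using lower[of y i "- j"] i j by simp
    then show ?thesis by (simp add: yx)
  qed
qed

section \<open>Minimal coset representatives\<close>

text \<open>
  Roots take values in \<open>(-1, 1)\<close> at alcoves that touch the origin, so the hyperplanes between two such
  alcoves pass through the origin.
\<close>

lemma len_weyl:
  assumes v: "v \<in> W0" shows "len v = card {b. positive b \<and> positive (- v b)}"
proof -
  let ?A = "{b. positive b \<and> positive (- v b)}"
  have "inversions v = (\<lambda>b. aff (- v b) 0) ` ?A"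
  proof
    show "inversions v \<subseteq> (\<lambda>b. aff (- v b) 0) ` ?A"
    proof
      fix f assume f: "f \<in> inversions v"
      then have "f \<in> affine_roots" "0 < f p0" "f (v p0) < 0" by (simp_all add: inversions_def)
      then obtain c k where c: "c \<in> R" "f = aff c k" "0 < aff c k p0" "aff c k (v p0) < 0"
        using affine_root_cases by metis
      let ?b = "- inv v c"
      have b: "?b \<in> R" using root_uminus weyl_root weyl_inverse(2) v c(1) by blast
      have vb: "v ?b = - c" using v by (simp add: weyl_minus)
      have neg: "of_int k < p0 \<bullet> ?b" using c(4) v by (simp add: aff_def weyl_adjoint)
      have lt1: "p0 \<bullet> ?b < 1"
        using positive_or_negative[OF b] alcove_positive[OF p0_alcove, of ?b]
          alcove_positive[OF p0_alcove, of "- ?b"] by fastforce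
      then have "(of_int k :: real) < 1" using neg by simp
      then have k: "k = 0" "positive c" using aff_p0_positive_cases[OF c(1,3)] by auto
      then have "positive ?b" using positive_iff_p0[OF b] neg by simp
      then have "?b \<in> ?A" using vb k(2) by simp
      moreover have "f = aff (- v ?b) 0" using vb c(2) k(1) by simp
      ultimately show "f \<in> (\<lambda>b. aff (- v b) 0) ` ?A" by blast
    qed
    show "(\<lambda>b. aff (- v b) 0) ` ?A \<subseteq> inversions v"
    proof
      fix f assume "f \<in> (\<lambda>b. aff (- v b) 0) ` ?A"
      then obtain b where b: "positive b" "positive (- v b)" "f = aff (- v b) 0" by blast
      then have "f (v p0) = - (p0 \<bullet> b)" using v by (simp add: aff_def weyl_orthogonal)
      then have "f (v p0) < 0" using alcove_positive(1)[OF p0_alcove b(1)] by simp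
      moreover have "0 < f p0" using alcove_positive(1)[OF p0_alcove b(2)] b(3) by (simp add: aff_def)
      moreover have "f \<in> affine_roots" using b(2,3) aff_affine_root positive_root by blast
      ultimately show "f \<in> inversions v" by (simp add: inversions_def)
    qed
  qed
  moreover have "inj_on (\<lambda>b. aff (- v b) 0) ?A"
    by (rule inj_onI) (metis aff_eq_iff minus_equation_iff v weyl_inv_apply(1))
  ultimately show ?thesis by (simp add: card_image)
qed

text \<open>
  An element \<open>z\<close> of the stabilizer permutes the positive roots that are not orthogonal to \<open>l\<close>, and \<open>v\<close>
  keeps the others positive. Hence all inversions of \<open>v\<close> are among the former, and \<open>z\<close> matches them
  with inversions of \<open>v \<circ> z\<close>.
\<close>

lemma min_coset_rep_if_simple_positive:
  assumes l: "dominant l" and v: "v \<in> W0"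
    and pos: "\<And>j. j \<in> I \<Longrightarrow> l \<bullet> \<alpha> j = 0 \<Longrightarrow> positive (v (\<alpha> j))"
  shows "v \<in> min_coset_reps R \<alpha> \<theta> l"
proof -
  have perp: "positive (v b)" if b: "positive b" "l \<bullet> b = 0" for b
  proof -
    have nonneg: "\<forall>i\<in>I. 0 \<le> (l \<bullet> \<alpha> i) * (\<omega> i \<bullet> b)"
      using l b(1) by (simp add: dominant_def positive_def)
    have "(\<Sum>i\<in>I. (l \<bullet> \<alpha> i) * (\<omega> i \<bullet> b)) = 0" using b(2) by (simp only: inner_expansion[symmetric])
    then have zero: "\<forall>i\<in>I. (l \<bullet> \<alpha> i) * (\<omega> i \<bullet> b) = 0"
      using sum_nonneg_eq_0_iff[OF finite_I, of "\<lambda>i. (l \<bullet> \<alpha> i) * (\<omega> i \<bullet> b)"] nonneg by blast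
    have "v b = v (\<Sum>i\<in>I. (\<omega> i \<bullet> b) *\<^sub>R \<alpha> i)" using alpha_expansion[of b] by metis
    also have "\<dots> = (\<Sum>i\<in>I. (\<omega> i \<bullet> b) *\<^sub>R v (\<alpha> i))"
      by (simp add: linear_sum[OF weyl_linear[OF v]] weyl_scale[OF v])
    finally have vb: "v b = (\<Sum>i\<in>I. (\<omega> i \<bullet> b) *\<^sub>R v (\<alpha> i))" .
    have "0 \<le> \<omega> k \<bullet> v b" if k: "k \<in> I" for k
      unfolding vb inner_sum_right inner_scaleR_right
    proof (rule sum_nonneg)
      fix i assume i: "i \<in> I"
      show "0 \<le> (\<omega> i \<bullet> b) * (\<omega> k \<bullet> v (\<alpha> i))"
      proof (cases "l \<bullet> \<alpha> i = 0")
        case True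
        then show ?thesis using pos[OF i True] b(1) i k by (simp add: positive_def)
      next
        case False
        then show ?thesis using zero i by auto
      qed
    qed
    then show ?thesis using weyl_root[OF v positive_root[OF b(1)]] by (simp add: positive_def)
  qed
  have "len v \<le> len (v \<circ> z)" if z: "z \<in> W0" "z l = l" for z
  proof -
    let ?A = "\<lambda>w. {b. positive b \<and> positive (- w b)}"
    have "card (?A v) \<le> card (?A (v \<circ> z))"
    proof (rule card_inj_on_le[of "inv z"])
      show "inj_on (inv z) (?A v)" using z(1) by (intro inj_on_inverseI[of _ z]) simp
      show "inv z ` ?A v \<subseteq> ?A (v \<circ> z)"
      proof
        fix c assume "c \<in> inv z ` ?A v"
        then obtain b where b: "positive b" "positive (- v b)" "c = inv z b" by blast
        have "l \<bullet> b \<noteq> 0" using perp[OF b(1)] b(2) not_positive_both by blast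
        then have "0 < l \<bullet> b" using dominant_positive[OF l b(1)] by simp
        then have "0 < l \<bullet> c" using weyl_adjoint[OF z(1), of l b] z(2) b(3) by simp
        moreover have "c \<in> R" using b weyl_root weyl_inverse(2) z(1) positive_root by blast
        ultimately have "positive c"
          using positive_or_negative[of c] dominant_positive[OF l, of "- c"] by auto
        then show "c \<in> ?A (v \<circ> z)" using b z(1) by simp
      qed
      show "finite (?A (v \<circ> z))" using finite_R positive_root by (auto intro: finite_subset[of _ R])
    qed
    then show ?thesis using len_weyl[OF v] len_weyl[OF weyl_comp[OF v z(1)]] by simp
  qed
  then show ?thesis
    using v weyl_length_eq_len weyl_ext weyl_comp by (simp add: min_coset_reps_def weyl_stabilizer_def)
qed

text \<open>
  The minimal element of the double coset places the fundamental alcove at the vertex \<open>l\<close> in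
  the corner closest to the origin, so a wall of the dominant chamber through \<open>l\<close> is a wall of
  that corner.
\<close>

lemma min_double_coset_rep_wall:
  assumes l: "l \<in> coweights \<omega>" "dominant l" and m: "min_double_coset_rep R \<alpha> \<theta> l m"
  shows "m 0 = l"
    and "j \<in> I \<Longrightarrow> l \<bullet> \<alpha> j = 0 \<Longrightarrow>
      0 < aff (\<alpha> j) 0 (m p0) \<and> (\<exists>k\<in>I. reflection (\<alpha> j) 0 \<circ> m = m \<circ> reflection (\<alpha> k) 0)"
proof -
  obtain v1 v2 where v12: "v1 \<in> W0" "v2 \<in> W0" "m = v1 \<circ> (+) l \<circ> v2"
    using m by (auto simp: min_double_coset_rep_def is_arg_min_def weyl_double_coset_def)
  define v where "v = v1 \<circ> v2"
  have v: "v \<in> W0" using v12 weyl_comp by (simp add: v_def)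
  have mW: "m \<in> We" using v12 ext_comp weyl_ext translation_ext[OF l(1)] by blast
  have min: "len m \<le> len w" if w: "w = u1 \<circ> m \<circ> u2" "u1 \<in> W0" "u2 \<in> W0" for w u1 u2
  proof -
    have "w = (u1 \<circ> v1) \<circ> (+) l \<circ> (v2 \<circ> u2)" using w(1) v12(3) by (simp add: comp_assoc)
    moreover have "u1 \<circ> v1 \<in> W0" "v2 \<circ> u2 \<in> W0" using w v12 weyl_comp by blast+
    ultimately have "w \<in> weyl_double_coset R l" unfolding weyl_double_coset_def by blast
    moreover have "w \<in> We" using w mW ext_comp weyl_ext by blast
    ultimately show ?thesis
      using m weyl_length_eq_len[OF mW] weyl_length_eq_len[of w]
      by (auto simp: min_double_coset_rep_def is_arg_min_def not_less)
  qed
  \<comment> \<open>Minimality under multiplication from the left puts the alcove of \<open>m\<close> into the dominant chamber.\<close>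
  have left: "0 < aff (\<alpha> i) 0 (m p0)" if i: "i \<in> I" for i
  proof -
    have "\<not> aff (\<alpha> i) 0 (m p0) < 0"
      using len_wall_less[OF wall_alpha[OF i] mW] min[of "reflection (\<alpha> i) 0 \<circ> m" "reflection (\<alpha> i) 0" id]
        weyl_reflection[OF alpha_root[OF i]] weyl_id by (auto simp del: comp_apply)
    then show ?thesis
      using affine_root_orbit[OF aff_affine_root[OF alpha_root[OF i]] mW, of 0] by simp
  qed
  have "dominant (m 0)"
    unfolding dominant_def
  proof
    fix i assume i: "i \<in> I"
    have "aff (\<alpha> i) 0 \<circ> m \<in> affine_roots" using affine_root_comp[OF aff_affine_root[OF alpha_root[OF i]] mW] .
    from affine_root_zero[OF this] left[OF i] show "0 \<le> m 0 \<bullet> \<alpha> i" by (simp add: aff_def)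
  qed
  moreover have m0: "m 0 = v1 l" using v12 by (simp add: weyl_zero)
  ultimately have v1l: "v1 l = l" using dominant_unique[OF l(2) v12(1)] by simp
  then show "m 0 = l" using m0 by simp
  have mv: "m x = l + v x" for x using v12 v1l by (simp add: weyl_add v_def)
  have minv: "inv m p0 = inv v (p0 - l)"
  proof -
    have "m (inv v (p0 - l)) = p0" using mv v by simp
    then show ?thesis using mW by (metis ext_inv_apply(1))
  qed
  \<comment> \<open>Minimality under multiplication from the right: no wall of this alcove through \<open>l\<close> separates it from the fundamental alcove.\<close>
  have right: "l \<bullet> v (\<alpha> k) < p0 \<bullet> v (\<alpha> k)" if k: "k \<in> I" for k
  proof -
    have ms: "m \<circ> reflection (\<alpha> k) 0 \<in> We" using mW ext_comp ext_reflection alpha_root k by blast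
    have "inv (m \<circ> reflection (\<alpha> k) 0) = reflection (\<alpha> k) 0 \<circ> inv m"
      using inv_comp_ext[OF mW ext_reflection[OF alpha_root[OF k]]] inv_reflection[OF alpha_root[OF k]] by simp
    then have "len (reflection (\<alpha> k) 0 \<circ> inv m) = len (m \<circ> reflection (\<alpha> k) 0)"
      using len_inverse[OF ms] by simp
    moreover have "len m \<le> len (m \<circ> reflection (\<alpha> k) 0)"
      by (rule min[of _ id "reflection (\<alpha> k) 0"]) (simp_all add: weyl_id weyl_reflection alpha_root k)
    ultimately have "\<not> aff (\<alpha> k) 0 (inv m p0) < 0"
      using len_wall_less[OF wall_alpha[OF k] ext_inverse(2)[OF mW]] len_inverse[OF mW] by linarith
    then have "0 < aff (\<alpha> k) 0 (inv m p0)"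
      using affine_root_orbit[OF aff_affine_root[OF alpha_root[OF k]] ext_inverse(2)[OF mW], of 0] by simp
    then show ?thesis
      using weyl_adjoint[OF weyl_inverse(2)[OF v], of "p0 - l" "\<alpha> k"] v weyl_inverse(1)[OF v]
      by (simp add: aff_def minv inner_diff_left inv_inv_eq)
  qed
  have vroot: "v (\<alpha> k) \<in> R" if "k \<in> I" for k using weyl_root v alpha_root that by blast
  have le0: "l \<bullet> v (\<alpha> k) \<le> 0" if k: "k \<in> I" for k
  proof (cases "positive (v (\<alpha> k))")
    case True
    have "l \<bullet> v (\<alpha> k) < 1" using right[OF k] alcove_positive(2)[OF p0_alcove True] by simp
    moreover have "l \<bullet> v (\<alpha> k) \<in> \<int>" using coweight_root_int[OF l(1) vroot[OF k]] .
    ultimately show ?thesis by (auto elim!: Ints_cases)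
  next
    case False
    then show ?thesis
      using not_positive_iff[OF vroot[OF k]] dominant_positive[OF l(2), of "- v (\<alpha> k)"] by simp
  qed
  have posv: "positive (v (\<alpha> k))" if k: "k \<in> I" "l \<bullet> v (\<alpha> k) = 0" for k
    using positive_iff_p0[OF vroot[OF k(1)]] right[OF k(1)] k(2) by simp
  assume j: "j \<in> I" "l \<bullet> \<alpha> j = 0"
  \<comment> \<open>As \<open>l\<close> is orthogonal to \<open>v b\<close> and no \<open>l \<bullet> v (\<alpha> k)\<close> is positive, all terms of the expansion of \<open>v b\<close> are orthogonal to \<open>l\<close>.\<close>
  have "\<exists>b. positive b \<and> (v b = \<alpha> j \<or> v b = - \<alpha> j)"
  proof -
    have "inv v (\<alpha> j) \<in> R" using weyl_root weyl_inverse(2) v alpha_root j(1) by blast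
    then consider "positive (inv v (\<alpha> j))" | "positive (- inv v (\<alpha> j))" using positive_or_negative by blast
    then show ?thesis using v by cases (auto simp: weyl_minus intro: exI[of _ "inv v (\<alpha> j)"] exI[of _ "- inv v (\<alpha> j)"])
  qed
  then obtain b where b: "positive b" "v b = \<alpha> j \<or> v b = - \<alpha> j" by blast
  have "v b = v (\<Sum>k\<in>I. (\<omega> k \<bullet> b) *\<^sub>R \<alpha> k)" using alpha_expansion[of b] by metis
  also have "\<dots> = (\<Sum>k\<in>I. (\<omega> k \<bullet> b) *\<^sub>R v (\<alpha> k))"
    by (simp add: linear_sum[OF weyl_linear[OF v]] weyl_scale[OF v])
  finally have vb: "v b = (\<Sum>k\<in>I. (\<omega> k \<bullet> b) *\<^sub>R v (\<alpha> k))" .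
  have coeff: "0 \<le> \<omega> k \<bullet> b" if "k \<in> I" for k using b(1) that by (simp add: positive_def)
  have "l \<bullet> v b = 0" using b(2) j(2) by auto
  then have "(\<Sum>k\<in>I. - ((\<omega> k \<bullet> b) * (l \<bullet> v (\<alpha> k)))) = 0"
    unfolding vb by (simp add: inner_sum_right sum_negf)
  moreover have "0 \<le> - ((\<omega> k \<bullet> b) * (l \<bullet> v (\<alpha> k)))" if "k \<in> I" for k
    using coeff[OF that] le0[OF that] by (simp add: mult_nonneg_nonpos)
  ultimately have "\<forall>k\<in>I. - ((\<omega> k \<bullet> b) * (l \<bullet> v (\<alpha> k))) = 0"
    using sum_nonneg_eq_0_iff[OF finite_I, of "\<lambda>k. - ((\<omega> k \<bullet> b) * (l \<bullet> v (\<alpha> k)))"] by blast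
  then have support: "positive (v (\<alpha> k))" if "k \<in> I" "\<omega> k \<bullet> b \<noteq> 0" for k
    using posv that by auto
  have terms: "0 \<le> (\<omega> k \<bullet> b) * (\<omega> i \<bullet> v (\<alpha> k))" if "k \<in> I" "i \<in> I" for i k
    using coeff[OF that(1)] support[OF that(1)] that(2) by (cases "\<omega> k \<bullet> b = 0") (auto simp: positive_def)
  have expand: "\<omega> i \<bullet> v b = (\<Sum>k\<in>I. (\<omega> k \<bullet> b) * (\<omega> i \<bullet> v (\<alpha> k)))" for i
    unfolding vb by (simp add: inner_sum_right)
  have "0 \<le> \<omega> i \<bullet> v b" if "i \<in> I" for i
    unfolding expand using terms that by (intro sum_nonneg) auto
  then have "v b = \<alpha> j" using b(2) j(1) omega_alpha[OF j(1) j(1)] by fastforce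
  obtain k where k: "k \<in> I" "0 < \<omega> k \<bullet> b" using positive_has_coefficient b(1) by blast
  have vk: "positive (v (\<alpha> k))" using support k by simp
  have "\<omega> i \<bullet> v (\<alpha> k) = 0" if i: "i \<in> I" "i \<noteq> j" for i
  proof -
    have "(\<Sum>k\<in>I. (\<omega> k \<bullet> b) * (\<omega> i \<bullet> v (\<alpha> k))) = 0"
      unfolding expand[symmetric] \<open>v b = \<alpha> j\<close> using i j(1) omega_alpha by simp
    then have "\<forall>k\<in>I. (\<omega> k \<bullet> b) * (\<omega> i \<bullet> v (\<alpha> k)) = 0"
      using sum_nonneg_eq_0_iff[OF finite_I, of "\<lambda>k. (\<omega> k \<bullet> b) * (\<omega> i \<bullet> v (\<alpha> k))"] terms i(1) by blast
    then show ?thesis using k by auto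
  qed
  then have "v (\<alpha> k) = \<alpha> j" using positive_not_simple_coefficient[OF vk _ j(1)] by force
  then have "v \<circ> reflection (\<alpha> k) 0 = reflection (\<alpha> j) 0 \<circ> v" using weyl_conj_reflection[OF v, of "\<alpha> k"] by simp
  from fun_cong[OF this] have "v (reflection (\<alpha> k) 0 x) = reflection (\<alpha> j) 0 (v x)" for x by simp
  then have "reflection (\<alpha> j) 0 \<circ> m = m \<circ> reflection (\<alpha> k) 0"
    using j(2) by (auto simp: fun_eq_iff mv reflection_def inner_add_left)
  then show "0 < aff (\<alpha> j) 0 (m p0) \<and> (\<exists>k\<in>I. reflection (\<alpha> j) 0 \<circ> m = m \<circ> reflection (\<alpha> k) 0)"
    using left[OF j(1)] k(1) by blast
qed

text \<open>
  A simple reflection that stabilizes \<open>l\<close> can be moved from the front of the minimal word to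
  its end, where it fixes the vertex. Hence starting at \<open>v s\<close> yields no vertices beyond those
  reached from \<open>v\<close>.
\<close>

lemma stabilizing_letter_superfluous:
  assumes l: "l \<in> coweights \<omega>" "dominant l" and m: "min_double_coset_rep R \<alpha> \<theta> l m"
    and M: "reduced_expression R \<alpha> \<theta> \<omega> M g m"
    and j: "j \<in> I" "l \<bullet> \<alpha> j = 0" and v: "v \<in> W0"
    and y: "y \<in> walk_ends upward (map letter M) {v \<circ> reflection (\<alpha> j) 0}"
  shows "\<exists>z\<in>walk_ends upward (map letter M) {v}. z (g 0) = y (g 0)"
proof -
  let ?M = "map letter M" and ?s = "reflection (\<alpha> j) 0"
  note M' = reduced_expressionD[OF M]
  have g: "g \<in> We" using flat_ext[OF M'(2)] .
  obtain k where k: "k \<in> I" "?s \<circ> m = m \<circ> reflection (\<alpha> k) 0" and mpos: "0 < aff (\<alpha> j) 0 (m p0)"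
    using min_double_coset_rep_wall(2)[OF l m j] by blast
  have f: "aff (\<alpha> k) 0 \<circ> inv g \<in> affine_roots"
    using affine_root_comp[OF aff_affine_root[OF alpha_root[OF k(1)]] ext_inverse(2)[OF g]] .
  then obtain b q where b: "aff (\<alpha> k) 0 \<circ> inv g = aff b q" by (rule affine_root_cases)
  \<comment> \<open>The letter \<open>(b, q)\<close> acts after \<open>g\<close> as \<open>\<alpha> k\<close> acts before it; it need not be the letter of a root \<open>\<alpha> i\<close>.\<close>
  have wb: "wall b q" by (rule wall_conj_flat[OF wall_alpha[OF k(1)] M'(2) b])
  have conj: "g \<circ> reflection (\<alpha> k) 0 = reflection b q \<circ> g"
    by (rule comp_reflection[OF g alpha_root[OF k(1)] b])
  have wj: "wall (\<alpha> j) 0" by (rule wall_alpha[OF j(1)])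
  have WM: "word ?M \<in> We" using word_ext[OF M'(4)] .
  have "(?s \<circ> word ?M) \<circ> g = (word ?M \<circ> reflection b q) \<circ> g"
    using k(2) conj unfolding M'(3) by (metis comp_assoc)
  then have "(?s \<circ> word ?M) \<circ> (g \<circ> inv g) = (word ?M \<circ> reflection b q) \<circ> (g \<circ> inv g)"
    by (metis comp_assoc)
  then have words: "?s \<circ> word ?M = word ?M \<circ> reflection b q" using g by simp
  have "len m = length ?M"
    using M'(5) inversions_comp_flat[OF WM M'(2)] M'(3) by (simp add: reduced_word_def)
  moreover have "len (?s \<circ> m) = len (?s \<circ> word ?M)"
    using inversions_comp_flat[OF ext_comp[OF wall_ext[OF wj] WM] M'(2)] M'(3) by (simp only: comp_assoc)
  ultimately have len: "len (?s \<circ> word ?M) = Suc (length ?M)"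
    using len_wall_greater[OF wj M'(6) mpos] len_wall_le[OF wj M'(6)] by linarith
  have w1: "word ((\<alpha> j, 0) # ?M) = ?s \<circ> word ?M" by (rule word_simps)
  have w2: "word (?M @ [(b, q)]) = word ?M \<circ> reflection b q" by (simp add: word_append)
  have "reduced_word ((\<alpha> j, 0) # ?M)" "reduced_word (?M @ [(b, q)])"
    unfolding reduced_word_def w1 w2 using len words by simp_all
  then have indep: "walk_ends upward ((\<alpha> j, 0) # ?M) {v} = walk_ends upward (?M @ [(b, q)]) {v}"
    using M'(4) wb wj words w1 w2 weyl_ext[OF v]
    by (intro walk_ends_upward_word_independent) simp_all
  have "y \<in> walk_ends upward ?M (fold_step upward (\<alpha> j) 0 {v})"
    using y subsetD[OF walk_ends_mono[of "{v \<circ> ?s}" "fold_step upward (\<alpha> j) 0 {v}" upward ?M]]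
    by (simp add: fold_step_single)
  then have "y \<in> fold_step upward b q (walk_ends upward ?M {v})"
    using indep by (simp add: walk_ends_append)
  then obtain z where z: "z \<in> walk_ends upward ?M {v}" "y = z \<circ> reflection b q \<or> y = z"
    by (auto simp: fold_step_def)
  have "reflection b q (g 0) = g 0" using fun_cong[OF conj, of 0] by (simp add: reflection_def)
  then have "z (g 0) = y (g 0)" using z(2) by auto
  then show ?thesis using z(1) by blast
qed

lemma start_at_min_coset_rep:
  assumes l: "l \<in> coweights \<omega>" "dominant l" and m: "min_double_coset_rep R \<alpha> \<theta> l m"
    and M: "reduced_expression R \<alpha> \<theta> \<omega> M g m"
    and v: "v \<in> W0" and y: "y \<in> walk_ends upward (map letter M) {v}"
  shows "\<exists>u\<in>min_coset_reps R \<alpha> \<theta> l. \<exists>z\<in>walk_ends upward (map letter M) {u}. z (g 0) = y (g 0)"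
  using v y
proof (induction "len v" arbitrary: v y rule: less_induct)
  case less
  show ?case
  proof (cases "v \<in> min_coset_reps R \<alpha> \<theta> l")
    case True
    then show ?thesis using less.prems by blast
  next
    case False
    then obtain j where j: "j \<in> I" "l \<bullet> \<alpha> j = 0" "\<not> positive (v (\<alpha> j))"
      using min_coset_rep_if_simple_positive[OF l(2) less.prems(1)] by blast
    let ?s = "reflection (\<alpha> j) 0"
    have s: "?s \<in> W0" using weyl_reflection alpha_root j(1) by blast
    have vs: "v \<circ> ?s \<in> W0" using less.prems(1) s weyl_comp by blast
    have "v (\<alpha> j) \<in> R" using weyl_root less.prems(1) alpha_root j(1) by blast
    then have "p0 \<bullet> v (\<alpha> j) < 0"
      using not_positive_iff j(3) positive_iff_p0[of "- v (\<alpha> j)"] root_uminus by simp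
    then have "aff (\<alpha> j) 0 (inv v p0) < 0"
      using weyl_adjoint[OF weyl_inverse(2)[OF less.prems(1)], of p0 "\<alpha> j"] weyl_inverse(1)[OF less.prems(1)]
      by (simp add: aff_def inv_inv_eq)
    then have "len (?s \<circ> inv v) < len (inv v)"
      using len_wall_less[OF wall_alpha[OF j(1)] weyl_ext[OF weyl_inverse(2)[OF less.prems(1)]]] by simp
    moreover have "inv (v \<circ> ?s) = ?s \<circ> inv v"
      using inv_comp_ext[OF weyl_ext[OF less.prems(1)] weyl_ext[OF s]] inv_reflection[OF alpha_root[OF j(1)]] by simp
    ultimately have lt: "len (v \<circ> ?s) < len v"
      using len_inverse[OF weyl_ext[OF vs]] len_inverse[OF weyl_ext[OF less.prems(1)]] by simp
    have "v \<circ> ?s \<circ> ?s = v" using alpha_nonzero[OF j(1)] by (auto simp: fun_eq_iff)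
    then obtain z where z: "z \<in> walk_ends upward (map letter M) {v \<circ> ?s}" "z (g 0) = y (g 0)"
      using stabilizing_letter_superfluous[OF l m M j(1,2) vs, of y] less.prems(2) by metis
    show ?thesis using less.hyps[OF lt vs z(1)] z(2) by simp
  qed
qed

section \<open>Walks with prescribed ends\<close>

lemma folded_stepI:
  assumes x: "x \<in> We" and w: "letter i = (a, k)" "wall a k"
    and x': "x' = x \<circ> reflection a k \<or> x' = x \<and> upward (aff a k \<circ> inv x)"
  shows "folded_step R \<alpha> \<theta> i x x'"
proof -
  let ?xs = "x \<circ> reflection a k"
  have xs: "?xs \<in> We" using ext_comp[OF x wall_ext[OF w(2)]] .
  obtain c q where c: "c \<in> R" "aff a k \<circ> inv x = aff c q"
    using affine_root_comp[OF aff_affine_root[OF wall_root[OF w(2)]] ext_inverse(2)[OF x]] affine_root_cases by blast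
  have side: "0 < aff c q (x p0)" "aff c q (?xs p0) < 0"
    unfolding c(2)[symmetric] using x wall_pos[OF w(2)] wall_aff_reflection[OF w(2)] by simp_all
  have step: "folded_step R \<alpha> \<theta> i x x' \<longleftrightarrow>
      negative_to_positive R \<alpha> \<theta> x ?xs \<and> x' = ?xs \<or> negative_to_positive R \<alpha> \<theta> ?xs x \<and> (x' = ?xs \<or> x' = x)"
    by (auto simp: folded_step_def Let_def simple_reflection_letter w(1))
  show ?thesis
  proof (cases "positive c")
    case True
    then have "negative_to_positive R \<alpha> \<theta> ?xs x"
      unfolding negative_to_positive_def positive_roots_eq[symmetric]
      using alcove_side(2)[OF c(1) xs, of q] alcove_side(1)[OF c(1) x, of q] side by blast
    then show ?thesis using step x' by blast
  next
    case False
    then have n: "positive (- c)" using c(1) not_positive_iff by blast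
    then have "x' = ?xs" using x' False c(2) by simp
    moreover have "0 < aff (- c) (- q) (?xs p0)" "aff (- c) (- q) (x p0) < 0"
      using side by (simp_all add: aff_minus)
    then have "negative_to_positive R \<alpha> \<theta> x ?xs"
      unfolding negative_to_positive_def
      using alcove_side(1)[OF root_uminus[OF c(1)] xs, of "- q"]
        alcove_side(2)[OF root_uminus[OF c(1)] x, of "- q"] n positive_roots_eq by blast
    ultimately show ?thesis using step by blast
  qed
qed

lemma walk_with_end:
  assumes "set is \<subseteq> {0..DIM('a)}" "Y \<subseteq> affine_weyl R" "y \<in> walk_ends upward (map letter is) Y"
  shows "\<exists>p. length p = Suc (length is) \<and> set p \<subseteq> affine_weyl R \<and> p ! 0 \<in> Y \<and> last p = y \<and>
    (\<forall>k<length is. folded_step R \<alpha> \<theta> (is ! k) (p ! k) (p ! Suc k))"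
  using assms
proof (induction "is" arbitrary: Y)
  case Nil
  then show ?case by (intro exI[of _ "[y]"]) auto
next
  case (Cons i "is")
  obtain a k where a: "letter i = (a, k)" by fastforce
  have w: "wall a k" using letter_wall[OF _ a] Cons.prems(1) by simp
  have sub: "fold_step upward a k Y \<subseteq> affine_weyl R"
    using Cons.prems(2) affine_comp_reflection[OF _ wall_root[OF w]] by (auto simp: fold_step_def)
  have "y \<in> walk_ends upward (map letter is) (fold_step upward a k Y)" using Cons.prems(3) a by simp
  then obtain p where p: "length p = Suc (length is)" "set p \<subseteq> affine_weyl R"
    "p ! 0 \<in> fold_step upward a k Y" "last p = y"
    "\<forall>k<length is. folded_step R \<alpha> \<theta> (is ! k) (p ! k) (p ! Suc k)"
    using Cons.IH[OF _ sub] Cons.prems(1) by auto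
  then obtain x where x: "x \<in> Y" "p ! 0 = x \<circ> reflection a k \<or> p ! 0 = x \<and> upward (aff a k \<circ> inv x)"
    by (auto simp: fold_step_def)
  have xA: "x \<in> affine_weyl R" using x(1) Cons.prems(2) by blast
  have first: "folded_step R \<alpha> \<theta> i x (p ! 0)" by (rule folded_stepI[OF affine_ext[OF xA] a w x(2)])
  have "folded_step R \<alpha> \<theta> ((i # is) ! k) ((x # p) ! k) ((x # p) ! Suc k)" if "k < length (i # is)" for k
    using first p(5) that by (cases k) auto
  moreover have "p \<noteq> []" using p(1) by auto
  ultimately show ?case
    using p x(1) xA by (intro exI[of _ "x # p"]) auto
qed

lemma folded_paths_nonempty:
  assumes l: "l \<in> coweights \<omega>" "dominant l"
    and U: "\<And>u. u \<in> min_coset_reps R \<alpha> \<theta> l \<Longrightarrow> reduced_expression R \<alpha> \<theta> \<omega> (U u) id u"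
    and m: "min_double_coset_rep R \<alpha> \<theta> l m" and M: "reduced_expression R \<alpha> \<theta> \<omega> M g m"
    and x: "x \<in> coweights \<omega>" "x \<in> saturated_set R \<alpha> l"
  shows "folded_paths R \<alpha> \<theta> U M g l x \<noteq> {}"
proof -
  let ?M = "map letter M" and ?G = "walk_ends upward (map letter M) W0"
  let ?X = "(\<lambda>y. y (g 0)) ` ?G"
  note M' = reduced_expressionD[OF M]
  have GW: "?G \<subseteq> We" using walk_ends_ext[OF M'(4)] weyl_ext by blast
  have "x \<in> ?X"
  proof (rule saturated_subset[OF _ _ _ x])
    show "?X \<subseteq> coweights \<omega>"
    proof
      fix v assume "v \<in> ?X"
      then obtain y where "y \<in> ?G" "v = (y \<circ> g) 0" by auto
      then show "v \<in> coweights \<omega>"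
        using ext_zero_coweight[OF ext_comp[OF _ flat_ext[OF M'(2)]]] GW by blast
    qed
    have "id \<circ> word ?M \<in> ?G" by (rule unfolded_end[OF weyl_id])
    moreover have "word ?M (g 0) = l" using min_double_coset_rep_wall(1)[OF l m] M'(3) by simp
    ultimately show "l \<in> ?X" by force
    fix v i j assume v: "v \<in> ?X" "i \<in> I" "0 \<le> j" "of_int j \<le> v \<bullet> \<alpha> i"
    then obtain y where y: "y \<in> ?G" "v = y (g 0)" by blast
    then obtain z where "z \<in> ?G" "z (g 0) = v - of_int j *\<^sub>R coroot (\<alpha> i)"
      using vertex_string[OF v(2) M'(4,2) y(1) GW v(3)] v(4) by blast
    then show "v - of_int j *\<^sub>R coroot (\<alpha> i) \<in> ?X"
      by (intro image_eqI[of _ "\<lambda>y. y (g 0)" z]) simp_all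
  qed
  then obtain y where y: "y \<in> ?G" "y (g 0) = x" by blast
  then obtain v where "v \<in> W0" "y \<in> walk_ends upward ?M {v}" using walk_ends_singletons[of upward ?M W0] by blast
  then obtain u z where u: "u \<in> min_coset_reps R \<alpha> \<theta> l" and z: "z \<in> walk_ends upward ?M {u}" "z (g 0) = x"
    using start_at_min_coset_rep[OF l m M] y(2) by blast
  note U' = reduced_expressionD[OF U[OF u]]
  have "id \<circ> word (map letter (U u)) \<in> walk_ends upward (map letter (U u)) {id}" by (rule unfolded_end) simp
  then have "{u} \<subseteq> walk_ends upward (map letter (U u)) {id}" using U'(3) by simp
  then have "walk_ends upward ?M {u} \<subseteq> walk_ends upward ?M (walk_ends upward (map letter (U u)) {id})"
    by (rule walk_ends_mono)
  then have zU: "z \<in> walk_ends upward (map letter (U u @ M)) {id}"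
    using z(1) by (auto simp: walk_ends_append)
  have "id \<in> affine_weyl R" by (simp add: affine_weyl_def generated_by_reflections.id)
  then obtain p where p: "folded_walk R \<alpha> \<theta> (U u @ M) p" "last p = z"
    using walk_with_end[OF _ _ zU] U'(1) M'(1) by (auto simp: folded_walk_def)
  have "z \<in> We"
    using walk_ends_ext[of "map letter (U u @ M)" "{id}"] zU U'(4) M'(4) ext_id by auto
  then have "z \<circ> g \<in> We" using flat_ext[OF M'(2)] ext_comp by blast
  then obtain t w where t: "w \<in> W0" "\<And>v. (z \<circ> g) v = t + w v" using ext_cases by blast
  then have "t = x" using t(2)[of 0] z(2) weyl_zero[OF t(1)] by simp
  then have "walk_end p g = (+) x \<circ> w" using t(2) p(2) by (auto simp: walk_end_def fun_eq_iff)
  then show ?thesis using p(1) u t(1) unfolding folded_paths_def by blast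
qed

end

theorem theoremC:
  fixes R :: "'a::euclidean_space set"
    and \<alpha> \<omega> :: "nat \<Rightarrow> 'a"
    and \<theta> l \<mu> :: 'a
    and U :: "('a \<Rightarrow> 'a) \<Rightarrow> nat list"
    and M :: "nat list"
    and \<gamma> m :: "'a \<Rightarrow> 'a"
  assumes "reduced_root_system R" and "irreducible_root_system R"
    and "simple_roots R \<alpha>"
    and "highest_root R \<alpha> \<theta>"
    and "fundamental_coweights \<alpha> \<omega>"
    and "l \<in> dominant_coweights \<omega>"
    and "\<mu> \<in> coweights \<omega>"
    and "\<And>u. u \<in> min_coset_reps R \<alpha> \<theta> l \<Longrightarrow> reduced_expression R \<alpha> \<theta> \<omega> (U u) id u"
    and "min_double_coset_rep R \<alpha> \<theta> l m"
    and "reduced_expression R \<alpha> \<theta> \<omega> M \<gamma> m"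
  shows "folded_paths R \<alpha> \<theta> U M \<gamma> l \<mu> \<noteq> {} \<longleftrightarrow> \<mu> \<in> saturated_set R \<alpha> l"
proof -
  interpret root_datum R \<alpha> \<omega> \<theta> "{1..DIM('a)}"
    using assms(1,3-5) by unfold_locales auto
  have l: "l \<in> coweights \<omega>" "dominant l"
    using assms(6) unfolding dominant_coweights_iff coweights_iff dominant_def
    by (auto simp: Nats_altdef2)
  show ?thesis
  proof
    assume "folded_paths R \<alpha> \<theta> U M \<gamma> l \<mu> \<noteq> {}"
    then obtain p u w where p: "u \<in> min_coset_reps R \<alpha> \<theta> l" "folded_walk R \<alpha> \<theta> (U u @ M) p"
      "walk_end p \<gamma> = (+) \<mu> \<circ> w" "w \<in> W0"
      by (auto simp: folded_paths_def)
    moreover have "u \<in> W0" using p(1) by (simp add: min_coset_reps_def)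
    moreover have "m \<in> weyl_double_coset R l"
      using assms(9) by (simp add: min_double_coset_rep_def is_arg_min_def)
    ultimately show "\<mu> \<in> saturated_set R \<alpha> l"
      using folded_walk_end_saturated[OF l assms(8)] assms(10) by blast
  next
    assume "\<mu> \<in> saturated_set R \<alpha> l"
    then show "folded_paths R \<alpha> \<theta> U M \<gamma> l \<mu> \<noteq> {}"
      using folded_paths_nonempty[OF l assms(8-10,7)] by blast
  qed
qed

end
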